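(* Let $k$ be an algebraically closed field with $\operatorname{char}(k)\ne2$, let $A=A(\alpha,\beta,\gamma)$ be a 4-dimensional Sklyanin algebra over $k$ whose associated automorphism $\sigma$ has infinite order, and let $B^{G,\mu}$ be the cocycle twist of $B=A/(\Omega_1,\Omega_2)$ described in the context. Then $B^{G,\mu}$ is a prime ring.
   Context: Write $[x,y]=xy-yx$, $[x,y]_+=xy+yx$. The parameters satisfy $\alpha+\beta+\gamma+\alpha\beta\gamma=0$, $\{\alpha,\beta,\gamma\}\cap\{0,\pm1\}=\emptyset$; $A$ is generated by $x_0,\dots,x_3$ (degree 1) with relations $[x_0,x_1]-\alpha[x_2,x_3]_+$, $[x_0,x_1]_+-[x_2,x_3]$, $[x_0,x_2]-\beta[x_3,x_1]_+$, $[x_0,x_2]_+-[x_3,x_1]$, $[x_0,x_3]-\gamma[x_1,x_2]_+$, $[x_0,x_3]_+-[x_1,x_2]$. Associated geometry: the elliptic curve $E\subset\mathbb{P}^3_k$, $y_0^2+y_1^2+y_2^2+y_3^2=0$, $y_3^2+\frac{1-\gamma}{1+\alpha}y_1^2+\frac{1+\gamma}{1-\beta}y_2^2=0$, parameterises (with four extra points) the point modules over $A$ (cyclic $\mathbb{N}$-graded right modules with Hilbert series $1/(1-t)$); $\sigma$ is the translation automorphism of $E$ with $M_p[1]_{\ge0}\cong M_{\sigma(p)}$. $\Omega_1=-x_0^2+x_1^2+x_2^2+x_3^2$ and $\Omega_2=x_1^2+\frac{1+\alpha}{1-\beta}x_2^2+\frac{1-\alpha}{1+\gamma}x_3^2$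 are central in $A$, and $B=A/(\Omega_1,\Omega_2)$. $G=\langle g_1,g_2\rangle\cong(C_2)^2$ acts on $B$ by $x_0^{g_1}=x_0$, $x_1^{g_1}=x_1$, $x_2^{g_1}=-x_2$, $x_3^{g_1}=-x_3$, $x_i^{g_2}=(-1)^ix_i$, inducing a $G$-grading with $x_0,x_1,x_2,x_3$ in degrees $e,g_1,g_2,g_1g_2$. With $\mu(g_1^pg_2^q,g_1^rg_2^s)=(-1)^{ps}$ ($p,q,r,s\in\{0,1\}$), $B^{G,\mu}$ is $B$ with multiplication $a\ast_\mu b=\mu(g,h)ab$ for $a\in B_g,b\in B_h$. *)

theory Defs
  imports
    "HOL-Algebra.Algebraic_Closure_Type"
    "HOL-Algebra.Ideal_Product"
    "HOL-Library.Poly_Mapping"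
begin

section \<open>Prime rings\<close>

text \<open>The zero ideal is a prime ideal, in the sense of noncommutative ring theory. The library's
  \<open>primeideal\<close> is the notion for commutative rings (and presupposes commutativity).\<close>

definition prime_ring :: "('a, 'b) ring_scheme \<Rightarrow> bool" where
  "prime_ring R \<longleftrightarrow> ring R \<and> \<one>\<^bsub>R\<^esub> \<noteq> \<zero>\<^bsub>R\<^esub> \<and>
     (\<forall>I J. ideal I R \<longrightarrow> ideal J R \<longrightarrow> I \<cdot>\<^bsub>R\<^esub> J = {\<zero>\<^bsub>R\<^esub>} \<longrightarrow> I = {\<zero>\<^bsub>R\<^esub>} \<or> J = {\<zero>\<^bsub>R\<^esub>})"


section \<open>Internal direct sums, graded modules, cocycle twists\<close>

definition is_decomposition ::
    "('m, 'z) ring_scheme \<Rightarrow> ('i \<Rightarrow> 'm set) \<Rightarrow> 'm \<Rightarrow> ('i \<Rightarrow> 'm) \<Rightarrow> bool" where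
  "is_decomposition M C m c \<longleftrightarrow>
     (\<forall>i. c i \<in> C i) \<and> finite {i. c i \<noteq> \<zero>\<^bsub>M\<^esub>} \<and> m = (\<Oplus>\<^bsub>M\<^esub>i\<in>{i. c i \<noteq> \<zero>\<^bsub>M\<^esub>}. c i)"

definition homogeneous_part ::
    "('m, 'z) ring_scheme \<Rightarrow> ('i \<Rightarrow> 'm set) \<Rightarrow> 'm \<Rightarrow> 'i \<Rightarrow> 'm" where
  "homogeneous_part M C m = (THE c. is_decomposition M C m c)"

text \<open>Right modules are carried by the library's record \<open>module\<close>, whose scalar operation is
  written on the left: \<open>a \<odot>\<^bsub>M\<^esub> m\<close> stands for the right action \<open>m \<cdot> a\<close>, so that a product
  \<open>a \<otimes> b\<close> acts by \<open>a\<close> first.\<close>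

record ('a, 'm) graded_module = "('a, 'm) module" +
  component :: "nat \<Rightarrow> 'm set"

locale graded_right_module = R?: ring R + M?: abelian_group M
  for R :: "'a ring" (structure) and R_deg :: "nat \<Rightarrow> 'a set"
    and M :: "('a, 'm) graded_module" (structure) +
  assumes action_closed:
      "a \<in> carrier R \<Longrightarrow> m \<in> carrier M \<Longrightarrow> a \<odot>\<^bsub>M\<^esub> m \<in> carrier M"
    and action_distrib_ring:
      "a \<in> carrier R \<Longrightarrow> b \<in> carrier R \<Longrightarrow> m \<in> carrier M \<Longrightarrow>
         (a \<oplus>\<^bsub>R\<^esub> b) \<odot>\<^bsub>M\<^esub> m = a \<odot>\<^bsub>M\<^esub> m \<oplus>\<^bsub>M\<^esub> b \<odot>\<^bsub>M\<^esub> m"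
    and action_distrib_module:
      "a \<in> carrier R \<Longrightarrow> m \<in> carrier M \<Longrightarrow> m' \<in> carrier M \<Longrightarrow>
         a \<odot>\<^bsub>M\<^esub> (m \<oplus>\<^bsub>M\<^esub> m') = a \<odot>\<^bsub>M\<^esub> m \<oplus>\<^bsub>M\<^esub> a \<odot>\<^bsub>M\<^esub> m'"
    and action_mult:
      "a \<in> carrier R \<Longrightarrow> b \<in> carrier R \<Longrightarrow> m \<in> carrier M \<Longrightarrow>
         (a \<otimes>\<^bsub>R\<^esub> b) \<odot>\<^bsub>M\<^esub> m = b \<odot>\<^bsub>M\<^esub> (a \<odot>\<^bsub>M\<^esub> m)"
    and action_one: "m \<in> carrier M \<Longrightarrow> \<one>\<^bsub>R\<^esub> \<odot>\<^bsub>M\<^esub> m = m"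
    and component_subgroup: "additive_subgroup (component M n) M"
    and component_direct_sum:
      "m \<in> carrier M \<Longrightarrow> \<exists>!c. is_decomposition M (component M) m c"
    and component_action:
      "a \<in> R_deg i \<Longrightarrow> m \<in> component M n \<Longrightarrow> a \<odot>\<^bsub>M\<^esub> m \<in> component M (n + i)"

text \<open>The truncated shift \<open>M[1]\<^sub>\<ge>\<^sub>0\<close>: its component in degree \<open>n\<close> is \<open>M\<^sub>n\<^sub>+\<^sub>1\<close>, and its underlying
  module is the submodule \<open>M\<^sub>\<ge>\<^sub>1\<close> of \<open>M\<close>.\<close>

definition shift_module :: "('a, 'm) graded_module \<Rightarrow> ('a, 'm) graded_module" where
  "shift_module M = M
     \<lparr>carrier := {m \<in> carrier M. homogeneous_part M (component M) m 0 = \<zero>\<^bsub>M\<^esub>},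
      component := (\<lambda>n. component M (Suc n))\<rparr>"

definition graded_isomorphic ::
    "'a ring \<Rightarrow> ('a, 'm) graded_module \<Rightarrow> ('a, 'n) graded_module \<Rightarrow> bool" where
  "graded_isomorphic R M N \<longleftrightarrow> (\<exists>f.
     bij_betw f (carrier M) (carrier N) \<and>
     (\<forall>m\<in>carrier M. \<forall>n\<in>carrier M. f (m \<oplus>\<^bsub>M\<^esub> n) = f m \<oplus>\<^bsub>N\<^esub> f n) \<and>
     (\<forall>a\<in>carrier R. \<forall>m\<in>carrier M. f (a \<odot>\<^bsub>M\<^esub> m) = a \<odot>\<^bsub>N\<^esub> f m) \<and>
     (\<forall>n. f ` component M n = component N n))"

text \<open>Here \<open>\<iota>\<close> is the structure map from the ground field. Hilbert series \<open>1/(1 - t)\<close> means that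
  every component is one-dimensional.\<close>

definition point_module ::
    "'a ring \<Rightarrow> ('k::field \<Rightarrow> 'a) \<Rightarrow> (nat \<Rightarrow> 'a set) \<Rightarrow> ('a, 'm) graded_module \<Rightarrow> bool" where
  "point_module R \<iota> R_deg M \<longleftrightarrow>
     graded_right_module R R_deg M \<and>
     (\<exists>m\<in>carrier M. carrier M = {a \<odot>\<^bsub>M\<^esub> m | a. a \<in> carrier R}) \<and>
     (\<forall>n. \<exists>m\<in>component M n. m \<noteq> \<zero>\<^bsub>M\<^esub> \<and> component M n = {\<iota> c \<odot>\<^bsub>M\<^esub> m | c. True})"

text \<open>The multiplication with \<open>a * b = \<mu>(g, h) a b\<close> for \<open>a\<close>, \<open>b\<close> homogeneous of degrees \<open>g\<close>, \<open>h\<close>,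
  extended biadditively.\<close>

definition cocycle_twist ::
    "'a ring \<Rightarrow> ('k \<Rightarrow> 'a) \<Rightarrow> ('g::finite \<Rightarrow> 'a set) \<Rightarrow> ('g \<Rightarrow> 'g \<Rightarrow> 'k) \<Rightarrow> 'a ring" where
  "cocycle_twist R \<iota> C \<mu> = R
     \<lparr>mult := (\<lambda>a b. \<Oplus>\<^bsub>R\<^esub>g\<in>UNIV. \<Oplus>\<^bsub>R\<^esub>h\<in>UNIV.
        \<iota> (\<mu> g h) \<otimes>\<^bsub>R\<^esub> (homogeneous_part R C a g \<otimes>\<^bsub>R\<^esub> homogeneous_part R C b h))\<rparr>"


section \<open>The free algebra on four generators\<close>

datatype gen = X0 | X1 | X2 | X3

instance gen :: finite
proof
  have "(UNIV :: gen set) = {X0, X1, X2, X3}"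
    using gen.exhaust by auto
  then show "finite (UNIV :: gen set)"
    by (metis finite.emptyI finite.insertI)
qed

text \<open>The free monoid, written additively as required for the convolution product on
  \<open>word \<Rightarrow>\<^sub>0 'k\<close>, which is thereby the free algebra.\<close>

datatype word = Word (letters: "gen list")

instantiation word :: monoid_add
begin
definition "0 = Word []"
definition "u + v = Word (letters u @ letters v)"
instance
  by standard (simp_all add: zero_word_def plus_word_def)
end

type_synonym 'k free_alg = "word \<Rightarrow>\<^sub>0 'k"

definition scalar :: "'k::field \<Rightarrow> 'k free_alg" where
  "scalar c = Poly_Mapping.single 0 c"

definition xgen :: "gen \<Rightarrow> 'k::field free_alg" where
  "xgen i = Poly_Mapping.single (Word [i]) 1"

definition free_deg :: "nat \<Rightarrow> 'k::field free_alg set" where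
  "free_deg n = {f. \<forall>w\<in>Poly_Mapping.keys f. length (letters w) = n}"

abbreviation free_ring :: "'k::field free_alg ring" where
  "free_ring \<equiv> ring_of_type_algebra"


section \<open>The Sklyanin algebra and its quotient\<close>

definition sklyanin_parameters :: "'k::field \<Rightarrow> 'k \<Rightarrow> 'k \<Rightarrow> bool" where
  "sklyanin_parameters \<alpha> \<beta> \<gamma> \<longleftrightarrow>
     \<alpha> + \<beta> + \<gamma> + \<alpha> * \<beta> * \<gamma> = 0 \<and> {\<alpha>, \<beta>, \<gamma>} \<inter> {0, 1, -1} = {}"

definition commutator :: "'a::ring_1 \<Rightarrow> 'a \<Rightarrow> 'a" where
  "commutator x y = x * y - y * x"

definition anticommutator :: "'a::ring_1 \<Rightarrow> 'a \<Rightarrow> 'a" where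
  "anticommutator x y = x * y + y * x"

definition sklyanin_relations :: "'k::field \<Rightarrow> 'k \<Rightarrow> 'k \<Rightarrow> 'k free_alg set" where
  "sklyanin_relations \<alpha> \<beta> \<gamma> =
     {commutator (xgen X0) (xgen X1) - scalar \<alpha> * anticommutator (xgen X2) (xgen X3),
      anticommutator (xgen X0) (xgen X1) - commutator (xgen X2) (xgen X3),
      commutator (xgen X0) (xgen X2) - scalar \<beta> * anticommutator (xgen X3) (xgen X1),
      anticommutator (xgen X0) (xgen X2) - commutator (xgen X3) (xgen X1),
      commutator (xgen X0) (xgen X3) - scalar \<gamma> * anticommutator (xgen X1) (xgen X2),
      anticommutator (xgen X0) (xgen X3) - commutator (xgen X1) (xgen X2)}"

type_synonym 'k skl = "'k free_alg set"

definition sklyanin :: "'k::field \<Rightarrow> 'k \<Rightarrow> 'k \<Rightarrow> 'k skl ring" where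
  "sklyanin \<alpha> \<beta> \<gamma> = free_ring Quot (Idl\<^bsub>free_ring\<^esub> (sklyanin_relations \<alpha> \<beta> \<gamma>))"

definition to_skl :: "'k::field \<Rightarrow> 'k \<Rightarrow> 'k \<Rightarrow> 'k free_alg \<Rightarrow> 'k skl" where
  "to_skl \<alpha> \<beta> \<gamma> f = Idl\<^bsub>free_ring\<^esub> (sklyanin_relations \<alpha> \<beta> \<gamma>) +>\<^bsub>free_ring\<^esub> f"

definition skl_deg :: "'k::field \<Rightarrow> 'k \<Rightarrow> 'k \<Rightarrow> nat \<Rightarrow> 'k skl set" where
  "skl_deg \<alpha> \<beta> \<gamma> n = to_skl \<alpha> \<beta> \<gamma> ` free_deg n"

definition \<Omega>1 :: "'k::field free_alg" where
  "\<Omega>1 = - ((xgen X0)^2) + (xgen X1)^2 + (xgen X2)^2 + (xgen X3)^2"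

definition \<Omega>2 :: "'k::field \<Rightarrow> 'k \<Rightarrow> 'k \<Rightarrow> 'k free_alg" where
  "\<Omega>2 \<alpha> \<beta> \<gamma> = (xgen X1)^2 + scalar ((1 + \<alpha>) / (1 - \<beta>)) * (xgen X2)^2
                        + scalar ((1 - \<alpha>) / (1 + \<gamma>)) * (xgen X3)^2"

definition \<Omega>_ideal :: "'k::field \<Rightarrow> 'k \<Rightarrow> 'k \<Rightarrow> 'k skl set" where
  "\<Omega>_ideal \<alpha> \<beta> \<gamma> =
     Idl\<^bsub>sklyanin \<alpha> \<beta> \<gamma>\<^esub> {to_skl \<alpha> \<beta> \<gamma> \<Omega>1, to_skl \<alpha> \<beta> \<gamma> (\<Omega>2 \<alpha> \<beta> \<gamma>)}"

type_synonym 'k skl_quot = "'k skl set"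

definition skl_B :: "'k::field \<Rightarrow> 'k \<Rightarrow> 'k \<Rightarrow> 'k skl_quot ring" where
  "skl_B \<alpha> \<beta> \<gamma> = sklyanin \<alpha> \<beta> \<gamma> Quot \<Omega>_ideal \<alpha> \<beta> \<gamma>"

definition to_B :: "'k::field \<Rightarrow> 'k \<Rightarrow> 'k \<Rightarrow> 'k free_alg \<Rightarrow> 'k skl_quot" where
  "to_B \<alpha> \<beta> \<gamma> f = \<Omega>_ideal \<alpha> \<beta> \<gamma> +>\<^bsub>sklyanin \<alpha> \<beta> \<gamma>\<^esub> to_skl \<alpha> \<beta> \<gamma> f"


section \<open>The elliptic curve and its automorphism\<close>

text \<open>Points of projective 3-space are punctured lines through the origin.\<close>

type_synonym 'k proj_point = "(gen \<Rightarrow> 'k) set"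

definition proj_point :: "(gen \<Rightarrow> 'k::field) \<Rightarrow> 'k proj_point" where
  "proj_point y = {\<lambda>i. c * y i | c. c \<noteq> 0}"

definition skl_curve :: "'k::field \<Rightarrow> 'k \<Rightarrow> 'k \<Rightarrow> 'k proj_point set" where
  "skl_curve \<alpha> \<beta> \<gamma> = {proj_point y | y. y \<noteq> (\<lambda>_. 0) \<and>
     (y X0)^2 + (y X1)^2 + (y X2)^2 + (y X3)^2 = 0 \<and>
     (y X3)^2 + (1 - \<gamma>) / (1 + \<alpha>) * (y X1)^2 + (1 + \<gamma>) / (1 - \<beta>) * (y X2)^2 = 0}"

text \<open>\<open>M\<close> is a point module \<open>M\<^sub>p\<close>: the linear forms of degree 1 that annihilate \<open>M\<^sub>0\<close> are exactly
  those vanishing at \<open>p\<close>, so that \<open>p\<close> is the point of the dual projective space of the span of the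
  generators which is attached to \<open>M\<close>.\<close>

definition point_module_at ::
    "'k::field \<Rightarrow> 'k \<Rightarrow> 'k \<Rightarrow> 'k proj_point \<Rightarrow> ('k skl, 'm) graded_module \<Rightarrow> bool" where
  "point_module_at \<alpha> \<beta> \<gamma> p M \<longleftrightarrow>
     point_module (sklyanin \<alpha> \<beta> \<gamma>) (\<lambda>c. to_skl \<alpha> \<beta> \<gamma> (scalar c)) (skl_deg \<alpha> \<beta> \<gamma>) M \<and>
     (\<exists>y. y \<noteq> (\<lambda>_. 0) \<and> p = proj_point y \<and>
       (\<forall>c. (\<forall>m\<in>component M 0. to_skl \<alpha> \<beta> \<gamma> (\<Sum>i\<in>UNIV. scalar (c i) * xgen i) \<odot>\<^bsub>M\<^esub> m = \<zero>\<^bsub>M\<^esub>)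
            \<longleftrightarrow> (\<Sum>i\<in>UNIV. c i * y i) = 0))"

text \<open>\<open>\<sigma>\<close> is the automorphism of the curve with \<open>M\<^sub>p[1]\<^sub>\<ge>\<^sub>0 \<cong> M\<^sub>\<sigma>\<^sub>(\<^sub>p\<^sub>)\<close>; this condition determines \<open>\<sigma>\<close>
  on the curve. Ranging over modules carried by subsets of \<open>nat \<Rightarrow>\<^sub>0 'k\<close>, a vector space with a
  countable basis, is no restriction: a point module has dimension 1 in each degree \<open>n\<close>.\<close>

definition is_skl_automorphism ::
    "'k::field \<Rightarrow> 'k \<Rightarrow> 'k \<Rightarrow> ('k proj_point \<Rightarrow> 'k proj_point) \<Rightarrow> bool" where
  "is_skl_automorphism \<alpha> \<beta> \<gamma> \<sigma> \<longleftrightarrow>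
     bij_betw \<sigma> (skl_curve \<alpha> \<beta> \<gamma>) (skl_curve \<alpha> \<beta> \<gamma>) \<and>
     (\<forall>p\<in>skl_curve \<alpha> \<beta> \<gamma>.
        \<exists>(M :: ('k skl, nat \<Rightarrow>\<^sub>0 'k) graded_module)
         (N :: ('k skl, nat \<Rightarrow>\<^sub>0 'k) graded_module).
          point_module_at \<alpha> \<beta> \<gamma> p M \<and> point_module_at \<alpha> \<beta> \<gamma> (\<sigma> p) N \<and>
          graded_isomorphic (sklyanin \<alpha> \<beta> \<gamma>) (shift_module M) N)"

definition infinite_order_on :: "'a set \<Rightarrow> ('a \<Rightarrow> 'a) \<Rightarrow> bool" where
  "infinite_order_on S f \<longleftrightarrow> (\<forall>n>0. \<exists>p\<in>S. (f ^^ n) p \<noteq> p)"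


section \<open>The group action and the twist\<close>

text \<open>The pair \<open>(p, q)\<close> stands for \<open>g\<^sub>1\<^sup>p g\<^sub>2\<^sup>q\<close>.\<close>

type_synonym G = "bool \<times> bool"

fun gen_sign :: "G \<Rightarrow> gen \<Rightarrow> 'k::field" where
  "gen_sign (p, q) X0 = 1"
| "gen_sign (p, q) X1 = (-1) ^ of_bool q"
| "gen_sign (p, q) X2 = (-1) ^ of_bool p"
| "gen_sign (p, q) X3 = (-1) ^ of_bool p * (-1) ^ of_bool q"

text \<open>The automorphism of the free algebra sending each \<open>xgen i\<close> to \<open>gen_sign h i\<close> times \<open>xgen i\<close>.\<close>

definition free_act :: "G \<Rightarrow> 'k::field free_alg \<Rightarrow> 'k free_alg" where
  "free_act h f = (\<Sum>w\<in>Poly_Mapping.keys f.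
     Poly_Mapping.single w (prod_list (map (gen_sign h) (letters w)) * Poly_Mapping.lookup f w))"

text \<open>The automorphism \<open>free_act h\<close> preserves both ideals, so the induced automorphisms of \<open>A\<close> and
  of \<open>B\<close> send a coset to its image.\<close>

definition B_act :: "G \<Rightarrow> 'k::field skl_quot \<Rightarrow> 'k skl_quot" where
  "B_act h b = (\<lambda>a. free_act h ` a) ` b"

text \<open>The isomorphism from \<open>G\<close> to its character group under which \<open>X0\<close>, \<open>X1\<close>, \<open>X2\<close>, \<open>X3\<close> have degrees
  \<open>e\<close>, \<open>g\<^sub>1\<close>, \<open>g\<^sub>2\<close>, \<open>g\<^sub>1 g\<^sub>2\<close> in the grading by isotypic components.\<close>

fun G_char :: "G \<Rightarrow> G \<Rightarrow> 'k::field" where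
  "G_char (p, q) (r, s) = (-1) ^ (of_bool p * of_bool s + of_bool q * of_bool r)"

definition B_comp :: "'k::field \<Rightarrow> 'k \<Rightarrow> 'k \<Rightarrow> G \<Rightarrow> 'k skl_quot set" where
  "B_comp \<alpha> \<beta> \<gamma> g = {b \<in> carrier (skl_B \<alpha> \<beta> \<gamma>).
     \<forall>h. B_act h b = to_B \<alpha> \<beta> \<gamma> (scalar (G_char g h)) \<otimes>\<^bsub>skl_B \<alpha> \<beta> \<gamma>\<^esub> b}"

fun cocycle :: "G \<Rightarrow> G \<Rightarrow> 'k::field" where
  "cocycle (p, q) (r, s) = (-1) ^ (of_bool p * of_bool s)"

definition twisted_B :: "'k::field \<Rightarrow> 'k \<Rightarrow> 'k \<Rightarrow> 'k skl_quot ring" where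
  "twisted_B \<alpha> \<beta> \<gamma> =
     cocycle_twist (skl_B \<alpha> \<beta> \<gamma>) (\<lambda>c. to_B \<alpha> \<beta> \<gamma> (scalar c)) (B_comp \<alpha> \<beta> \<gamma>) cocycle"

end

theory Submission
  imports Defs
begin

text \<open>
  A word of length \<open>n\<close> in the generators is evaluated along an orbit \<open>p, \<sigma> p, \<sigma>\<^sup>2 p, \<dots>\<close> of the curve by
  multiplying the corresponding coordinates; this kills the relations and \<open>\<Omega>\<^sub>1, \<Omega>\<^sub>2\<close>. Conversely
  a homogeneous element that vanishes along almost all orbits is zero in \<open>B\<close>, by induction on the
  degree: if it vanishes at the four zeros \<open>(b\<^sub>0, b\<^sub>1, \<plusminus>b\<^sub>2, \<plusminus>b\<^sub>3)\<close> of \<open>u = b\<^sub>1 x\<^sub>0 - b\<^sub>0 x\<^sub>1\<close> on the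
  curve, it is divisible by \<open>u\<close> on the left modulo the relations, and the quotient vanishes almost
  everywhere again. This rests on rank computations for the eight bilinear relations at \<open>b\<close>, and it
  identifies \<open>B\<close> with a ring of functions along orbits without Hilbert series.

  Since \<open>\<sigma>\<close> is generically given by cubic polynomials and the curve is irreducible (its function field
  is \<open>k(X)(\<surd>A, \<surd>C)\<close> with \<open>A\<close>, \<open>C\<close> and \<open>A C\<close> not squares), a nonzero homogeneous element of \<open>B\<close> vanishes
  at finitely many points only. For nonzero \<open>a\<close>, \<open>b\<close> in the twist, evaluate \<open>a * x\<^sub>l * b\<close> for the four
  generators at a generic point. If all these products were zero, orthogonality of the characters of
  \<open>G\<close> would separate the \<open>G\<close>-components and give \<open>a\<^sub>g(p) b\<^sub>h(\<sigma>\<^sup>n\<^sup>+\<^sup>1 p) = 0\<close> for all \<open>g\<close>, \<open>h\<close>, where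
  \<open>n\<close> is the degree of \<open>a\<close>.
\<close>

text \<open>The value of a twisted product at a point is a signed sum over pairs of G-degrees, whose
  terms may cancel although neither factor vanishes; evaluation alone therefore does not exhibit the
  twist as a domain. Inserting a generator changes the signs by \<mu>(a,b)\<mu>(b,a), a
  nondegenerate pairing on G.

  The automorphism \<sigma> is given only through point modules. What is extracted from it is that
  representatives of p and \<sigma>(p) satisfy eight bilinear equations; at a generic p these
  determine \<sigma>(p), and Cramer's rule turns them into the cubic formula.

  A plane meets the quartic curve in four points. The planes given by u are special in that these
  points differ from b by sign changes only, which ties the linear algebra at all four of them to
  the relations at b.\<close>

abbreviation "single \<equiv> Poly_Mapping.single"
abbreviation "lookup \<equiv> Poly_Mapping.lookup"
abbreviation "keys \<equiv> Poly_Mapping.keys"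

definition dot :: "(gen \<Rightarrow> 'k::field) \<Rightarrow> (gen \<Rightarrow> 'k) \<Rightarrow> 'k" where
  "dot c y = (\<Sum>i\<in>UNIV. c i * y i)"

lemma UNIV_gen: "(UNIV :: gen set) = {X0, X1, X2, X3}"
  using gen.exhaust by auto

lemma sum_gen: "(\<Sum>i\<in>UNIV. f i) = f X0 + f X1 + f X2 + (f X3 :: 'a::comm_monoid_add)"
  by (simp add: UNIV_gen add.assoc)

lemma all_gen: "(\<forall>i. P i) \<longleftrightarrow> P X0 \<and> P X1 \<and> P X2 \<and> P X3"
  by (metis gen.exhaust)

lemma UNIV_G: "(UNIV :: G set) = {(False, False), (True, False), (False, True), (True, True)}"
  by auto

lemma sum_G: "(\<Sum>g\<in>UNIV. f g) = f (False, False) + f (True, False) + f (False, True)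
    + (f (True, True) :: 'a::comm_monoid_add)"
  by (simp add: UNIV_G add.assoc)

subsection \<open>Linear functionals and diagonal operators on the free algebra\<close>

lemma free_alg_sum: "f = (\<Sum>w\<in>keys f. single w (lookup f w))"
proof (rule poly_mapping_eqI)
  fix v
  have "(\<Sum>w\<in>keys f. lookup (single w (lookup f w)) v)
      = (\<Sum>w\<in>keys f. if w = v then lookup f w else 0)"
    by (rule sum.cong) (auto simp: lookup_single)
  then show "lookup f v = lookup
      (\<Sum>w\<in>keys f. single w (lookup f w)) v"
    by (simp add: lookup_sum not_in_keys_iff_lookup_eq_zero)
qed

lemma free_alg_induct [case_names zero single add]:
  fixes f :: "'a \<Rightarrow>\<^sub>0 'b::comm_monoid_add"
  assumes "P 0" "\<And>w c. P (single w c)" "\<And>f g. P f \<Longrightarrow> P g \<Longrightarrow> P (f + g)"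
  shows "P f"
proof -
  have "P (\<Sum>w\<in>S. single w (lookup f w))" if "finite S" for S
    using that by induction (auto intro: assms)
  then show ?thesis
    by (subst free_alg_sum) simp
qed

definition lext :: "('a \<Rightarrow> 'b) \<Rightarrow> ('a \<Rightarrow>\<^sub>0 'b) \<Rightarrow> 'b::comm_ring_1" where
  "lext \<phi> f = (\<Sum>w\<in>keys f. lookup f w * \<phi> w)"

lemma lext_superset:
  assumes "finite S" "keys f \<subseteq> S"
  shows "lext \<phi> f = (\<Sum>w\<in>S. lookup f w * \<phi> w)"
  unfolding lext_def using assms
  by (intro sum.mono_neutral_left) (auto simp: not_in_keys_iff_lookup_eq_zero)

lemma lext_add: "lext \<phi> (f + g) = lext \<phi> f + lext \<phi> g"
proof -
  let ?S = "keys f \<union> keys g"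
  have "keys (f + g) \<subseteq> ?S"
    by (rule keys_add)
  then show ?thesis
    by (simp add: lext_superset[of ?S] lookup_add distrib_right sum.distrib)
qed

lemma lext_0 [simp]: "lext \<phi> 0 = 0"
  by (simp add: lext_def)

lemma lext_single [simp]: "lext \<phi> (single w c) = c * \<phi> w"
  by (simp add: lext_superset[of "{w}"])

lemma lext_uminus: "lext \<phi> (- f) = - lext \<phi> f"
  using lext_add[of \<phi> f "- f"] by (simp add: eq_neg_iff_add_eq_0 add.commute)

lemma lext_diff: "lext \<phi> (f - g) = lext \<phi> f - lext \<phi> g"
  using lext_add[of \<phi> f "- g"] by (simp add: lext_uminus)

lemma lext_sum: "lext \<phi> (\<Sum>x\<in>S. f x) = (\<Sum>x\<in>S. lext \<phi> (f x))"
  by (induction S rule: infinite_finite_induct) (auto simp: lext_add)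

definition diag :: "('a \<Rightarrow> 'b) \<Rightarrow> ('a \<Rightarrow>\<^sub>0 'b) \<Rightarrow> ('a \<Rightarrow>\<^sub>0 'b::comm_ring_1)" where
  "diag \<psi> f = (\<Sum>w\<in>keys f. single w (\<psi> w * lookup f w))"

lemma lookup_diag [simp]: "lookup (diag \<psi> f) v = \<psi> v * lookup f v"
proof -
  have "(\<Sum>w\<in>keys f. lookup (single w (\<psi> w * lookup f w)) v)
      = (\<Sum>w\<in>keys f. if w = v then \<psi> w * lookup f w else 0)"
    by (rule sum.cong) (auto simp: lookup_single)
  then show ?thesis
    by (simp add: diag_def lookup_sum not_in_keys_iff_lookup_eq_zero)
qed

lemma diag_single [simp]: "diag \<psi> (single w c) = single w (\<psi> w * c)"
  by (rule poly_mapping_eqI) (simp add: lookup_single when_def)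

lemma diag_add: "diag \<psi> (f + g) = diag \<psi> f + diag \<psi> g"
  by (rule poly_mapping_eqI) (simp add: lookup_add distrib_left)

lemma diag_0 [simp]: "diag \<psi> 0 = 0"
  by (rule poly_mapping_eqI) simp

lemma diag_diff: "diag \<psi> (f - g) = diag \<psi> f - diag \<psi> g"
  by (rule poly_mapping_eqI) (simp add: lookup_minus right_diff_distrib)

lemma keys_diag: "keys (diag \<psi> f) \<subseteq> {w \<in> keys f. \<psi> w \<noteq> 0}"
  by (auto simp: in_keys_iff)

lemma lext_diag: "lext \<phi> (diag \<psi> f) = lext (\<lambda>w. \<phi> w * \<psi> w) f"
  using keys_diag[of \<psi> f]
  by (subst lext_superset[of "keys f"]) (auto simp: lext_def mult_ac)

lemma scalar_mult_single: "scalar c * single w d = single w (c * d)"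
  by (simp add: scalar_def mult_single)

lemma single_mult_scalar: "single w d * scalar c = single w (c * d)"
  by (simp add: scalar_def mult_single mult.commute)

lemma scalar_commute: "f * scalar c = scalar c * f"
  by (induction f rule: free_alg_induct)
     (simp_all add: scalar_mult_single single_mult_scalar distrib_left distrib_right)

lemma scalar_0 [simp]: "scalar 0 = 0"
  by (simp add: scalar_def)

lemma scalar_1 [simp]: "scalar 1 = 1"
  by (simp add: scalar_def)

lemma scalar_add: "scalar (c + d) = scalar c + scalar d"
  by (simp add: scalar_def single_add)

lemma scalar_diff: "scalar (c - d) = scalar c - scalar d"
  by (simp add: scalar_def single_diff)

lemma scalar_uminus: "scalar (- c) = - scalar c"
  by (simp add: scalar_def single_uminus)

lemma scalar_mult: "scalar (c * d) = scalar c * scalar d"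
  by (simp add: scalar_def mult_single)

lemma lookup_scalar_mult: "lookup (scalar c * f) w = c * lookup f w"
  by (induction f rule: free_alg_induct)
     (simp_all add: scalar_mult_single lookup_single when_def lookup_add distrib_left)

lemma lext_scalar: "lext \<phi> (scalar c * f) = c * lext \<phi> f"
  by (induction f rule: free_alg_induct)
     (simp_all add: scalar_mult_single lext_add distrib_left mult.assoc)

subsection \<open>Degrees and evaluation along sequences of vectors\<close>

fun gdeg :: "gen \<Rightarrow> G" where
  "gdeg X0 = (False, False)"
| "gdeg X1 = (True, False)"
| "gdeg X2 = (False, True)"
| "gdeg X3 = (True, True)"

fun gadd :: "G \<Rightarrow> G \<Rightarrow> G" where
  "gadd (p, q) (r, s) = (p \<noteq> r, q \<noteq> s)"

abbreviation gzero :: G where "gzero \<equiv> (False, False)"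

lemma gadd_assoc: "gadd (gadd a b) c = gadd a (gadd b c)"
  by (cases a; cases b; cases c) auto

lemma gadd_0 [simp]: "gadd gzero a = a" "gadd a gzero = a"
  by (cases a; auto)+

lemma gadd_self [simp]: "gadd a a = gzero"
  by (cases a) auto

lemma gadd_cancel [simp]: "gadd a (gadd a b) = b"
  by (cases a; cases b) auto

lemma gadd_eq_iff: "gadd a b = c \<longleftrightarrow> b = gadd a c"
  by (cases a; cases b; cases c) auto

definition wdeg :: "word \<Rightarrow> G" where
  "wdeg w = foldr (\<lambda>i. gadd (gdeg i)) (letters w) gzero"

lemma wdeg_0 [simp]: "wdeg 0 = gzero"
  by (simp add: wdeg_def zero_word_def)

lemma wdeg_Cons: "wdeg (Word (i # w)) = gadd (gdeg i) (wdeg (Word w))"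
  by (simp add: wdeg_def)

lemma wdeg_add: "wdeg (u + v) = gadd (wdeg u) (wdeg v)"
proof -
  have "wdeg (Word (u @ v)) = gadd (wdeg (Word u)) (wdeg (Word v))" for u v
    by (induction u) (auto simp: wdeg_Cons gadd_assoc, simp add: wdeg_def)
  then show ?thesis
    by (simp add: plus_word_def)
qed

definition wlen :: "word \<Rightarrow> nat" where
  "wlen w = length (letters w)"

lemma wlen_0 [simp]: "wlen 0 = 0"
  by (simp add: wlen_def zero_word_def)

lemma wlen_add: "wlen (u + v) = wlen u + wlen v"
  by (simp add: wlen_def plus_word_def)

definition shift :: "nat \<Rightarrow> (nat \<Rightarrow> 'b) \<Rightarrow> nat \<Rightarrow> 'b" where
  "shift n ys = (\<lambda>i. ys (n + i))"

lemma shift_apply: "shift n ys i = ys (n + i)"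
  by (simp add: shift_def)

lemma shift_at_0 [simp]: "shift n ys 0 = ys n"
  by (simp add: shift_def)

lemma shift_0 [simp]: "shift 0 ys = ys"
  by (simp add: shift_def fun_eq_iff)

lemma shift_shift [simp]: "shift m (shift n ys) = shift (n + m) ys"
  by (simp add: shift_def add.assoc)

fun evl :: "(nat \<Rightarrow> gen \<Rightarrow> 'k::field) \<Rightarrow> gen list \<Rightarrow> 'k" where
  "evl ys [] = 1"
| "evl ys (i # w) = ys 0 i * evl (shift 1 ys) w"

lemma evl_append: "evl ys (u @ v) = evl ys u * evl (shift (length u) ys) v"
  by (induction u arbitrary: ys) auto

definition evw :: "(nat \<Rightarrow> gen \<Rightarrow> 'k::field) \<Rightarrow> word \<Rightarrow> 'k" where
  "evw ys w = evl ys (letters w)"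

lemma evw_0 [simp]: "evw ys 0 = 1"
  by (simp add: evw_def zero_word_def)

lemma evw_add: "evw ys (u + v) = evw ys u * evw (shift (wlen u) ys) v"
  by (simp add: evw_def plus_word_def evl_append wlen_def)

definition ev :: "nat \<Rightarrow> (nat \<Rightarrow> gen \<Rightarrow> 'k::field) \<Rightarrow> 'k free_alg \<Rightarrow> 'k" where
  "ev n ys = lext (\<lambda>w. if wlen w = n then evw ys w else 0)"

definition gev :: "nat \<Rightarrow> G \<Rightarrow> (nat \<Rightarrow> gen \<Rightarrow> 'k::field) \<Rightarrow> 'k free_alg \<Rightarrow> 'k" where
  "gev n g ys = lext (\<lambda>w. if wlen w = n \<and> wdeg w = g then evw ys w else 0)"

lemma ev_lin:
  "ev n ys (f + g) = ev n ys f + ev n ys g" "ev n ys (f - g) = ev n ys f - ev n ys g"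
  "ev n ys (- f) = - ev n ys f" "ev n ys (\<Sum>x\<in>A. F x) = (\<Sum>x\<in>A. ev n ys (F x))"
  "ev n ys (scalar c * f) = c * ev n ys f" "ev n ys 0 = 0"
  by (simp_all add: ev_def lext_add lext_diff lext_uminus lext_sum lext_scalar)

lemma gev_lin:
  "gev n g ys (f + h) = gev n g ys f + gev n g ys h" "gev n g ys (f - h) = gev n g ys f - gev n g ys h"
  "gev n g ys (- f) = - gev n g ys f" "gev n g ys (\<Sum>x\<in>A. F x) = (\<Sum>x\<in>A. gev n g ys (F x))"
  "gev n g ys (scalar c * f) = c * gev n g ys f" "gev n g ys 0 = 0"
  by (simp_all add: gev_def lext_add lext_diff lext_uminus lext_sum lext_scalar)

lemma gev_single: "gev n g ys (single w c)
    = (if wlen w = n \<and> wdeg w = g then c * evw ys w else 0)"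
  by (simp add: gev_def)

text \<open>Serves the ordinary and the twisted product at once: both concatenate words up to a
  factor that depends only on the G-degrees. A first factor of length \<open>i\<close> uses up
  \<open>i\<close> points, hence the shift; the second degree is \<open>gadd a k\<close> because
  every element of G is its own inverse.\<close>

lemma gev_bilinear:
  assumes add: "\<And>f f' h. P (f + f') h = P f h + P f' h" "\<And>f h h'. P f (h + h') = P f h + P f h'"
    and zero: "\<And>h. P 0 h = 0" "\<And>f. P f 0 = 0"
    and single: "\<And>u c v d. P (single u c) (single v d) = single (u + v) (\<chi> (wdeg u) (wdeg v) * (c * d))"
  shows "gev n k ys (P f h) =
    (\<Sum>i\<le>n. \<Sum>a\<in>UNIV. \<chi> a (gadd a k) * (gev i a ys f * gev (n - i) (gadd a k) (shift i ys) h))"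
proof (induction f rule: free_alg_induct)
  case zero
  then show ?case by (simp add: gev_lin assms(3))
next
  case (single u c)
  show ?case
  proof (induction h rule: free_alg_induct)
    case zero
    then show ?case by (simp add: gev_lin assms(4))
  next
    case (single v d)
    have "(\<Sum>i\<le>n. \<Sum>a\<in>UNIV. \<chi> a (gadd a k) * (gev i a ys (single u c)
              * gev (n - i) (gadd a k) (shift i ys) (single v d)))
        = (\<Sum>i\<le>n. \<Sum>a\<in>UNIV. if a = wdeg u then (if i = wlen u then \<chi> a (gadd a k) * (c * evw ys u
              * gev (n - i) (gadd a k) (shift i ys) (single v d)) else 0) else 0)"
      by (intro sum.cong) (auto simp: gev_single)
    also have "\<dots> = (if wlen u \<le> n then \<chi> (wdeg u) (gadd (wdeg u) k) * (c * evw ys u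
              * gev (n - wlen u) (gadd (wdeg u) k) (shift (wlen u) ys) (single v d)) else 0)"
      by simp
    also have "\<dots> = gev n k ys (P (single u c) (single v d))"
      by (auto simp: assms(5) gev_single wlen_add wdeg_add evw_add gadd_eq_iff)
    finally show ?case ..
  next
    case (add f g)
    then show ?case by (simp add: assms(2) distrib_left gev_lin sum.distrib)
  qed
next
  case (add f g)
  then show ?case by (simp add: assms(1) distrib_left distrib_right gev_lin sum.distrib)
qed

lemma gev_mult:
  "gev n k ys (f * h) = (\<Sum>i\<le>n. \<Sum>a\<in>UNIV. gev i a ys f * gev (n - i) (gadd a k) (shift i ys) h)"
  by (subst gev_bilinear[where P = "(*)" and \<chi> = "\<lambda>_ _. 1"]) (simp_all add: distrib_left distrib_right mult_single)

lemma ev_eq_sum_gev: "ev n ys f = (\<Sum>g\<in>UNIV. gev n g ys f)"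
proof (induction f rule: free_alg_induct)
  case (single w c)
  have "(\<Sum>g\<in>UNIV. gev n g ys (single w c))
      = (\<Sum>g\<in>UNIV. if g = wdeg w then (if wlen w = n then c * evw ys w else 0) else 0)"
    by (rule sum.cong) (auto simp: gev_single)
  then show ?case
    by (simp add: ev_def)
qed (simp_all add: ev_lin gev_lin sum.distrib)

definition lin :: "(gen \<Rightarrow> 'k::field) \<Rightarrow> 'k free_alg" where
  "lin c = (\<Sum>i\<in>UNIV. scalar (c i) * xgen i)"

lemma lin_add: "lin (\<lambda>i. c i + d i) = lin c + lin d"
  by (simp add: lin_def scalar_add distrib_right sum.distrib)

lemma lin_scale: "lin (\<lambda>i. a * c i) = scalar a * lin c"
  by (simp add: lin_def scalar_mult sum_distrib_left mult.assoc)

lemma lin_0 [simp]: "lin (\<lambda>i. 0) = 0"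
  by (simp add: lin_def)

lemma lin_unit: "lin (\<lambda>j. of_bool (j = i)) = xgen i"
proof -
  have "lin (\<lambda>j. of_bool (j = i)) = (\<Sum>j\<in>UNIV. if j = i then xgen j else 0)"
    unfolding lin_def by (rule sum.cong) auto
  then show ?thesis by simp
qed

lemma ev_xgen_mult: "ev (Suc n) ys (xgen i * f) = ys 0 i * ev n (shift 1 ys) f"
proof (induction f rule: free_alg_induct)
  case (single w c)
  have "wlen (Word [i] + w) = Suc (wlen w)" "evw ys (Word [i] + w) = ys 0 i * evw (shift 1 ys) w"
    by (auto simp: wlen_def evw_def plus_word_def)
  then show ?case
    by (simp add: xgen_def mult_single ev_def)
qed (simp_all add: ev_lin distrib_left)

lemma ev_lin_mult: "ev (Suc n) ys (lin c * f) = dot c (ys 0) * ev n (shift 1 ys) f"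
  by (simp add: lin_def dot_def sum_distrib_right ev_lin ev_xgen_mult mult.assoc)

lemma free_deg_iff: "f \<in> free_deg n \<longleftrightarrow> (\<forall>w. wlen w \<noteq> n \<longrightarrow> lookup f w = 0)"
  by (auto simp: free_deg_def wlen_def in_keys_iff)

lemma free_deg_0 [simp]: "0 \<in> free_deg n"
  by (simp add: free_deg_iff)

lemma free_deg_add: "f \<in> free_deg n \<Longrightarrow> g \<in> free_deg n \<Longrightarrow> f + g \<in> free_deg n"
  by (simp add: free_deg_iff lookup_add)

lemma free_deg_scalar: "f \<in> free_deg n \<Longrightarrow> scalar c * f \<in> free_deg n"
  by (simp add: free_deg_iff lookup_scalar_mult)

lemma free_deg_sum: "(\<And>x. x \<in> S \<Longrightarrow> f x \<in> free_deg n) \<Longrightarrow> (\<Sum>x\<in>S. f x) \<in> free_deg n"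
  by (induction S rule: infinite_finite_induct) (auto intro: free_deg_add)

lemma free_deg_single [simp]: "single w c \<in> free_deg (wlen w)"
  by (auto simp: free_deg_iff lookup_single when_def)

lemma free_deg_mult:
  assumes "f \<in> free_deg m" "g \<in> free_deg n"
  shows "f * g \<in> free_deg (m + n)"
  using assms keys_mult[of f g]
  by (force simp: free_deg_def plus_word_def)

lemma lin_free_deg: "lin c \<in> free_deg 1"
  unfolding lin_def xgen_def scalar_mult_single
  by (intro free_deg_sum) (metis free_deg_single wlen_def One_nat_def length_0_conv length_Suc_conv word.sel)

lemma free_deg_0_scalar:
  assumes "f \<in> free_deg 0"
  shows "f = scalar (ev 0 ys f)"
proof (rule poly_mapping_eqI)
  fix w
  have w0: "wlen w = 0 \<longleftrightarrow> w = 0" for w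
    by (cases w) (auto simp: wlen_def zero_word_def)
  have "keys f \<subseteq> {0}"
    using assms by (auto simp: free_deg_iff w0 in_keys_iff)
  then have "ev 0 ys f = lookup f 0"
    unfolding ev_def by (subst lext_superset[of "{0}"]) auto
  then show "lookup f w = lookup (scalar (ev 0 ys f)) w"
    using assms by (auto simp: scalar_def lookup_single when_def free_deg_iff w0)
qed

lemma free_deg_Suc_decomp:
  assumes "f \<in> free_deg (Suc n)"
  obtains h where "\<And>i. h i \<in> free_deg n" "f = (\<Sum>i\<in>UNIV. xgen i * h i)"
proof -
  define T where "T i = {w \<in> keys f. hd (letters w) = i}" for i
  define h where "h i = (\<Sum>w\<in>T i. single (Word (tl (letters w))) (lookup f w))" for i
  have len: "length (letters w) = Suc n" if "w \<in> keys f" for w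
    using assms that by (auto simp: free_deg_def)
  have 1: "h i \<in> free_deg n" for i
    unfolding h_def
  proof (rule free_deg_sum)
    fix w assume "w \<in> T i"
    then have "wlen (Word (tl (letters w))) = n"
      using len by (simp add: T_def wlen_def)
    then show "single (Word (tl (letters w))) (lookup f w) \<in> free_deg n"
      using free_deg_single by metis
  qed
  have 2: "xgen i * h i = (\<Sum>w\<in>T i. single w (lookup f w))" for i
    unfolding h_def sum_distrib_left
  proof (rule sum.cong)
    fix w assume w: "w \<in> T i"
    then have "letters w = i # tl (letters w)"
      using len[of w] by (cases "letters w") (auto simp: T_def)
    then have "Word [i] + Word (tl (letters w)) = w"
      by (cases w) (auto simp: plus_word_def)
    then show "xgen i * single (Word (tl (letters w))) (lookup f w)
        = single w (lookup f w)"
      by (simp add: xgen_def mult_single)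
  qed simp
  have "(\<Sum>i\<in>UNIV. xgen i * h i) = (\<Sum>w\<in>(\<Union>i\<in>UNIV. T i). single w (lookup f w))"
    unfolding 2 by (subst sum.UNION_disjoint) (auto simp: T_def)
  also have "(\<Union>i\<in>UNIV. T i) = keys f"
    by (auto simp: T_def)
  finally have "f = (\<Sum>i\<in>UNIV. xgen i * h i)"
    by (metis free_alg_sum)
  with 1 show ?thesis by (rule that)
qed

subsection \<open>The bilinear relations\<close>

text \<open>The first argument of the bilinear form is frozen because in a right module the left
  letter acts first: \<open>row r y\<close> is the linear form that has to vanish at the successor
  of \<open>y\<close>.\<close>

definition row :: "(gen \<Rightarrow> gen \<Rightarrow> 'k::field) \<Rightarrow> (gen \<Rightarrow> 'k) \<Rightarrow> gen \<Rightarrow> 'k" where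
  "row r y = (\<lambda>j. \<Sum>i\<in>UNIV. y i * r i j)"

definition bil :: "(gen \<Rightarrow> gen \<Rightarrow> 'k::field) \<Rightarrow> 'k free_alg" where
  "bil r = (\<Sum>i\<in>UNIV. xgen i * lin (r i))"

lemma dot_add: "dot (\<lambda>i. c i + d i) y = dot c y + dot d y"
  by (simp add: dot_def distrib_right sum.distrib)

lemma dot_scale: "dot (\<lambda>i. a * c i) y = a * dot c y"
  by (simp add: dot_def sum_distrib_left mult.assoc)

lemma dot_diff: "dot (\<lambda>i. c i - d i) y = dot c y - dot d y"
  by (simp add: dot_def left_diff_distrib sum_subtractf)

lemma dot_unit: "dot (\<lambda>j. of_bool (j = i)) y = y i"
  by (cases i) (simp_all add: dot_def sum_gen)

lemma lin_diff: "lin (\<lambda>i. c i - d i) = lin c - lin d"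
  by (simp add: lin_def scalar_diff left_diff_distrib sum_subtractf)

lemma lin_mult_scalar: "lin m * (scalar a * x) = scalar a * (lin m * x)"
  by (metis mult.assoc scalar_commute)

lemma scalar_left_commute: "scalar a * (scalar b * x) = scalar b * (scalar a * x)"
  by (metis mult.assoc scalar_commute)

lemma lin_row: "lin (row r y) = (\<Sum>i\<in>UNIV. scalar (y i) * lin (r i))"
  by (simp add: row_def sum_gen lin_add lin_scale)

text \<open>When \<open>dot m b = 1\<close>, the forms \<open>x_i - b_i m\<close> vanish at
  \<open>b\<close>; modulo the right ideal they generate, only the combination of the
  \<open>h i\<close> with weights \<open>b i\<close> matters.\<close>

lemma sum_xgen_decomp:
  "(\<Sum>i\<in>UNIV. xgen i * h i) = (\<Sum>i\<in>UNIV. lin (\<lambda>j. of_bool (j = i) - b i * m j) * h i)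
     + lin m * (\<Sum>i\<in>UNIV. scalar (b i) * h i)"
proof -
  have "lin (\<lambda>j. of_bool (j = i) - b i * m j) * h i + lin m * (scalar (b i) * h i) = xgen i * h i" for i
    by (simp only: lin_diff lin_scale lin_unit) (simp add: lin_mult_scalar algebra_simps)
  then show ?thesis
    by (simp only: sum_distrib_left sum.distrib[symmetric])
qed

text \<open>Meant for two points \<open>b\<close>, \<open>c\<close> with dual forms
  \<open>m\<close>, \<open>m'\<close>.\<close>

lemma sum_xgen_decomp2:
  "(\<Sum>i\<in>UNIV. xgen i * h i) = (\<Sum>i\<in>UNIV. lin (\<lambda>j. of_bool (j = i) - b i * m j - c i * m' j) * h i)
     + lin m * (\<Sum>i\<in>UNIV. scalar (b i) * h i) + lin m' * (\<Sum>i\<in>UNIV. scalar (c i) * h i)"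
proof -
  have "lin (\<lambda>j. of_bool (j = i) - b i * m j - c i * m' j) * h i + lin m * (scalar (b i) * h i)
      + lin m' * (scalar (c i) * h i) = xgen i * h i" for i
    by (simp only: lin_diff lin_scale lin_unit) (simp add: lin_mult_scalar algebra_simps)
  then show ?thesis
    by (simp only: sum_distrib_left sum.distrib[symmetric])
qed

text \<open>By Cramer's rule for the minor of the first three columns.\<close>

lemma annihilator_three_rows:
  fixes p q r z w :: "gen \<Rightarrow> 'k::field"
  assumes "dot p z = 0" "dot q z = 0" "dot r z = 0" "z \<noteq> (\<lambda>_. 0)"
    and M: "p X0 * (q X1 * r X2 - q X2 * r X1) - p X1 * (q X0 * r X2 - q X2 * r X0)
          + p X2 * (q X0 * r X1 - q X1 * r X0) \<noteq> 0" (is "?M \<noteq> 0")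
  shows "z X3 \<noteq> 0"
    and "dot w z = 0 \<Longrightarrow> \<exists>a b c. w = (\<lambda>i. a * p i + b * q i + c * r i)"
proof -
  note d = assms(1-3)[unfolded dot_def sum_gen]
  show z3: "z X3 \<noteq> 0"
  proof
    assume z3: "z X3 = 0"
    have "?M * z X0 = (q X1 * r X2 - q X2 * r X1) * (p X0 * z X0 + p X1 * z X1 + p X2 * z X2 + p X3 * 0)
        - (p X1 * r X2 - p X2 * r X1) * (q X0 * z X0 + q X1 * z X1 + q X2 * z X2 + q X3 * 0)
        + (p X1 * q X2 - p X2 * q X1) * (r X0 * z X0 + r X1 * z X1 + r X2 * z X2 + r X3 * 0)"
      "?M * z X1 = - (q X0 * r X2 - q X2 * r X0) * (p X0 * z X0 + p X1 * z X1 + p X2 * z X2 + p X3 * 0)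
        + (p X0 * r X2 - p X2 * r X0) * (q X0 * z X0 + q X1 * z X1 + q X2 * z X2 + q X3 * 0)
        - (p X0 * q X2 - p X2 * q X0) * (r X0 * z X0 + r X1 * z X1 + r X2 * z X2 + r X3 * 0)"
      "?M * z X2 = (q X0 * r X1 - q X1 * r X0) * (p X0 * z X0 + p X1 * z X1 + p X2 * z X2 + p X3 * 0)
        - (p X0 * r X1 - p X1 * r X0) * (q X0 * z X0 + q X1 * z X1 + q X2 * z X2 + q X3 * 0)
        + (p X0 * q X1 - p X1 * q X0) * (r X0 * z X0 + r X1 * z X1 + r X2 * z X2 + r X3 * 0)"
      by (simp_all add: algebra_simps)
    then have "?M * z X0 = 0" "?M * z X1 = 0" "?M * z X2 = 0"
      using d[unfolded z3] by simp_all
    then have "z X0 = 0" "z X1 = 0" "z X2 = 0"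
      using M by auto
    with z3 have "z = (\<lambda>_. 0)"
      by (intro ext) (metis gen.exhaust)
    with assms(4) show False by simp
  qed
  assume w: "dot w z = 0"
  define a' where "a' = w X0 * (q X1 * r X2 - q X2 * r X1) - w X1 * (q X0 * r X2 - q X2 * r X0)
          + w X2 * (q X0 * r X1 - q X1 * r X0)"
  define b' where "b' = p X0 * (w X1 * r X2 - w X2 * r X1) - p X1 * (w X0 * r X2 - w X2 * r X0)
          + p X2 * (w X0 * r X1 - w X1 * r X0)"
  define c' where "c' = p X0 * (q X1 * w X2 - q X2 * w X1) - p X1 * (q X0 * w X2 - q X2 * w X0)
          + p X2 * (q X0 * w X1 - q X1 * w X0)"
  define a b c where "a = a' / ?M" and "b = b' / ?M" and "c = c' / ?M"
  then have a: "a * ?M = a'" and b: "b * ?M = b'" and c: "c * ?M = c'"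
    using M by simp_all
  have M_diff: "?M * (w i - (a * p i + b * q i + c * r i))
      = ?M * w i - (a * ?M) * p i - (b * ?M) * q i - (c * ?M) * r i" for i
    by (simp add: algebra_simps)
  have "?M * (w X0 - (a * p X0 + b * q X0 + c * r X0)) = 0"
    "?M * (w X1 - (a * p X1 + b * q X1 + c * r X1)) = 0"
    "?M * (w X2 - (a * p X2 + b * q X2 + c * r X2)) = 0"
    unfolding M_diff a b c a'_def b'_def c'_def by (simp_all add: algebra_simps)
  then have e: "w X0 = a * p X0 + b * q X0 + c * r X0" "w X1 = a * p X1 + b * q X1 + c * r X1"
    "w X2 = a * p X2 + b * q X2 + c * r X2"
    using M by auto
  have "(w X3 - (a * p X3 + b * q X3 + c * r X3)) * z X3 = 0"
  proof -
    have "(w X3 - (a * p X3 + b * q X3 + c * r X3)) * z X3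
      = (w X0 * z X0 + w X1 * z X1 + w X2 * z X2 + w X3 * z X3)
        - a * (p X0 * z X0 + p X1 * z X1 + p X2 * z X2 + p X3 * z X3)
        - b * (q X0 * z X0 + q X1 * z X1 + q X2 * z X2 + q X3 * z X3)
        - c * (r X0 * z X0 + r X1 * z X1 + r X2 * z X2 + r X3 * z X3)
        - (w X0 - (a * p X0 + b * q X0 + c * r X0)) * z X0
        - (w X1 - (a * p X1 + b * q X1 + c * r X1)) * z X1
        - (w X2 - (a * p X2 + b * q X2 + c * r X2)) * z X2"
      by (simp add: algebra_simps)
    then show ?thesis
      using w[unfolded dot_def sum_gen] d e by simp
  qed
  then have "w X3 = a * p X3 + b * q X3 + c * r X3"
    using z3 by auto
  with e have "w i = a * p i + b * q i + c * r i" for i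
    by (cases i) auto
  then show "\<exists>a b c. w = (\<lambda>i. a * p i + b * q i + c * r i)"
    by blast
qed

text \<open>\<open>flip\<close> commutes with \<open>\<sigma>\<close> on the curve, whereas \<open>flip3\<close> conjugates \<open>\<sigma>\<close> to its inverse.\<close>

fun flip :: "(gen \<Rightarrow> 'k::field) \<Rightarrow> gen \<Rightarrow> 'k" where
  "flip y X0 = y X0" | "flip y X1 = y X1" | "flip y X2 = - y X2" | "flip y X3 = - y X3"

fun flip3 :: "(gen \<Rightarrow> 'k::field) \<Rightarrow> gen \<Rightarrow> 'k" where
  "flip3 y X0 = y X0" | "flip3 y X1 = y X1" | "flip3 y X2 = y X2" | "flip3 y X3 = - y X3"

lemma flip_flip [simp]: "flip (flip y) = y"
proof
  show "flip (flip y) i = y i" for i by (cases i) auto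
qed

lemma flip_scale: "flip (\<lambda>i. t * y i) = (\<lambda>i. t * flip y i)"
proof
  show "flip (\<lambda>i. t * y i) i = t * flip y i" for i by (cases i) auto
qed

lemma dot_flip: "dot (flip w) y = dot w (flip y)"
  by (simp add: dot_def sum_gen)

definition ker1 :: "(gen \<Rightarrow> 'k::field) \<Rightarrow> (gen \<Rightarrow> 'k) set" where
  "ker1 b = {w. dot w b = 0}"

definition ker2 :: "(gen \<Rightarrow> 'k::field) \<Rightarrow> (gen \<Rightarrow> 'k) \<Rightarrow> (gen \<Rightarrow> 'k) set" where
  "ker2 b c = {w. dot w b = 0 \<and> dot w c = 0}"

fun Om1m :: "gen \<Rightarrow> gen \<Rightarrow> 'k::field" where
  "Om1m X0 X0 = -1" | "Om1m X1 X1 = 1" | "Om1m X2 X2 = 1" | "Om1m X3 X3 = 1" | "Om1m _ _ = 0"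

section \<open>The relations, their parity and their rank at a point\<close>

locale skl_params =
  fixes \<alpha> \<beta> \<gamma> :: "'k::alg_closed_field"
  assumes two: "(2::'k) \<noteq> 0"
    and params: "sklyanin_parameters \<alpha> \<beta> \<gamma>"
begin

definition "\<omega>2 = (1 + \<alpha>) / (1 - \<beta>)"
definition "\<omega>3 = (1 - \<alpha>) / (1 + \<gamma>)"

fun Om2m :: "gen \<Rightarrow> gen \<Rightarrow> 'k" where
  "Om2m X1 X1 = 1" | "Om2m X2 X2 = \<omega>2" | "Om2m X3 X3 = \<omega>3" | "Om2m _ _ = 0"
text \<open>Sums and differences of the defining relations: \<open>R1\<close>, \<open>R2\<close> come from those of degree \<open>g\<^sub>1\<close>,
  \<open>R3\<close>, \<open>R4\<close> from degree \<open>g\<^sub>2\<close>, and \<open>R5\<close>, \<open>R6\<close> from degree \<open>g\<^sub>1 g\<^sub>2\<close>.\<close>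

fun R1 :: "gen \<Rightarrow> gen \<Rightarrow> 'k" where
  "R1 X0 X1 = 2" | "R1 X2 X3 = - (1 + \<alpha>)" | "R1 X3 X2 = 1 - \<alpha>" | "R1 _ _ = 0"
fun R2 :: "gen \<Rightarrow> gen \<Rightarrow> 'k" where
  "R2 X1 X0 = 2" | "R2 X2 X3 = - (1 - \<alpha>)" | "R2 X3 X2 = 1 + \<alpha>" | "R2 _ _ = 0"
fun R3 :: "gen \<Rightarrow> gen \<Rightarrow> 'k" where
  "R3 X0 X2 = 2" | "R3 X3 X1 = - (1 + \<beta>)" | "R3 X1 X3 = 1 - \<beta>" | "R3 _ _ = 0"
fun R4 :: "gen \<Rightarrow> gen \<Rightarrow> 'k" where
  "R4 X2 X0 = 2" | "R4 X3 X1 = - (1 - \<beta>)" | "R4 X1 X3 = 1 + \<beta>" | "R4 _ _ = 0"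
fun R5 :: "gen \<Rightarrow> gen \<Rightarrow> 'k" where
  "R5 X0 X3 = 2" | "R5 X1 X2 = - (1 + \<gamma>)" | "R5 X2 X1 = 1 - \<gamma>" | "R5 _ _ = 0"
fun R6 :: "gen \<Rightarrow> gen \<Rightarrow> 'k" where
  "R6 X3 X0 = 2" | "R6 X1 X2 = - (1 - \<gamma>)" | "R6 X2 X1 = 1 + \<gamma>" | "R6 _ _ = 0"

text \<open>Parity under \<open>flip\<close>: the even relations pair letters within
  \<open>X0\<close>, \<open>X1\<close> and within \<open>X2\<close>, \<open>X3\<close>, the odd ones
  mix the two pairs. Having enough relations of each parity is what later separates \<open>b\<close>
  from \<open>flip b\<close>.\<close>

definition "even_rels = {Om1m, Om2m, R1, R2}"
definition "odd_rels = {R3, R4, R5, R6}"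
definition "rels = even_rels \<union> odd_rels"

definition related :: "(gen \<Rightarrow> 'k) \<Rightarrow> (gen \<Rightarrow> 'k) \<Rightarrow> bool" where
  "related y z \<longleftrightarrow> (\<forall>r\<in>rels. dot (row r y) z = 0)"

lemma alpha_nz: "\<alpha> \<noteq> 0" "1 + \<alpha> \<noteq> 0" "1 - \<alpha> \<noteq> 0" "\<beta> \<noteq> 0" "1 + \<beta> \<noteq> 0" "1 - \<beta> \<noteq> 0"
  "\<gamma> \<noteq> 0" "1 + \<gamma> \<noteq> 0" "1 - \<gamma> \<noteq> 0"
  using params by (auto simp: sklyanin_parameters_def add_eq_0_iff)

lemma param_eq: "\<alpha> + \<beta> + \<gamma> + \<alpha> * \<beta> * \<gamma> = 0"
  using params by (simp add: sklyanin_parameters_def)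

lemma omega2_nz: "\<omega>2 \<noteq> 0"
  using alpha_nz by (simp add: \<omega>2_def)

text \<open>Up to the factors \<open>- b X0\<close> and \<open>- 2 * b X2\<close>, the two
  polynomials are the minors in the columns \<open>X0\<close>, \<open>X1\<close>, \<open>X2\<close>
  of the rows \<open>Om1m\<close>, \<open>Om2m\<close>, \<open>R1\<close> and \<open>R3\<close>,
  \<open>R4\<close>, \<open>R5\<close> at \<open>b\<close>. At a \<open>good\<close> point the rows
  of either parity thus have rank at least three.\<close>

definition even_minor :: "(gen \<Rightarrow> 'k) \<Rightarrow> 'k" where
  "even_minor b = (1 - \<alpha>) * b X1 * b X3 - 2 * \<omega>2 * b X0 * b X2"
definition odd_minor :: "(gen \<Rightarrow> 'k) \<Rightarrow> 'k" where
  "odd_minor b = (1 + \<beta>) * (1 + \<gamma>) * b X1 * b X3 - 2 * (1 - \<gamma>) * b X0 * b X2"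

definition good :: "(gen \<Rightarrow> 'k) \<Rightarrow> bool" where
  "good b \<longleftrightarrow> (\<forall>i. b i \<noteq> 0) \<and> even_minor b \<noteq> 0 \<and> odd_minor b \<noteq> 0"

lemma good_nz: "good b \<Longrightarrow> b i \<noteq> 0"
  by (simp add: good_def)

lemma good_flip_scale:
  assumes "good b" "t \<noteq> 0"
  shows "good (\<lambda>i. t * flip b i)"
proof -
  have 1: "even_minor (\<lambda>i. t * flip b i) = - t\<^sup>2 * even_minor b" "odd_minor (\<lambda>i. t * flip b i) = - t\<^sup>2 * odd_minor b"
    by (simp_all add: even_minor_def odd_minor_def power2_eq_square algebra_simps)
  have 2: "t * flip b i \<noteq> 0" for i
    using assms by (cases i) (auto simp: good_def)
  show ?thesis
    unfolding good_def 1 using assms 2 by (auto simp: good_def)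
qed

lemma good_flip: "good b \<Longrightarrow> good (flip b)"
  using good_flip_scale[of b 1] by simp

lemma row_flip_even: "r \<in> even_rels \<Longrightarrow> row r (flip b) = flip (row r b)"
proof (rule ext)
  fix j assume "r \<in> even_rels"
  then show "row r (flip b) j = flip (row r b) j"
    by (cases j) (auto simp: even_rels_def row_def sum_gen)
qed

lemma row_flip_odd: "r \<in> odd_rels \<Longrightarrow> row r (flip b) = (\<lambda>j. - flip (row r b) j)"
proof (rule ext)
  fix j assume "r \<in> odd_rels"
  then show "row r (flip b) j = - flip (row r b) j"
    by (cases j) (auto simp: odd_rels_def row_def sum_gen)
qed

lemma row_scale: "row r (\<lambda>i. t * b i) = (\<lambda>j. t * row r b j)"
  by (simp add: row_def sum_distrib_left mult.assoc)

lemma dot_uminus: "dot (\<lambda>i. - c i) y = - dot c y"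
  by (simp add: dot_def sum_negf)

lemma related_flip: "related b z \<Longrightarrow> related (flip b) (flip z)"
  by (auto simp: related_def rels_def row_flip_even row_flip_odd dot_flip dot_uminus)

text \<open>Three independent rows that kill \<open>z\<close> span all linear forms vanishing at
  \<open>z\<close>, since these forms make up a space of dimension three.\<close>

lemma even_expansion:
  assumes "good b" "related b z" "z \<noteq> (\<lambda>_. 0)"
  shows "z X3 \<noteq> 0"
    and "dot w z = 0 \<Longrightarrow> \<exists>k1 k2 k3. w = (\<lambda>i. k1 * row Om1m b i + k2 * row Om2m b i + k3 * row R1 b i)"
proof -
  have d: "dot (row Om1m b) z = 0" "dot (row Om2m b) z = 0" "dot (row R1 b) z = 0"
    using assms(2) by (auto simp: related_def rels_def even_rels_def)
  have M: "row Om1m b X0 * (row Om2m b X1 * row R1 b X2 - row Om2m b X2 * row R1 b X1)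
     - row Om1m b X1 * (row Om2m b X0 * row R1 b X2 - row Om2m b X2 * row R1 b X0)
     + row Om1m b X2 * (row Om2m b X0 * row R1 b X1 - row Om2m b X1 * row R1 b X0) = - b X0 * even_minor b"
    by (simp add: row_def sum_gen even_minor_def algebra_simps)
  have "- b X0 * even_minor b \<noteq> 0"
    using assms(1) by (simp add: good_def)
  from annihilator_three_rows[OF d assms(3), unfolded M, OF this]
  show "z X3 \<noteq> 0"
    and "dot w z = 0 \<Longrightarrow> \<exists>k1 k2 k3. w = (\<lambda>i. k1 * row Om1m b i + k2 * row Om2m b i + k3 * row R1 b i)"
    by auto
qed

lemma odd_expansion:
  assumes "good b" "related b z" "z \<noteq> (\<lambda>_. 0)" "dot w z = 0"
  shows "\<exists>k3 k4 k5. w = (\<lambda>i. k3 * row R3 b i + k4 * row R4 b i + k5 * row R5 b i)"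
proof -
  have d: "dot (row R3 b) z = 0" "dot (row R4 b) z = 0" "dot (row R5 b) z = 0"
    using assms(2) by (auto simp: related_def rels_def odd_rels_def)
  have M: "row R3 b X0 * (row R4 b X1 * row R5 b X2 - row R4 b X2 * row R5 b X1)
     - row R3 b X1 * (row R4 b X0 * row R5 b X2 - row R4 b X2 * row R5 b X0)
     + row R3 b X2 * (row R4 b X0 * row R5 b X1 - row R4 b X1 * row R5 b X0) = - 2 * b X2 * odd_minor b"
    by (simp add: row_def sum_gen odd_minor_def algebra_simps)
  have "- 2 * b X2 * odd_minor b \<noteq> 0"
    using assms(1) two by (simp add: good_def)
  from annihilator_three_rows(2)[OF d assms(3), unfolded M, OF this assms(4)]
  show ?thesis .
qed

text \<open>The rows at \<open>b\<close> already span the annihilator of \<open>z\<close>, so every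
  form that kills \<open>z\<close> kills \<open>z'\<close>; proportionality is read off from forms
  supported on two coordinates.\<close>

lemma related_unique:
  assumes "good b" "related b z" "z \<noteq> (\<lambda>_. 0)" "related b z'" "z' \<noteq> (\<lambda>_. 0)"
  obtains t where "t \<noteq> 0" "z' = (\<lambda>i. t * z i)"
proof -
  have ann: "dot w z' = 0" if w: "dot w z = 0" for w
  proof -
    from even_expansion(2)[OF assms(1-3) w] obtain k1 k2 k3
      where "w = (\<lambda>i. k1 * row Om1m b i + k2 * row Om2m b i + k3 * row R1 b i)" by blast
    then show ?thesis
      using assms(4) by (simp add: dot_add dot_scale related_def rels_def even_rels_def)
  qed
  have z3: "z X3 \<noteq> 0"
    using even_expansion(1)[OF assms(1-3)] .
  have e: "z' i = z' X3 / z X3 * z i" for i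
  proof -
    have "dot (\<lambda>j. z X3 * of_bool (j = i) - z i * of_bool (j = X3)) z = 0"
      by (simp add: dot_diff dot_scale dot_unit)
    from ann[OF this] have "z X3 * z' i - z i * z' X3 = 0"
      by (simp add: dot_diff dot_scale dot_unit)
    with z3 show ?thesis by (simp add: field_simps)
  qed
  have "z' X3 \<noteq> 0"
  proof
    assume "z' X3 = 0"
    then have "z' = (\<lambda>_. 0)"
      by (intro ext) (subst e, simp)
    with assms(5) show False by simp
  qed
  with z3 have "z' X3 / z X3 \<noteq> 0"
    by simp
  then show ?thesis
    using e by (rule that[OF _ ext])
qed

end

section \<open>Right ideals of forms vanishing at one point or at a pair of points\<close>

locale skl_ideal = skl_params \<alpha> \<beta> \<gamma> for \<alpha> \<beta> \<gamma> :: "'k::alg_closed_field" +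
  fixes K :: "'k free_alg set"
  assumes K_0: "0 \<in> K"
    and K_add: "f \<in> K \<Longrightarrow> g \<in> K \<Longrightarrow> f + g \<in> K"
    and K_lmult: "f \<in> K \<Longrightarrow> g * f \<in> K"
    and K_rmult: "f \<in> K \<Longrightarrow> f * g \<in> K"
    and K_rels: "r \<in> rels \<Longrightarrow> bil r \<in> K"
    and K_ev: "f \<in> K \<Longrightarrow> (\<And>i. related (ys i) (ys (Suc i))) \<Longrightarrow> ev n ys f = 0"
begin

text \<open>The right ideal generated by the linear forms in \<open>W\<close>, modulo \<open>K\<close>, in degree \<open>n + 1\<close>.\<close>

inductive_set span_by :: "(gen \<Rightarrow> 'k) set \<Rightarrow> nat \<Rightarrow> 'k free_alg set" for W n where
  span_K: "k \<in> K \<Longrightarrow> k \<in> span_by W n"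
| span_gen: "w \<in> W \<Longrightarrow> h \<in> free_deg n \<Longrightarrow> lin w * h \<in> span_by W n"
| span_add: "f \<in> span_by W n \<Longrightarrow> g \<in> span_by W n \<Longrightarrow> f + g \<in> span_by W n"

lemma span_mult: "f \<in> span_by W n \<Longrightarrow> h \<in> free_deg m \<Longrightarrow> f * h \<in> span_by W (n + m)"
proof (induction rule: span_by.induct)
  case (span_gen w g)
  then show ?case
    by (simp add: mult.assoc span_by.span_gen free_deg_mult)
qed (auto simp: distrib_right intro: span_by.intros K_rmult)

lemma span_scalar: "f \<in> span_by W n \<Longrightarrow> scalar c * f \<in> span_by W n"
proof (induction rule: span_by.induct)
  case (span_gen w g)
  have "scalar c * (lin w * g) = lin w * (scalar c * g)"
    by (simp add: lin_mult_scalar)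
  then show ?case
    using span_gen by (simp add: span_by.span_gen free_deg_scalar)
qed (auto simp: distrib_left intro: span_by.intros K_lmult)

lemma span_uminus: "f \<in> span_by W n \<Longrightarrow> - f \<in> span_by W n"
  using span_scalar[of f W n "- 1"] by (simp add: scalar_uminus)

lemma span_diff: "f \<in> span_by W n \<Longrightarrow> g \<in> span_by W n \<Longrightarrow> f - g \<in> span_by W n"
  using span_add[of f W n "- g"] span_uminus by simp

lemma span_sum: "(\<And>i. i \<in> S \<Longrightarrow> f i \<in> span_by W n) \<Longrightarrow> (\<Sum>i\<in>S. f i) \<in> span_by W n"
  by (induction S rule: infinite_finite_induct) (auto intro: span_by.intros K_0)

lemma span_transfer:
  assumes "f \<in> span_by W n" and "\<And>w. w \<in> W \<Longrightarrow> lin l * lin w \<in> span_by W' 1"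
  shows "lin l * f \<in> span_by W' (Suc n)"
  using assms(1)
proof (induction rule: span_by.induct)
  case (span_gen w g)
  then show ?case
    using span_mult[OF assms(2), of w g n] by (simp add: mult.assoc)
qed (auto simp: distrib_left intro: span_by.intros K_lmult)

text \<open>Splitting the first letter of \<open>bil r\<close> at \<open>b\<close> turns every term
  except \<open>lin m * lin (row r b)\<close> into an element of the right ideal of
  \<open>ker1 b\<close>, while the whole sum lies in \<open>K\<close>.\<close>

lemma rel_row:
  assumes "r \<in> rels" "dot m b = 1"
  shows "lin m * lin (row r b) \<in> span_by (ker1 b) 1"
proof -
  have "bil r = (\<Sum>i\<in>UNIV. lin (\<lambda>j. of_bool (j = i) - b i * m j) * lin (r i)) + lin m * lin (row r b)"
    unfolding bil_def lin_row by (rule sum_xgen_decomp)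
  then have "lin m * lin (row r b) = bil r - (\<Sum>i\<in>UNIV. lin (\<lambda>j. of_bool (j = i) - b i * m j) * lin (r i))"
    by simp
  also have "\<dots> \<in> span_by (ker1 b) 1"
    using assms by (intro span_diff span_K K_rels span_sum span_gen lin_free_deg)
      (auto simp: ker1_def dot_diff dot_scale dot_unit)
  finally show ?thesis .
qed

lemma rel_row2:
  assumes "r \<in> rels" "dot m b = 1" "dot m c = 0" "dot m' b = 0" "dot m' c = 1"
  shows "lin m * lin (row r b) + lin m' * lin (row r c) \<in> span_by (ker2 b c) 1"
proof -
  have "bil r = (\<Sum>i\<in>UNIV. lin (\<lambda>j. of_bool (j = i) - b i * m j - c i * m' j) * lin (r i))
      + lin m * lin (row r b) + lin m' * lin (row r c)"
    unfolding bil_def lin_row by (rule sum_xgen_decomp2)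
  then have "lin m * lin (row r b) + lin m' * lin (row r c)
      = bil r - (\<Sum>i\<in>UNIV. lin (\<lambda>j. of_bool (j = i) - b i * m j - c i * m' j) * lin (r i))"
    by simp
  also have "\<dots> \<in> span_by (ker2 b c) 1"
    using assms by (intro span_diff span_K K_rels span_sum span_gen lin_free_deg)
      (auto simp: ker2_def dot_diff dot_scale dot_unit)
  finally show ?thesis .
qed

text \<open>The forms vanishing at the successor \<open>z\<close> are combinations of even rows at
  \<open>b\<close>, to which \<open>rel_row\<close> applies. A general \<open>l\<close> differs from
  a multiple of \<open>m\<close> by a form vanishing at \<open>b\<close>.\<close>

lemma span_ker1:
  assumes "good b" "related b z" "z \<noteq> (\<lambda>_. 0)" "dot w z = 0"
  shows "lin l * lin w \<in> span_by (ker1 b) 1"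
proof -
  define m where "m j = (of_bool (j = X0) / b X0 :: 'k)" for j
  have m: "dot m b = 1"
    using good_nz[OF assms(1), of X0] by (simp add: m_def dot_def sum_gen)
  from even_expansion(2)[OF assms] obtain k1 k2 k3
    where w: "w = (\<lambda>i. k1 * row Om1m b i + k2 * row Om2m b i + k3 * row R1 b i)" by blast
  have "lin m * lin w = scalar k1 * (lin m * lin (row Om1m b)) + scalar k2 * (lin m * lin (row Om2m b))
      + scalar k3 * (lin m * lin (row R1 b))"
    by (simp add: w lin_add lin_scale distrib_left lin_mult_scalar)
  also have "\<dots> \<in> span_by (ker1 b) 1"
    using m by (intro span_add span_scalar rel_row) (auto simp: rels_def even_rels_def)
  finally have 1: "lin m * lin w \<in> span_by (ker1 b) 1" .
  have "lin l = scalar (dot l b) * lin m + lin (\<lambda>j. l j - dot l b * m j)"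
    by (simp add: lin_diff lin_scale)
  then have "lin l * lin w = scalar (dot l b) * (lin m * lin w) + lin (\<lambda>j. l j - dot l b * m j) * lin w"
    by (metis distrib_right mult.assoc)
  also have "\<dots> \<in> span_by (ker1 b) 1"
    using m by (intro span_add[OF span_scalar[OF 1] span_gen] lin_free_deg) (simp add: ker1_def dot_diff dot_scale)
  finally show ?thesis .
qed

text \<open>A form vanishing at \<open>z\<close> is a combination of even rows at \<open>b\<close>,
  and also one of odd rows. Passing to \<open>c\<close>, a multiple of \<open>flip b\<close>, flips
  each row with a sign given by its parity. The two expansions therefore put both
  \<open>lin m * lin w + scalar t * (lin m' * lin (flip w))\<close> and the corresponding difference
  into the span, and half their sum isolates \<open>lin m * lin w\<close>.\<close>

lemma span_ker2:
  assumes "good b" "related b z" "z \<noteq> (\<lambda>_. 0)" "dot w z = 0"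
    and c: "c = (\<lambda>i. t * flip b i)" and t: "t \<noteq> 0"
    and m: "dot m b = 1" "dot m c = 0" "dot m' b = 0" "dot m' c = 1"
  shows "lin m * lin w \<in> span_by (ker2 b c) 1"
proof -
  have ev: "lin m * lin (row r b) + scalar t * (lin m' * lin (flip (row r b))) \<in> span_by (ker2 b c) 1"
    if "r \<in> even_rels" for r
    using rel_row2[OF _ m, of r] that
    by (simp add: rels_def c row_scale row_flip_even lin_scale lin_mult_scalar)
  have od: "lin m * lin (row r b) - scalar t * (lin m' * lin (flip (row r b))) \<in> span_by (ker2 b c) 1"
    if "r \<in> odd_rels" for r
  proof -
    have "lin (row r c) = - (scalar t * lin (flip (row r b)))"
      using that lin_scale[of "- t" "flip (row r b)"]
      by (simp add: c row_scale row_flip_odd scalar_uminus)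
    then show ?thesis
      using rel_row2[OF _ m, of r] that by (simp add: rels_def lin_mult_scalar)
  qed
  have flip_comb: "flip (\<lambda>i. k1 * p i + k2 * q i + k3 * r i) = (\<lambda>i. k1 * flip p i + k2 * flip q i + k3 * flip r i)"
    for k1 k2 k3 :: 'k and p q r
  proof
    show "flip (\<lambda>i. k1 * p i + k2 * q i + k3 * r i) i = k1 * flip p i + k2 * flip q i + k3 * flip r i" for i
      by (cases i) auto
  qed
  from even_expansion(2)[OF assms(1-4)] obtain k1 k2 k3
    where w: "w = (\<lambda>i. k1 * row Om1m b i + k2 * row Om2m b i + k3 * row R1 b i)" by blast
  have "lin m * lin w + scalar t * (lin m' * lin (flip w)) =
      scalar k1 * (lin m * lin (row Om1m b) + scalar t * (lin m' * lin (flip (row Om1m b))))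
      + scalar k2 * (lin m * lin (row Om2m b) + scalar t * (lin m' * lin (flip (row Om2m b))))
      + scalar k3 * (lin m * lin (row R1 b) + scalar t * (lin m' * lin (flip (row R1 b))))"
    by (simp only: w flip_comb lin_add lin_scale)
      (simp add: distrib_left lin_mult_scalar scalar_left_commute add_ac)
  also have "\<dots> \<in> span_by (ker2 b c) 1"
    by (intro span_add span_scalar ev) (auto simp: even_rels_def)
  finally have 1: "lin m * lin w + scalar t * (lin m' * lin (flip w)) \<in> span_by (ker2 b c) 1" .
  from odd_expansion[OF assms(1-4)] obtain k3 k4 k5
    where w: "w = (\<lambda>i. k3 * row R3 b i + k4 * row R4 b i + k5 * row R5 b i)" by blast
  have "lin m * lin w - scalar t * (lin m' * lin (flip w)) =
      scalar k3 * (lin m * lin (row R3 b) - scalar t * (lin m' * lin (flip (row R3 b))))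
      + scalar k4 * (lin m * lin (row R4 b) - scalar t * (lin m' * lin (flip (row R4 b))))
      + scalar k5 * (lin m * lin (row R5 b) - scalar t * (lin m' * lin (flip (row R5 b))))"
    by (simp only: w flip_comb lin_add lin_scale)
      (simp add: distrib_left right_diff_distrib lin_mult_scalar scalar_left_commute algebra_simps)
  also have "\<dots> \<in> span_by (ker2 b c) 1"
    by (intro span_add span_scalar od) (auto simp: odd_rels_def)
  finally have 2: "lin m * lin w - scalar t * (lin m' * lin (flip w)) \<in> span_by (ker2 b c) 1" .
  have "scalar (1/2) * (2 * x) = x" for x :: "'k free_alg"
  proof -
    have "scalar (1/2) * (2 * x) = scalar (1/2 + 1/2) * x"
      unfolding scalar_add by (simp add: distrib_left distrib_right mult_2)
    also have "(1/2 + 1/2 :: 'k) = 1"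
      using two by (simp add: field_simps)
    finally show ?thesis by simp
  qed
  then have "lin m * lin w = scalar (1/2) * ((lin m * lin w + scalar t * (lin m' * lin (flip w)))
      + (lin m * lin w - scalar t * (lin m' * lin (flip w))))"
    by (simp add: mult_2)
  then show ?thesis
    using span_scalar[OF span_add[OF 1 2], of "1/2"] by simp
qed

text \<open>Relatedness is required everywhere, goodness only at the first \<open>n\<close> points:
  in degree \<open>n + 1\<close> there are \<open>n\<close> transitions between consecutive points,
  and the rank conditions concern the point where a transition starts.\<close>

definition chain :: "nat \<Rightarrow> (nat \<Rightarrow> gen \<Rightarrow> 'k) \<Rightarrow> bool" where
  "chain n ys \<longleftrightarrow> (\<forall>i. ys i \<noteq> (\<lambda>_. 0) \<and> related (ys i) (ys (Suc i))) \<and> (\<forall>i<n. good (ys i))"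

lemma chain_shift: "chain (Suc n) ys \<Longrightarrow> chain n (shift 1 ys)"
  by (auto simp: chain_def shift_apply)

lemma chain_mono: "chain (Suc n) ys \<Longrightarrow> chain n ys"
  by (auto simp: chain_def)

text \<open>Modulo the forms vanishing at \<open>zs 0\<close>, \<open>f\<close> is
  \<open>lin l * h'\<close>, where \<open>h'\<close> has degree one less and vanishes along the
  shifted sequence. By induction \<open>h'\<close> lies in the right ideal of the forms vanishing at
  \<open>zs 1\<close>, and \<open>span_ker1\<close> carries this back to
  \<open>zs 0\<close>.\<close>

lemma vanish_at_point:
  assumes "chain n zs" "f \<in> free_deg (Suc n)" "ev (Suc n) zs f = 0"
  shows "f \<in> span_by (ker1 (zs 0)) n"
  using assms
proof (induction n arbitrary: zs f rule: less_induct)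
  case (less n zs f)
  then have "zs 0 \<noteq> (\<lambda>_. 0)"
    by (auto simp: chain_def)
  then obtain i0 where i0: "zs 0 i0 \<noteq> 0" by blast
  define l where "l j = of_bool (j = i0) / zs 0 i0" for j
  have l: "dot l (zs 0) = 1"
    using i0 by (cases i0) (simp_all add: l_def dot_def sum_gen)
  obtain h where h: "\<And>i. h i \<in> free_deg n" "f = (\<Sum>i\<in>UNIV. xgen i * h i)"
    using free_deg_Suc_decomp[OF less.prems(2)] by blast
  define h' where "h' = (\<Sum>i\<in>UNIV. scalar (zs 0 i) * h i)"
  have e: "ev n (shift 1 zs) h' = 0"
    using less.prems(3) unfolding h(2) h'_def by (simp add: ev_lin ev_xgen_mult)
  have d: "h' \<in> free_deg n"
    unfolding h'_def by (intro free_deg_sum free_deg_scalar h)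
  have 1: "lin l * h' \<in> span_by (ker1 (zs 0)) n"
  proof (cases n)
    case 0
    then show ?thesis
      using free_deg_0_scalar[of h' "shift 1 zs"] d e by (simp add: span_K K_0)
  next
    case (Suc m)
    have g: "good (zs 0)" "related (zs 0) (zs 1)" "zs 1 \<noteq> (\<lambda>_. 0)"
      using less.prems(1) Suc by (auto simp: chain_def)
    have "h' \<in> span_by (ker1 (zs 1)) m"
      using less.IH[of m "shift 1 zs" h'] chain_shift less.prems(1) d e Suc by simp
    then show ?thesis
      unfolding Suc by (rule span_transfer) (use span_ker1[OF g] in \<open>auto simp: ker1_def\<close>)
  qed
  have "f = (\<Sum>i\<in>UNIV. lin (\<lambda>j. of_bool (j = i) - zs 0 i * l j) * h i) + lin l * h'"
    unfolding h(2) h'_def by (rule sum_xgen_decomp)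
  then show ?case
    using l h(1) 1 by (auto intro!: span_add span_sum span_gen simp: ker1_def dot_diff dot_scale dot_unit)
qed

lemma ker2_commute: "ker2 b c = ker2 c b"
  by (auto simp: ker2_def)

text \<open>Only the first letter has to treat both points together; afterwards \<open>h1\<close>
  and \<open>h2\<close> are handled along their own sequences by \<open>vanish_at_point\<close>. The
  index \<open>Suc n\<close> of the chains makes the starting point \<open>good\<close> even for
  \<open>n = 0\<close>.\<close>

lemma vanish_at_pair:
  assumes ys: "chain (Suc n) ys" and ys2: "chain (Suc n) ys2"
    and c: "ys2 0 = (\<lambda>i. t * flip (ys 0) i)" and t: "t \<noteq> 0"
    and f: "f \<in> free_deg (Suc n)" "ev (Suc n) ys f = 0" "ev (Suc n) ys2 f = 0"
  shows "f \<in> span_by (ker2 (ys 0) (ys2 0)) n"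
proof -
  let ?b = "ys 0" and ?c = "ys2 0"
  have g: "good ?b" "related ?b (ys 1)" "ys 1 \<noteq> (\<lambda>_. 0)"
    and g2: "good ?c" "related ?c (ys2 1)" "ys2 1 \<noteq> (\<lambda>_. 0)"
    using ys ys2 by (auto simp: chain_def)
  have c': "?b = (\<lambda>i. (1/t) * flip ?c i)"
    unfolding c flip_scale using t by simp
  have nz: "?b i \<noteq> 0" for i
    using good_nz[OF g(1)] .
  \<comment> \<open>Dual forms for the two points: \<open>b\<close> and \<open>flip b\<close> agree
    in \<open>X0\<close> and are opposite in \<open>X2\<close>.\<close>
  define m where "m j = (of_bool (j = X0) / (2 * ?b X0) + of_bool (j = X2) / (2 * ?b X2))" for j
  define m' where "m' j = (of_bool (j = X0) / (2 * t * ?b X0) - of_bool (j = X2) / (2 * t * ?b X2))" for j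
  have m: "dot m ?b = 1" "dot m ?c = 0" "dot m' ?b = 0" "dot m' ?c = 1"
    using nz two t by (simp_all add: m_def m'_def c dot_def sum_gen field_simps)
  obtain h where h: "\<And>i. h i \<in> free_deg n" "f = (\<Sum>i\<in>UNIV. xgen i * h i)"
    using free_deg_Suc_decomp[OF f(1)] by blast
  define h1 where "h1 = (\<Sum>i\<in>UNIV. scalar (?b i) * h i)"
  define h2 where "h2 = (\<Sum>i\<in>UNIV. scalar (?c i) * h i)"
  have e: "ev n (shift 1 ys) h1 = 0" "ev n (shift 1 ys2) h2 = 0"
    using f(2,3) unfolding h(2) h1_def h2_def by (simp_all add: ev_lin ev_xgen_mult)
  have d: "h1 \<in> free_deg n" "h2 \<in> free_deg n"
    unfolding h1_def h2_def by (intro free_deg_sum free_deg_scalar h)+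
  have "lin m * h1 \<in> span_by (ker2 ?b ?c) n \<and> lin m' * h2 \<in> span_by (ker2 ?b ?c) n"
  proof (cases n)
    case 0
    then have "h1 = 0" "h2 = 0"
      using free_deg_0_scalar[of h1 "shift 1 ys"] free_deg_0_scalar[of h2 "shift 1 ys2"] d e by auto
    then show ?thesis by (simp add: span_K K_0)
  next
    case (Suc k)
    have "h1 \<in> span_by (ker1 (ys 1)) k" "h2 \<in> span_by (ker1 (ys2 1)) k"
      using vanish_at_point[of k "shift 1 ys" h1] vanish_at_point[of k "shift 1 ys2" h2]
        chain_shift[OF ys] chain_shift[OF ys2] chain_mono d e Suc by auto
    moreover have "lin m * lin w \<in> span_by (ker2 ?b ?c) 1" if "w \<in> ker1 (ys 1)" for w
      using that by (intro span_ker2[OF g _ c t m]) (simp add: ker1_def)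
    \<comment> \<open>The roles of the two points are exchanged, with \<open>1 / t\<close> in place
      of \<open>t\<close>.\<close>
    moreover have "lin m' * lin w \<in> span_by (ker2 ?c ?b) 1" if "w \<in> ker1 (ys2 1)" for w
      using that t by (intro span_ker2[OF g2 _ c' _ m(4,3,2,1)]) (simp_all add: ker1_def)
    ultimately show ?thesis
      unfolding Suc using ker2_commute[of ?b ?c] by (auto intro: span_transfer)
  qed
  moreover have "f = (\<Sum>i\<in>UNIV. lin (\<lambda>j. of_bool (j = i) - ?b i * m j - ?c i * m' j) * h i)
      + lin m * h1 + lin m' * h2"
    unfolding h(2) h1_def h2_def by (rule sum_xgen_decomp2)
  ultimately show ?thesis
    using m h(1) by (auto intro!: span_add span_sum span_gen simp: ker2_def dot_diff dot_scale dot_unit)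
qed

end

subsection \<open>Division by a linear form\<close>

text \<open>When all coordinates of \<open>b\<close> are nonzero, \<open>uform b\<close> and
  \<open>vform b\<close> form a basis of the linear forms vanishing at \<open>b\<close> and
  \<open>flip b\<close>.\<close>

fun uform :: "(gen \<Rightarrow> 'k::field) \<Rightarrow> gen \<Rightarrow> 'k" where
  "uform b X0 = b X1" | "uform b X1 = - b X0" | "uform b X2 = 0" | "uform b X3 = 0"

fun vform :: "(gen \<Rightarrow> 'k::field) \<Rightarrow> gen \<Rightarrow> 'k" where
  "vform b X0 = 0" | "vform b X1 = 0" | "vform b X2 = b X3" | "vform b X3 = - b X2"

lemma bil_add: "bil (\<lambda>i j. r i j + s i j) = bil r + bil s"
  by (simp add: bil_def lin_add distrib_left sum.distrib)

lemma bil_scale: "bil (\<lambda>i j. c * r i j) = scalar c * bil r"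
proof -
  have "xgen i * (scalar c * f) = scalar c * (xgen i * f)" for i and f :: "'a free_alg"
    by (metis mult.assoc scalar_commute)
  then show ?thesis
    by (simp add: bil_def lin_scale sum_distrib_left)
qed

lemma row_add: "row (\<lambda>i j. r i j + s i j) y = (\<lambda>j. row r y j + row s y j)"
  by (simp add: row_def distrib_left sum.distrib)

lemma row_scale_rel: "row (\<lambda>i j. c * r i j) y = (\<lambda>j. c * row r y j)"
  by (simp add: row_def sum_distrib_left mult.left_commute)

lemma both_zero:
  fixes a b :: "'k::field"
  assumes "(2::'k) \<noteq> 0" "a + b = 0" "a - b = 0"
  shows "a = 0" "b = 0"
proof -
  have "a = b"
    using assms(3) by simp
  with assms(2) have "2 * b = 0"
    by (simp only: mult_2)
  with assms(1) \<open>a = b\<close> show "a = 0" "b = 0"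
    by simp_all
qed

text \<open>Adding and subtracting the row conditions at \<open>b\<close> and \<open>flip b\<close>
  separates \<open>X0\<close>, \<open>X1\<close> from \<open>X2\<close>, \<open>X3\<close>: then
  \<open>E X1\<close> is a multiple of \<open>E X0\<close> and \<open>E X3\<close> one of
  \<open>E X2\<close>, which collects the first letters into \<open>u\<close> and
  \<open>v\<close>.\<close>

lemma bil_split:
  fixes b :: "gen \<Rightarrow> 'k::field"
  assumes two: "(2::'k) \<noteq> 0" and b: "\<And>i. b i \<noteq> 0"
    and E: "row E b = (\<lambda>_. 0)" "row E (flip b) = (\<lambda>_. 0)"
  shows "bil E = lin (uform b) * lin (\<lambda>j. E X0 j / b X1) + lin (vform b) * lin (\<lambda>j. E X2 j / b X3)"
proof -
  have 1: "b X0 * E X0 j + b X1 * E X1 j = 0" and 2: "b X2 * E X2 j + b X3 * E X3 j = 0" for j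
  proof -
    have "(b X0 * E X0 j + b X1 * E X1 j) + (b X2 * E X2 j + b X3 * E X3 j) = row E b j"
      "(b X0 * E X0 j + b X1 * E X1 j) - (b X2 * E X2 j + b X3 * E X3 j) = row E (flip b) j"
      by (simp_all add: row_def sum_gen)
    note this[unfolded E]
    from both_zero[OF two this] show "b X0 * E X0 j + b X1 * E X1 j = 0" "b X2 * E X2 j + b X3 * E X3 j = 0" .
  qed
  have E1: "E X1 = (\<lambda>j. - b X0 * (E X0 j / b X1))"
    using 1 b by (intro ext) (simp add: field_simps eq_neg_iff_add_eq_0)
  have E3: "E X3 = (\<lambda>j. - b X2 * (E X2 j / b X3))"
    using 2 b by (intro ext) (simp add: field_simps eq_neg_iff_add_eq_0)
  have E0: "E X0 = (\<lambda>j. b X1 * (E X0 j / b X1))" and E2: "E X2 = (\<lambda>j. b X3 * (E X2 j / b X3))"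
    using b by simp_all
  have lu: "lin (uform b) = scalar (b X1) * xgen X0 + scalar (- b X0) * xgen X1"
    and lv: "lin (vform b) = scalar (b X3) * xgen X2 + scalar (- b X2) * xgen X3"
    by (simp_all add: lin_def sum_gen)
  have x: "xgen i * (scalar c * f) = scalar c * (xgen i * f)" for i c and f :: "'k free_alg"
    by (metis mult.assoc scalar_commute)
  have "bil E = xgen X0 * lin (E X0) + xgen X1 * lin (E X1) + xgen X2 * lin (E X2) + xgen X3 * lin (E X3)"
    by (simp add: bil_def sum_gen)
  also have "lin (E X0) = scalar (b X1) * lin (\<lambda>j. E X0 j / b X1)"
    by (subst E0) (rule lin_scale)
  also have "lin (E X1) = scalar (- b X0) * lin (\<lambda>j. E X0 j / b X1)"
    by (subst E1) (rule lin_scale)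
  also have "lin (E X2) = scalar (b X3) * lin (\<lambda>j. E X2 j / b X3)"
    by (subst E2) (rule lin_scale)
  also have "lin (E X3) = scalar (- b X2) * lin (\<lambda>j. E X2 j / b X3)"
    by (subst E3) (rule lin_scale)
  finally show ?thesis
    by (simp add: lu lv x distrib_right mult.assoc add.assoc)
qed

context skl_ideal
begin

text \<open>The four rows of either parity at \<open>b\<close> are dependent, since they annihilate the successor of
  \<open>b\<close>. A dependency gives a relation in which every term is divisible by \<open>u\<close> or \<open>v\<close> on the left.\<close>

lemma dependency:
  assumes b: "good b" "related b z" "z \<noteq> (\<lambda>_. 0)"
    and r: "r \<in> rels" "p \<in> rels" "q \<in> rels" "s \<in> rels"
    and par: "{r, p, q, s} \<subseteq> even_rels \<or> {r, p, q, s} \<subseteq> odd_rels"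
    and comb: "row r b = (\<lambda>i. k1 * row p b i + k2 * row q b i + k3 * row s b i)"
  defines "E \<equiv> (\<lambda>i j. r i j + (- k1 * p i j + (- k2 * q i j + - k3 * s i j)))"
  shows "lin (uform b) * lin (\<lambda>j. E X0 j / b X1) + lin (vform b) * lin (\<lambda>j. E X2 j / b X3) \<in> K"
    and "related (flip3 b) y \<Longrightarrow> dot (E X2) y = 0"
proof -
  have rowE: "row E y = (\<lambda>j. row r y j + (- k1 * row p y j + (- k2 * row q y j + - k3 * row s y j)))" for y
    by (simp only: E_def row_add row_scale_rel)
  have E: "row E b = (\<lambda>_. 0)"
    unfolding rowE comb by (simp add: algebra_simps)
  have E': "row E (flip b) = (\<lambda>_. 0)"
  proof -
    have z: "flip (row r b) j = k1 * flip (row p b) j + k2 * flip (row q b) j + k3 * flip (row s b) j" for j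
      by (cases j) (simp_all add: comb)
    show ?thesis
      using par by (auto simp: rowE row_flip_even row_flip_odd z algebra_simps)
  qed
  have "bil E \<in> K"
    unfolding E_def bil_add bil_scale using r by (intro K_add K_lmult K_rels)
  then show "lin (uform b) * lin (\<lambda>j. E X0 j / b X1) + lin (vform b) * lin (\<lambda>j. E X2 j / b X3) \<in> K"
    using bil_split[OF two good_nz[OF b(1)] E E'] by simp
  assume y: "related (flip3 b) y"
  have "dot (row E (flip3 b)) y = 0"
    using y r unfolding rowE dot_add dot_scale by (simp add: related_def)
  \<comment> \<open>At \<open>flip3 b\<close> the contributions of \<open>X0\<close> and
    \<open>X1\<close> still cancel, whereas those of \<open>X2\<close> and \<open>X3\<close>, which
    cancelled at \<open>b\<close>, now add up.\<close>
  moreover have "row E (flip3 b) = (\<lambda>j. 2 * b X2 * E X2 j)"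
  proof
    fix j
    have "row E b j = 0" "row E (flip b) j = 0"
      using E E' by simp_all
    then show "row E (flip3 b) j = 2 * b X2 * E X2 j"
      by (simp add: row_def sum_gen algebra_simps)
  qed
  ultimately show "dot (E X2) y = 0"
    using two good_nz[OF b(1)] by (simp add: dot_scale)
qed

text \<open>Each dependency among the rows at \<open>b\<close> rewrites \<open>v\<close> times a
  certain form as a right multiple of \<open>u\<close> modulo \<open>K\<close>. The even dependency
  yields a form in \<open>X2\<close>, \<open>X3\<close>, the odd one a form in \<open>X0\<close>,
  \<open>X1\<close>. Both vanish at \<open>q\<close> and neither is zero, so together they span the
  forms vanishing at \<open>q\<close> and \<open>flip q\<close>.\<close>

lemma v_times_pair:
  assumes b: "good b" "related b z" "z \<noteq> (\<lambda>_. 0)"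
    and q: "related (flip3 b) q" "good q" and t: "t \<noteq> 0"
    and w: "w \<in> ker2 q (\<lambda>i. t * flip q i)"
  shows "\<exists>a k. k \<in> K \<and> lin (vform b) * lin w = lin (uform b) * lin a + k"
proof -
  have "dot (row R2 b) z = 0" "dot (row R6 b) z = 0"
    using b(2) by (auto simp: related_def rels_def even_rels_def odd_rels_def)
  then obtain k1 k2 k3 k4 k5 k6
    where e: "row R2 b = (\<lambda>i. k1 * row Om1m b i + k2 * row Om2m b i + k3 * row R1 b i)"
      and o: "row R6 b = (\<lambda>i. k4 * row R3 b i + k5 * row R4 b i + k6 * row R5 b i)"
    using even_expansion(2)[OF b] odd_expansion[OF b] by blast
  define E where "E = (\<lambda>i j. R2 i j + (- k1 * Om1m i j + (- k2 * Om2m i j + - k3 * R1 i j)))"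
  define F where "F = (\<lambda>i j. R6 i j + (- k4 * R3 i j + (- k5 * R4 i j + - k6 * R5 i j)))"
  have "R2 \<in> rels" "Om1m \<in> rels" "Om2m \<in> rels" "R1 \<in> rels"
    "{R2, Om1m, Om2m, R1} \<subseteq> even_rels \<or> {R2, Om1m, Om2m, R1} \<subseteq> odd_rels"
    by (auto simp: rels_def even_rels_def)
  note dep = dependency[OF b this e]
  have E: "lin (uform b) * lin (\<lambda>j. E X0 j / b X1) + lin (vform b) * lin (\<lambda>j. E X2 j / b X3) \<in> K" "dot (E X2) q = 0"
    unfolding E_def by (rule dep(1), rule dep(2)[OF q(1)])
  have "R6 \<in> rels" "R3 \<in> rels" "R4 \<in> rels" "R5 \<in> rels"
    "{R6, R3, R4, R5} \<subseteq> even_rels \<or> {R6, R3, R4, R5} \<subseteq> odd_rels"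
    by (auto simp: rels_def odd_rels_def)
  note dep = dependency[OF b this o]
  have F: "lin (uform b) * lin (\<lambda>j. F X0 j / b X1) + lin (vform b) * lin (\<lambda>j. F X2 j / b X3) \<in> K" "dot (F X2) q = 0"
    unfolding F_def by (rule dep(1), rule dep(2)[OF q(1)])
  have E2: "E X2 X0 = 0" "E X2 X1 = 0" "F X2 X2 = 0" "F X2 X3 = 0"
    by (simp_all add: E_def F_def)
  have bnz: "b i \<noteq> 0" and qnz: "q i \<noteq> 0" for i
    using b q by (auto simp: good_def)
  have rE: "row E b X2 = 0" "row E b X3 = 0"
    unfolding E_def row_add row_scale_rel using e by simp_all
  have rF: "row F b X0 = 0"
    unfolding F_def row_add row_scale_rel using o by simp
  \<comment> \<open>Otherwise \<open>E X3\<close> would vanish in these columns too, and the entries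
    coming from \<open>R1\<close> and \<open>R2\<close> would give
    \<open>k3 * (1 + \<alpha>) = 1 - \<alpha>\<close> and
    \<open>k3 * (1 - \<alpha>) = 1 + \<alpha>\<close>, hence
    \<open>4 * \<alpha> = 0\<close>.\<close>
  have En: "E X2 X2 \<noteq> 0 \<or> E X2 X3 \<noteq> 0"
  proof (rule ccontr)
    assume n: "\<not> (E X2 X2 \<noteq> 0 \<or> E X2 X3 \<noteq> 0)"
    then have "E X3 X2 = 0" "E X3 X3 = 0"
      using rE bnz by (simp_all add: row_def sum_gen, simp_all add: E_def)
    moreover have "E X2 X3 = k3 * (1 + \<alpha>) - (1 - \<alpha>)" "E X3 X2 = (1 + \<alpha>) - k3 * (1 - \<alpha>)"
      by (simp_all add: E_def algebra_simps)
    ultimately have eq: "k3 * (1 + \<alpha>) = 1 - \<alpha>" "k3 * (1 - \<alpha>) = 1 + \<alpha>"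
      using n by simp_all
    have "(1 - \<alpha>) * (1 - \<alpha>) = (1 + \<alpha>) * (1 + \<alpha>)"
      using eq by (metis mult.assoc mult.commute)
    then have "2 * (2 * \<alpha>) = 0"
      by (simp add: algebra_simps)
    then show False
      using two alpha_nz by (metis mult_eq_0_iff)
  qed
  \<comment> \<open>Column \<open>X0\<close> decides: the entry 2 that \<open>R6\<close> contributes
    in row \<open>X3\<close> can only be balanced by row \<open>X2\<close>.\<close>
  have Fn: "F X2 X0 \<noteq> 0 \<or> F X2 X1 \<noteq> 0"
  proof (rule ccontr)
    assume n: "\<not> (F X2 X0 \<noteq> 0 \<or> F X2 X1 \<noteq> 0)"
    have "F X0 X0 = 0" "F X1 X0 = 0" "F X3 X0 = 2"
      by (simp_all add: F_def)
    then show False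
      using n rF bnz two by (simp add: row_def sum_gen)
  qed
  have w': "w X0 * q X0 + w X1 * q X1 = 0" "w X2 * q X2 + w X3 * q X3 = 0"
  proof -
    have "dot w (\<lambda>i. t * flip q i) = t * dot w (flip q)"
      by (simp add: dot_def sum_distrib_left mult.left_commute)
    then have "dot w q = 0" "dot w (flip q) = 0"
      using w t by (auto simp: ker2_def)
    moreover have "(w X0 * q X0 + w X1 * q X1) + (w X2 * q X2 + w X3 * q X3) = dot w q"
      "(w X0 * q X0 + w X1 * q X1) - (w X2 * q X2 + w X3 * q X3) = dot w (flip q)"
      by (simp_all add: dot_def sum_gen)
    ultimately have "(w X0 * q X0 + w X1 * q X1) + (w X2 * q X2 + w X3 * q X3) = 0"
      "(w X0 * q X0 + w X1 * q X1) - (w X2 * q X2 + w X3 * q X3) = 0"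
      by simp_all
    from both_zero[OF two this] show "w X0 * q X0 + w X1 * q X1 = 0" "w X2 * q X2 + w X3 * q X3 = 0" .
  qed
  \<comment> \<open>In one pair of coordinates the forms vanishing at a point with nonzero entries
    make up a line, so the two halves of \<open>w\<close> are multiples of the forms coming from
    \<open>E\<close> and \<open>F\<close>.\<close>
  have plane: "\<exists>l. x = l * x' \<and> y = l * y'"
    if "x * s + y * t = 0" "x' * s + y' * t = 0" "x' \<noteq> 0 \<or> y' \<noteq> 0" "s \<noteq> 0" "t \<noteq> 0" for x y x' y' s t :: 'k
  proof -
    have y: "y = - x * s / t" "y' = - x' * s / t"
      using that by (simp_all add: field_simps eq_neg_iff_add_eq_0)
    then have "x' \<noteq> 0"
      using that(3) by auto
    then show ?thesis
      using y by (intro exI[of _ "x / x'"]) simp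
  qed
  obtain l where l: "w X2 = l * (E X2 X2 / b X3)" "w X3 = l * (E X2 X3 / b X3)"
  proof -
    have "E X2 X2 / b X3 * q X2 + E X2 X3 / b X3 * q X3 = (E X2 X2 * q X2 + E X2 X3 * q X3) / b X3"
      by (simp add: add_divide_distrib)
    also have "\<dots> = 0"
      using E(2) E2 by (simp add: dot_def sum_gen)
    finally show ?thesis
      using plane[OF w'(2)] En bnz qnz that by (metis divide_eq_0_iff)
  qed
  obtain l' where l': "w X0 = l' * (F X2 X0 / b X3)" "w X1 = l' * (F X2 X1 / b X3)"
  proof -
    have "F X2 X0 / b X3 * q X0 + F X2 X1 / b X3 * q X1 = (F X2 X0 * q X0 + F X2 X1 * q X1) / b X3"
      by (simp add: add_divide_distrib)
    also have "\<dots> = 0"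
      using F(2) E2 by (simp add: dot_def sum_gen)
    finally show ?thesis
      using plane[OF w'(1)] Fn bnz qnz that by (metis divide_eq_0_iff)
  qed
  have "w i = l * (E X2 i / b X3) + l' * (F X2 i / b X3)" for i
    using l l' E2 by (cases i) simp_all
  then have w_eq: "w = (\<lambda>i. l * (E X2 i / b X3) + l' * (F X2 i / b X3))"
    by blast
  define a where "a = (\<lambda>i. - l * (E X0 i / b X1) + - l' * (F X0 i / b X1))"
  define k where "k = scalar l * (lin (uform b) * lin (\<lambda>j. E X0 j / b X1) + lin (vform b) * lin (\<lambda>j. E X2 j / b X3))
    + scalar l' * (lin (uform b) * lin (\<lambda>j. F X0 j / b X1) + lin (vform b) * lin (\<lambda>j. F X2 j / b X3))"
  have "k \<in> K"
    unfolding k_def by (rule K_add[OF K_lmult[OF E(1)] K_lmult[OF F(1)]])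
  moreover have "lin (vform b) * lin w = lin (uform b) * lin a + k"
    unfolding w_eq a_def k_def lin_add lin_scale
    by (simp add: distrib_left right_diff_distrib lin_mult_scalar scalar_uminus)
  ultimately show ?thesis by blast
qed

lemma span_ker2_normal_form:
  assumes "f \<in> span_by (ker2 b (flip b)) n" and b: "\<And>i. b i \<noteq> 0"
  shows "\<exists>g h k. g \<in> free_deg n \<and> h \<in> free_deg n \<and> k \<in> K \<and> f = lin (uform b) * g + lin (vform b) * h + k"
  using assms(1)
proof (induction rule: span_by.induct)
  case (span_K k)
  then show ?case
    by (intro exI[of _ 0] exI[of _ k]) simp
next
  case (span_gen w h)
  have "(w X0 * b X0 + w X1 * b X1) + (w X2 * b X2 + w X3 * b X3) = dot w b"
    "(w X0 * b X0 + w X1 * b X1) - (w X2 * b X2 + w X3 * b X3) = dot w (flip b)"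
    by (simp_all add: dot_def sum_gen)
  moreover have "dot w b = 0" "dot w (flip b) = 0"
    using span_gen(1) by (auto simp: ker2_def)
  ultimately have "(w X0 * b X0 + w X1 * b X1) + (w X2 * b X2 + w X3 * b X3) = 0"
    "(w X0 * b X0 + w X1 * b X1) - (w X2 * b X2 + w X3 * b X3) = 0"
    by simp_all
  note w = both_zero[OF two this]
  have "w i = (w X0 / b X1) * uform b i + (w X2 / b X3) * vform b i" for i
    using w b by (cases i) (simp_all add: field_simps eq_neg_iff_add_eq_0)
  then have "w = (\<lambda>i. (w X0 / b X1) * uform b i + (w X2 / b X3) * vform b i)"
    by blast
  then have "lin w = scalar (w X0 / b X1) * lin (uform b) + scalar (w X2 / b X3) * lin (vform b)"
    by (metis lin_add lin_scale)
  then have "lin w * h = lin (uform b) * (scalar (w X0 / b X1) * h) + lin (vform b) * (scalar (w X2 / b X3) * h) + 0"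
    by (simp add: lin_mult_scalar distrib_right mult.assoc)
  then show ?case
    using span_gen K_0 free_deg_scalar by blast
next
  case (span_add f f')
  then obtain g h k g' h' k' where "g \<in> free_deg n" "h \<in> free_deg n" "k \<in> K" "f = lin (uform b) * g + lin (vform b) * h + k"
    "g' \<in> free_deg n" "h' \<in> free_deg n" "k' \<in> K" "f' = lin (uform b) * g' + lin (vform b) * h' + k'"
    by blast
  then show ?case
    by (intro exI[of _ "g + g'"] exI[of _ "h + h'"] exI[of _ "k + k'"])
       (simp add: free_deg_add K_add distrib_left add_ac)
qed

lemma v_times_span:
  assumes "f \<in> span_by W n" and W: "\<And>w. w \<in> W \<Longrightarrow> \<exists>a k. k \<in> K \<and> lin v * lin w = lin u * lin a + k"
  shows "\<exists>g k. g \<in> free_deg (Suc n) \<and> k \<in> K \<and> lin v * f = lin u * g + k"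
  using assms(1)
proof (induction rule: span_by.induct)
  case (span_K k)
  then show ?case
    by (intro exI[of _ 0] exI[of _ "lin v * k"]) (simp add: K_lmult)
next
  case (span_gen w h)
  from W[OF span_gen(1)] obtain a k where k: "k \<in> K" "lin v * lin w = lin u * lin a + k"
    by blast
  have "lin v * (lin w * h) = lin u * (lin a * h) + k * h"
    unfolding mult.assoc[symmetric] k(2) by (simp add: distrib_right)
  moreover have "lin a * h \<in> free_deg (Suc n)"
    using free_deg_mult[OF lin_free_deg span_gen(2)] by simp
  ultimately show ?case
    using K_rmult[OF k(1)] by blast
next
  case (span_add f f')
  then obtain g k g' k' where "g \<in> free_deg (Suc n)" "k \<in> K" "lin v * f = lin u * g + k"
    "g' \<in> free_deg (Suc n)" "k' \<in> K" "lin v * f' = lin u * g' + k'"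
    by blast
  then show ?case
    by (intro exI[of _ "g + g'"] exI[of _ "k + k'"]) (simp add: free_deg_add K_add distrib_left add_ac)
qed

text \<open>On the curve, \<open>uform b\<close> vanishes exactly at \<open>b\<close>, \<open>flip b\<close>, \<open>flip3 b\<close> and \<open>flip (flip3 b)\<close>.\<close>

theorem division:
  assumes ch: "chain (Suc n) ys1" "chain (Suc n) ys2" "chain (Suc n) ys3" "chain (Suc n) ys4"
    and start: "ys1 0 = b" "ys2 0 = flip b" "ys3 0 = flip3 b" "ys4 0 = flip (flip3 b)"
    and f: "f \<in> free_deg (Suc n)" "ev (Suc n) ys1 f = 0" "ev (Suc n) ys2 f = 0" "ev (Suc n) ys3 f = 0"
      "ev (Suc n) ys4 f = 0"
  shows "\<exists>g k. g \<in> free_deg n \<and> k \<in> K \<and> f = lin (uform b) * g + k"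
proof -
  have gb: "good b" "related b (ys1 1)" "ys1 1 \<noteq> (\<lambda>_. 0)"
    using ch(1) start by (auto simp: chain_def)
  note bnz = good_nz[OF gb(1)]
  have "f \<in> span_by (ker2 b (flip b)) n"
    using vanish_at_pair[OF ch(1,2) _ _ f(1-3), of 1] start by simp
  from span_ker2_normal_form[OF this bnz] obtain g h k
    where gh: "g \<in> free_deg n" "h \<in> free_deg n" "k \<in> K" and f_eq: "f = lin (uform b) * g + lin (vform b) * h + k"
    by blast
  have rel: "related (ys i) (ys (Suc i))" if "chain (Suc n) ys" for ys i
    using that by (simp add: chain_def)
  have z: "dot (uform b) (flip3 b) = 0" "dot (uform b) (flip (flip3 b)) = 0"
    "dot (vform b) (flip3 b) \<noteq> 0" "dot (vform b) (flip (flip3 b)) \<noteq> 0"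
    using bnz two by (simp_all add: dot_def sum_gen)
  \<comment> \<open>At \<open>flip3 b\<close> and its flip, \<open>u\<close> vanishes and
    \<open>v\<close> does not, so the vanishing of \<open>f\<close> passes to \<open>h\<close> along
    the shifted sequences.\<close>
  have h3: "ev n (shift 1 ys3) h = 0"
    using f(4) z K_ev[where ys = ys3, OF gh(3) rel[OF ch(3)]] unfolding f_eq by (simp add: ev_lin ev_lin_mult start)
  have h4: "ev n (shift 1 ys4) h = 0"
    using f(5) z K_ev[where ys = ys4, OF gh(3) rel[OF ch(4)]] unfolding f_eq by (simp add: ev_lin ev_lin_mult start)
  show ?thesis
  proof (cases n)
    case 0
    then have "h = 0"
      using free_deg_0_scalar[of h "shift 1 ys3"] gh(2) h3 by simp
    then show ?thesis
      using gh f_eq by auto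
  next
    case (Suc m)
    let ?q = "ys3 1"
    have g3: "good (flip3 b)" "related (flip3 b) ?q" "?q \<noteq> (\<lambda>_. 0)" "good ?q"
      using ch(3) start Suc rel[OF ch(3), of 0] by (auto simp: chain_def)
    have g4: "related (flip (flip3 b)) (ys4 1)" "ys4 1 \<noteq> (\<lambda>_. 0)"
      using ch(4) start rel[OF ch(4), of 0] by (auto simp: chain_def)
    have "flip ?q \<noteq> (\<lambda>_. 0)"
      using good_nz[OF good_flip[OF g3(4)], of X0] by metis
    \<comment> \<open>By \<open>related_flip\<close>, \<open>flip ?q\<close> is a successor of
      \<open>flip (flip3 b)\<close>, and successors are unique up to a scalar; so \<open>h\<close>
      vanishes at a pair of the shape that \<open>v_times_pair\<close> handles.\<close>
    then obtain t where t: "t \<noteq> 0" "ys4 1 = (\<lambda>i. t * flip ?q i)"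
      using related_unique[OF good_flip[OF g3(1)] related_flip[OF g3(2)] _ g4] by blast
    have "h \<in> span_by (ker2 ?q (ys4 1)) m"
      using vanish_at_pair[of m "shift 1 ys3" "shift 1 ys4" t h] chain_shift ch(3,4) t gh(2) h3 h4 Suc by simp
    then obtain g' k' where "g' \<in> free_deg n" "k' \<in> K" "lin (vform b) * h = lin (uform b) * g' + k'"
      using v_times_span[of h "ker2 ?q (ys4 1)" m "vform b" "uform b"]
        v_times_pair[OF gb g3(2,4) t(1)] t(2) Suc by metis
    then show ?thesis
      using gh unfolding f_eq
      by (intro exI[of _ "g + g'"] exI[of _ "k + k'"]) (simp add: free_deg_add K_add distrib_left add_ac)
  qed
qed

end

subsection \<open>Regular functions on the affine part of the curve\<close>

lemma infinite_alg_closed: "infinite (UNIV :: 'k::alg_closed_field set)"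
proof
  assume fin: "finite (UNIV :: 'k set)"
  define p where "p = (\<Prod>a\<in>(UNIV::'k set). [:- a, 1:]) + 1"
  have "poly p x = 1" for x
  proof -
    have "(\<Prod>a\<in>(UNIV::'k set). x - a) = 0"
      using fin by (intro prod_zero) auto
    then show ?thesis
      by (simp add: p_def poly_prod)
  qed
  moreover have "degree p > 0"
  proof -
    have "degree (\<Prod>a\<in>(UNIV::'k set). [:- a, 1:]) = card (UNIV :: 'k set)"
      by (subst degree_prod_eq_sum_degree) auto
    moreover have "card (UNIV :: 'k set) > 0"
      using fin by (simp add: card_gt_0_iff)
    ultimately show ?thesis
      by (simp add: p_def degree_add_eq_left)
  qed
  ultimately show False
    using alg_closed_imp_poly_has_root[of p] by simp
qed

lemma alg_closed_sqrt: "\<exists>x::'k::alg_closed_field. x\<^sup>2 = c"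
  using alg_closed_imp_poly_has_root[of "[:- c, 0, 1:]"] by (auto simp: power2_eq_square algebra_simps)

lemma finite_square_roots: "finite {x::'k::field. x\<^sup>2 = c}"
proof (cases "\<exists>x::'k. x\<^sup>2 = c")
  case True
  then obtain x where "x\<^sup>2 = c" by blast
  then have "{x::'k. x\<^sup>2 = c} \<subseteq> {x, - x}"
    by (auto simp: power2_eq_iff)
  then show ?thesis
    using finite_subset by blast
qed simp

text \<open>The order of vanishing at \<open>r\<close> would be odd on the left and even on the
  right. This covers all three non-square conditions on the curve: \<open>C\<close> is taken to be 1
  or a polynomial not vanishing at \<open>r\<close>.\<close>

lemma order_parity:
  fixes p q :: "'k::field poly"
  assumes "poly A' r \<noteq> 0" "poly C r \<noteq> 0" and eq: "[:- r, 1:] * A' * (p * p) = C * (q * q)"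
  shows "p = 0 \<and> q = 0"
proof (rule ccontr)
  assume n: "\<not> (p = 0 \<and> q = 0)"
  have nz: "A' \<noteq> 0" "C \<noteq> 0" "[:- r, 1:] \<noteq> 0"
    using assms by auto
  then have pq: "p \<noteq> 0" "q \<noteq> 0"
    using eq n by (metis mult_eq_0_iff)+
  have nz': "[:- r, 1:] * A' \<noteq> 0" "p * p \<noteq> 0" "[:- r, 1:] * A' * (p * p) \<noteq> 0"
    using nz pq by (metis mult_eq_0_iff)+
  have "order r [:- r, 1:] = 1"
    using order_power_n_n[of r 1] by (simp only: power_one_right)
  then have "order r ([:- r, 1:] * A' * (p * p)) = 1 + 2 * order r p"
    unfolding order_mult[OF nz'(3)] order_mult[OF nz'(1)] order_mult[OF nz'(2)]
    using assms(1) by (simp add: order_0I)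
  moreover have "order r (C * (q * q)) = 2 * order r q"
    using nz pq assms(2) by (simp add: order_mult order_0I)
  ultimately show False
    unfolding eq by presburger
qed

text \<open>The norm from \<open>k(X)(\<surd>A, \<surd>C)\<close> to \<open>k(X)\<close> has trivial kernel as soon as none of \<open>A\<close>, \<open>C\<close> and
  \<open>A C\<close> is a square.\<close>

lemma biquadratic_norm_zero:
  fixes A C a0 a1 a2 a3 :: "'r::idom"
  assumes two: "(2::'r) \<noteq> 0"
    and A: "\<And>p q. A * (p * p) = q * q \<Longrightarrow> p = 0 \<and> q = 0"
    and C: "\<And>p q. C * (p * p) = q * q \<Longrightarrow> p = 0 \<and> q = 0"
    and AC: "\<And>p q. A * (p * p) = C * (q * q) \<Longrightarrow> p = 0 \<and> q = 0"
    and norm: "(a0 * a0 + A * (a1 * a1) - C * (a2 * a2 + A * (a3 * a3))) * (a0 * a0 + A * (a1 * a1) - C * (a2 * a2 + A * (a3 * a3)))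
        = A * ((2 * (a0 * a1 - C * (a2 * a3))) * (2 * (a0 * a1 - C * (a2 * a3))))"
  shows "a0 = 0 \<and> a1 = 0 \<and> a2 = 0 \<and> a3 = 0"
proof -
  have PQ: "a0 * a0 + A * (a1 * a1) - C * (a2 * a2 + A * (a3 * a3)) = 0" "2 * (a0 * a1 - C * (a2 * a3)) = 0"
    using A[OF norm[symmetric]] by blast+
  then have P: "a0 * a0 + A * (a1 * a1) = C * (a2 * a2 + A * (a3 * a3))" and Q: "a0 * a1 = C * (a2 * a3)"
    using two by simp_all
  define w0 where "w0 = a0 * a2 - A * (a1 * a3)"
  define w1 where "w1 = a1 * a2 - a0 * a3"
  define m where "m = a2 * a2 - A * (a3 * a3)"
  have "w0 * w0 + A * (w1 * w1) - C * (m * m)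
      = (a0 * a0 + A * (a1 * a1) - C * (a2 * a2 + A * (a3 * a3))) * (a2 * a2 + A * (a3 * a3))
        - 4 * A * (a2 * a3) * (a0 * a1 - C * (a2 * a3))"
    unfolding w0_def w1_def m_def by (simp add: algebra_simps)
  then have 1: "w0 * w0 + A * (w1 * w1) = C * (m * m)"
    using P Q by simp
  have "w0 * w1 = (a0 * a1 - C * (a2 * a3)) * (a2 * a2 + A * (a3 * a3))
      - (a0 * a0 + A * (a1 * a1) - C * (a2 * a2 + A * (a3 * a3))) * (a2 * a3)"
    unfolding w0_def w1_def by (simp add: algebra_simps)
  then have "w0 * w1 = 0"
    using P Q by simp
  then have "m = 0"
  proof (cases "w0 = 0")
    case True
    then show ?thesis
      using 1 AC[of w1 m] by simp
  next
    case False
    then have "w1 = 0"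
      using \<open>w0 * w1 = 0\<close> by simp
    then show ?thesis
      using 1 C[of m w0] by simp
  qed
  then have "A * (a3 * a3) = a2 * a2"
    by (simp add: m_def)
  then have a23: "a3 = 0" "a2 = 0"
    using A by blast+
  then have "a0 * a0 + A * (a1 * a1) = 0" "a0 * a1 = 0"
    using P Q by simp_all
  then have "a0 = 0 \<and> a1 = 0"
  proof (cases "a0 = 0")
    case True
    then show ?thesis
      using A[of a1 0] \<open>a0 * a0 + A * (a1 * a1) = 0\<close> by simp
  next
    case False
    then show ?thesis
      using \<open>a0 * a0 + A * (a1 * a1) = 0\<close> \<open>a0 * a1 = 0\<close> by simp
  qed
  with a23 show ?thesis by simp
qed

section \<open>The affine chart and its coordinate ring\<close>

context skl_params
begin

definition "\<mu>1 = (1 - \<gamma>) / (1 + \<alpha>)"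
definition "\<mu>2 = (1 + \<gamma>) / (1 - \<beta>)"

text \<open>Each coincidence would turn the parameter equation into a vanishing product of factors
  that cannot be zero. These inequalities make \<open>pA\<close> and \<open>pC\<close> genuine
  quadratics without a common root.\<close>

lemma mu_nz: "\<mu>1 \<noteq> 0" "\<mu>2 \<noteq> 0" "\<mu>1 \<noteq> 1" "\<mu>2 \<noteq> 1" "\<mu>1 \<noteq> \<mu>2"
proof -
  show "\<mu>1 \<noteq> 0" "\<mu>2 \<noteq> 0"
    using alpha_nz by (simp_all add: \<mu>1_def \<mu>2_def)
  show "\<mu>1 \<noteq> 1"
  proof
    assume "\<mu>1 = 1"
    then have "1 - \<gamma> = 1 + \<alpha>"
      using alpha_nz by (simp add: \<mu>1_def)
    then have "\<gamma> = - \<alpha>"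
      by (simp add: algebra_simps eq_neg_iff_add_eq_0)
    then have "\<beta> * ((1 - \<alpha>) * (1 + \<alpha>)) = 0"
      using param_eq by (simp add: algebra_simps)
    with alpha_nz show False by simp
  qed
  show "\<mu>2 \<noteq> 1"
  proof
    assume "\<mu>2 = 1"
    then have "\<gamma> = - \<beta>"
      using alpha_nz by (simp add: \<mu>2_def eq_neg_iff_add_eq_0)
    then have "\<alpha> * ((1 - \<beta>) * (1 + \<beta>)) = 0"
      using param_eq by (simp add: algebra_simps)
    with alpha_nz show False by simp
  qed
  show "\<mu>1 \<noteq> \<mu>2"
  proof
    assume "\<mu>1 = \<mu>2"
    then have e: "(1 - \<gamma>) * (1 - \<beta>) = (1 + \<gamma>) * (1 + \<alpha>)"
      using alpha_nz by (simp add: \<mu>1_def \<mu>2_def frac_eq_eq)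
    have "\<gamma> * ((1 + \<alpha>) * (1 - \<beta>)) = ((1 + \<gamma>) * (1 + \<alpha>) - (1 - \<gamma>) * (1 - \<beta>))
        - (\<alpha> + \<beta> + \<gamma> + \<alpha> * \<beta> * \<gamma>)"
      by (simp add: algebra_simps)
    with alpha_nz e param_eq show False by simp
  qed
qed

definition on_curve :: "(gen \<Rightarrow> 'k) \<Rightarrow> bool" where
  "on_curve y \<longleftrightarrow> (y X0)\<^sup>2 + (y X1)\<^sup>2 + (y X2)\<^sup>2 + (y X3)\<^sup>2 = 0 \<and>
     (y X3)\<^sup>2 + \<mu>1 * (y X1)\<^sup>2 + \<mu>2 * (y X2)\<^sup>2 = 0"

text \<open>These coefficients solve the two equations of the curve, at \<open>y X0 = 1\<close>, for
  the squares of \<open>y X2\<close> and \<open>y X3\<close> as affine functions of the square of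
  \<open>y X1\<close>.\<close>

definition "A0 = 1 / (\<mu>2 - 1)"
definition "A1 = (1 - \<mu>1) / (\<mu>2 - 1)"
definition "C0 = - \<mu>2 / (\<mu>2 - 1)"
definition "C1 = (\<mu>1 - \<mu>2) / (\<mu>2 - 1)"

definition "pA = [:A0, 0, A1:]"
definition "pC = [:C0, 0, C1:]"

lemma AC_nz: "A0 \<noteq> 0" "A1 \<noteq> 0" "C0 \<noteq> 0" "C1 \<noteq> 0"
  using mu_nz by (simp_all add: A0_def A1_def C0_def C1_def)

lemma poly_pA: "poly pA t = A0 + A1 * t\<^sup>2"
  by (simp add: pA_def power2_eq_square algebra_simps)

lemma poly_pC: "poly pC t = C0 + C1 * t\<^sup>2"
  by (simp add: pC_def power2_eq_square algebra_simps)

text \<open>Eliminating \<open>t\<^sup>2\<close> between the two quadratics leaves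
  \<open>\<mu>1 * (1 - \<mu>2)\<close>, which is nonzero. This keeps the product of
  \<open>pA\<close> and \<open>pC\<close> from being a square.\<close>

lemma no_common_root: "poly pA t = 0 \<Longrightarrow> poly pC t \<noteq> 0"
proof
  assume "poly pA t = 0" "poly pC t = 0"
  then have 1: "1 + (1 - \<mu>1) * t\<^sup>2 = 0" "- \<mu>2 + (\<mu>1 - \<mu>2) * t\<^sup>2 = 0"
    using mu_nz by (simp_all add: poly_pA poly_pC A0_def A1_def C0_def C1_def add_divide_distrib[symmetric] )
  have "\<mu>1 * (1 - \<mu>2) = \<mu>2 * (1 + (1 - \<mu>1) * t\<^sup>2) * 0 + (\<mu>1 - \<mu>2) * (1 + (1 - \<mu>1) * t\<^sup>2)
      - (1 - \<mu>1) * (- \<mu>2 + (\<mu>1 - \<mu>2) * t\<^sup>2)"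
    by (simp add: algebra_simps)
  with 1 mu_nz show False by simp
qed

definition chart :: "(gen \<Rightarrow> 'k) set" where
  "chart = {y. y X0 = 1 \<and> (y X2)\<^sup>2 = poly pA (y X1) \<and> (y X3)\<^sup>2 = poly pC (y X1)}"

lemma chart_iff: "y \<in> chart \<longleftrightarrow> y X0 = 1 \<and> on_curve y"
proof -
  define a b c where "a = (y X1)\<^sup>2" and "b = (y X2)\<^sup>2" and "c = (y X3)\<^sup>2"
  have m: "\<mu>2 - 1 \<noteq> 0"
    using mu_nz by simp
  have "b = A0 + A1 * a \<and> c = C0 + C1 * a \<longleftrightarrow> 1 + a + b + c = 0 \<and> c + \<mu>1 * a + \<mu>2 * b = 0"
  proof -
    have "b = A0 + A1 * a \<longleftrightarrow> (\<mu>2 - 1) * b = 1 + (1 - \<mu>1) * a"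
      using m by (simp add: A0_def A1_def field_simps)
    moreover have "c = C0 + C1 * a \<longleftrightarrow> (\<mu>2 - 1) * c = - \<mu>2 + (\<mu>1 - \<mu>2) * a"
    proof -
      have "C0 + C1 * a = (- \<mu>2 + (\<mu>1 - \<mu>2) * a) / (\<mu>2 - 1)"
        by (simp only: C0_def C1_def add_divide_distrib times_divide_eq_left)
      then show ?thesis
        using m by (metis mult.commute nonzero_eq_divide_eq)
    qed
    moreover have "(\<mu>2 - 1) * b = 1 + (1 - \<mu>1) * a \<and> (\<mu>2 - 1) * c = - \<mu>2 + (\<mu>1 - \<mu>2) * a
      \<longleftrightarrow> 1 + a + b + c = 0 \<and> c + \<mu>1 * a + \<mu>2 * b = 0" (is "?P \<and> ?Q \<longleftrightarrow> ?R \<and> ?S")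
    proof
      assume h: "?P \<and> ?Q"
      have "(\<mu>2 - 1) * (1 + a + b + c) = ((\<mu>2 - 1) * b - (1 + (1 - \<mu>1) * a))
          + ((\<mu>2 - 1) * c - (- \<mu>2 + (\<mu>1 - \<mu>2) * a))"
        "(\<mu>2 - 1) * (c + \<mu>1 * a + \<mu>2 * b) = ((\<mu>2 - 1) * c - (- \<mu>2 + (\<mu>1 - \<mu>2) * a))
          + \<mu>2 * ((\<mu>2 - 1) * b - (1 + (1 - \<mu>1) * a))"
        by (simp_all add: algebra_simps)
      then have "(\<mu>2 - 1) * (1 + a + b + c) = 0" "(\<mu>2 - 1) * (c + \<mu>1 * a + \<mu>2 * b) = 0"
        by (simp_all only: h diff_self mult_zero_right add_0)
      with m show "?R \<and> ?S" by simp
    next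
      assume h: "?R \<and> ?S"
      have "(\<mu>2 - 1) * b = (c + \<mu>1 * a + \<mu>2 * b) - (1 + a + b + c) + (1 + (1 - \<mu>1) * a)"
        "(\<mu>2 - 1) * c = \<mu>2 * (1 + a + b + c) - (c + \<mu>1 * a + \<mu>2 * b) + (- \<mu>2 + (\<mu>1 - \<mu>2) * a)"
        by (simp_all add: algebra_simps)
      with h show "?P \<and> ?Q" by simp
    qed
    ultimately show ?thesis by blast
  qed
  then show ?thesis
    by (auto simp: chart_def on_curve_def poly_pA poly_pC a_def b_def c_def)
qed

lemma infinite_chart: "infinite chart"
proof
  assume fin: "finite chart"
  have "t \<in> (\<lambda>y. y X1) ` chart" for t
  proof -
    obtain a b where ab: "a\<^sup>2 = poly pA t" "b\<^sup>2 = poly pC t"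
      using alg_closed_sqrt by metis
    define y where "y = (\<lambda>i. case i of X0 \<Rightarrow> 1 | X1 \<Rightarrow> t | X2 \<Rightarrow> a | X3 \<Rightarrow> b)"
    have "y \<in> chart" "t = y X1"
      using ab by (simp_all add: chart_def y_def)
    then show ?thesis by blast
  qed
  then have "UNIV \<subseteq> (\<lambda>y. y X1) ` chart"
    by blast
  then show False
    using fin infinite_alg_closed finite_subset finite_imageI by metis
qed

text \<open>The general element of the coordinate ring of the chart, which has the basis 1,
  \<open>X2\<close>, \<open>X3\<close>, \<open>X2 X3\<close> over the polynomials in
  \<open>X1\<close>.\<close>

definition reg4 :: "'k poly \<Rightarrow> 'k poly \<Rightarrow> 'k poly \<Rightarrow> 'k poly \<Rightarrow> (gen \<Rightarrow> 'k) \<Rightarrow> 'k" where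
  "reg4 a0 a1 a2 a3 y = poly a0 (y X1) + poly a1 (y X1) * y X2 + poly a2 (y X1) * y X3
     + poly a3 (y X1) * (y X2 * y X3)"

definition regular :: "((gen \<Rightarrow> 'k) \<Rightarrow> 'k) \<Rightarrow> bool" where
  "regular F \<longleftrightarrow> (\<exists>a0 a1 a2 a3. \<forall>y\<in>chart. F y = reg4 a0 a1 a2 a3 y)"

text \<open>The roots are \<open>r\<close> and \<open>- r\<close>; they differ because
  \<open>r\<close> is nonzero and the characteristic is not two.\<close>

lemma simple_root:
  assumes "c0 \<noteq> 0" "c1 \<noteq> (0::'k)"
  obtains r D where "[:c0, 0, c1:] = [:- r, 1:] * D" "poly D r \<noteq> 0" "c0 + c1 * r\<^sup>2 = 0"
proof -
  obtain r where r: "r\<^sup>2 = - c0 / c1"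
    using alg_closed_sqrt by blast
  then have r2: "c1 * r\<^sup>2 = - c0"
    using assms by simp
  then have "r \<noteq> 0"
    using assms by auto
  show ?thesis
  proof
    show "[:c0, 0, c1:] = [:- r, 1:] * smult c1 [:r, 1:]"
      using r2 by (simp add: power2_eq_square algebra_simps)
    show "poly (smult c1 [:r, 1:]) r \<noteq> 0"
      using \<open>r \<noteq> 0\<close> two assms by (simp add: mult_2[symmetric])
    show "c0 + c1 * r\<^sup>2 = 0"
      using r2 by simp
  qed
qed

text \<open>The norm down to the polynomials in \<open>X1\<close> is nonzero and vanishes at the
  \<open>X1\<close>-coordinate of every zero; over each of its finitely many roots the chart has at
  most four points.\<close>

lemma reg4_finite_zeros:
  assumes "\<not> (a0 = 0 \<and> a1 = 0 \<and> a2 = 0 \<and> a3 = 0)"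
  shows "finite {y \<in> chart. reg4 a0 a1 a2 a3 y = 0}"
proof -
  \<comment> \<open>\<open>P + Q \<surd>A\<close> is the norm that eliminates
    \<open>\<surd>C\<close>, and \<open>N\<close> is the norm of that.\<close>
  define P where "P = a0 * a0 + pA * (a1 * a1) - pC * (a2 * a2 + pA * (a3 * a3))"
  define Q where "Q = 2 * (a0 * a1 - pC * (a2 * a3))"
  define N where "N = P * P - pA * (Q * Q)"
  obtain r D where rD: "pA = [:- r, 1:] * D" "poly D r \<noteq> 0" "poly pA r = 0"
    using simple_root[OF AC_nz(1,2)] by (metis pA_def poly_pA)
  obtain s F where sF: "pC = [:- s, 1:] * F" "poly F s \<noteq> 0" "poly pC s = 0"
    using simple_root[OF AC_nz(3,4)] by (metis pC_def poly_pC)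
  have "N \<noteq> 0"
  proof
    assume "N = 0"
    then have norm: "P * P = pA * (Q * Q)"
      by (simp add: N_def)
    have "(2 :: 'k poly) \<noteq> 0"
      using two by (simp add: numeral_poly)
    moreover have "p = 0 \<and> q = 0" if "pA * (p * p) = q * q" for p q
      using order_parity[OF rD(2), of 1 p q] that unfolding rD(1) by simp
    moreover have "p = 0 \<and> q = 0" if "pC * (p * p) = q * q" for p q
      using order_parity[OF sF(2), of 1 p q] that unfolding sF(1) by simp
    moreover have "p = 0 \<and> q = 0" if "pA * (p * p) = pC * (q * q)" for p q
      using order_parity[OF rD(2) no_common_root[OF rD(3)], of p q] that unfolding rD(1) by simp
    ultimately have "a0 = 0 \<and> a1 = 0 \<and> a2 = 0 \<and> a3 = 0"
      by (rule biquadratic_norm_zero) (use norm in \<open>simp_all add: P_def Q_def\<close>)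
    with assms show False by simp
  qed
  have zero: "poly N (y X1) = 0" if y: "y \<in> chart" and z: "reg4 a0 a1 a2 a3 y = 0" for y
  proof -
    define b0 b1 b2 b3 where b: "b0 = poly a0 (y X1)" "b1 = poly a1 (y X1)" "b2 = poly a2 (y X1)" "b3 = poly a3 (y X1)"
    define A C where AC: "A = poly pA (y X1)" "C = poly pC (y X1)"
    have sq: "y X2 * y X2 = A" "y X3 * y X3 = C"
      using y by (simp_all add: chart_def AC power2_eq_square)
    define P' where "P' = b0 * b0 + A * (b1 * b1) - C * (b2 * b2 + A * (b3 * b3))"
    define Q' where "Q' = 2 * (b0 * b1 - C * (b2 * b3))"
    have "b0 + b1 * y X2 + (b2 + b3 * y X2) * y X3 = 0"
      using z by (simp add: reg4_def b algebra_simps)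
    then have "(b0 + b1 * y X2 + (b2 + b3 * y X2) * y X3) * (b0 + b1 * y X2 - (b2 + b3 * y X2) * y X3) = 0"
      by simp
    moreover have "(b0 + b1 * y X2 + (b2 + b3 * y X2) * y X3) * (b0 + b1 * y X2 - (b2 + b3 * y X2) * y X3)
      = (b0 * b0 + (y X2 * y X2) * (b1 * b1) - (y X3 * y X3) * (b2 * b2 + (y X2 * y X2) * (b3 * b3)))
        + 2 * (b0 * b1 - (y X3 * y X3) * (b2 * b3)) * y X2"
      by (simp add: algebra_simps)
    ultimately have "P' + Q' * y X2 = 0"
      unfolding sq by (simp add: P'_def Q'_def)
    then have "(P' + Q' * y X2) * (P' - Q' * y X2) = 0"
      by simp
    then have "P' * P' - (y X2 * y X2) * (Q' * Q') = 0"
      by (simp add: algebra_simps)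
    then show ?thesis
      unfolding sq by (simp add: N_def P_def Q_def P'_def Q'_def b AC)
  qed
  define S where "S = (\<Union>t\<in>{t. poly N t = 0}. {(t, a, b) |a b. a \<in> {x. x\<^sup>2 = poly pA t} \<and> b \<in> {x. x\<^sup>2 = poly pC t}})"
  have "finite S"
    unfolding S_def using poly_roots_finite[OF \<open>N \<noteq> 0\<close>] finite_square_roots
    by (intro finite_UN_I) (auto intro!: finite_subset[OF _ finite_cartesian_product[OF finite.insertI[OF finite.emptyI]
        finite_cartesian_product[OF finite_square_roots finite_square_roots]]])
  moreover have "(\<lambda>y. (y X1, y X2, y X3)) ` {y \<in> chart. reg4 a0 a1 a2 a3 y = 0} \<subseteq> S"
    using zero by (auto simp: S_def chart_def)
  moreover have "inj_on (\<lambda>y. (y X1, y X2, y X3)) {y \<in> chart. reg4 a0 a1 a2 a3 y = 0}"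
  proof (rule inj_onI)
    fix y z assume "y \<in> {y \<in> chart. reg4 a0 a1 a2 a3 y = 0}" "z \<in> {y \<in> chart. reg4 a0 a1 a2 a3 y = 0}"
      "(y X1, y X2, y X3) = (z X1, z X2, z X3)"
    then have "y i = z i" for i
      by (cases i) (simp_all add: chart_def)
    then show "y = z"
      by blast
  qed
  ultimately show ?thesis
    using finite_imageD[OF finite_subset] by blast
qed

lemma regular_finite_zeros:
  assumes "regular F" "y0 \<in> chart" "F y0 \<noteq> 0"
  shows "finite {y \<in> chart. F y = 0}"
proof -
  obtain a0 a1 a2 a3 where F: "\<And>y. y \<in> chart \<Longrightarrow> F y = reg4 a0 a1 a2 a3 y"
    using assms(1) by (auto simp: regular_def)
  have "\<not> (a0 = 0 \<and> a1 = 0 \<and> a2 = 0 \<and> a3 = 0)"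
    using F[OF assms(2)] assms(3) by (auto simp: reg4_def)
  from reg4_finite_zeros[OF this] show ?thesis
    using F by (simp cong: conj_cong)
qed

lemma regular_const: "regular (\<lambda>_. c)"
  unfolding regular_def by (intro exI[of _ "[:c:]"] exI[of _ 0]) (simp add: reg4_def)

lemma regular_coord: "regular (\<lambda>y. y i)"
proof (cases i)
  case X0
  then show ?thesis
    unfolding regular_def by (intro exI[of _ 1] exI[of _ 0]) (simp add: reg4_def chart_def)
next
  case X1
  then show ?thesis
    unfolding regular_def by (intro exI[of _ "[:0, 1:]"] exI[of _ 0]) (simp add: reg4_def)
next
  case X2
  then show ?thesis
    unfolding regular_def by (rule_tac exI[of _ 0], rule_tac exI[of _ 1]) (intro exI[of _ 0], simp add: reg4_def)
next
  case X3
  then show ?thesis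
    unfolding regular_def by (rule_tac exI[of _ 0], rule_tac exI[of _ 0], rule_tac exI[of _ 1]) (intro exI[of _ 0], simp add: reg4_def)
qed

lemma regular_add: "regular F \<Longrightarrow> regular G \<Longrightarrow> regular (\<lambda>y. F y + G y)"
proof -
  assume "regular F" "regular G"
  then obtain a0 a1 a2 a3 b0 b1 b2 b3 where
    "\<forall>y\<in>chart. F y = reg4 a0 a1 a2 a3 y" "\<forall>y\<in>chart. G y = reg4 b0 b1 b2 b3 y"
    unfolding regular_def by blast
  then have "\<forall>y\<in>chart. F y + G y = reg4 (a0 + b0) (a1 + b1) (a2 + b2) (a3 + b3) y"
    by (simp add: reg4_def algebra_simps)
  then show ?thesis
    unfolding regular_def by blast
qed

lemma regular_mult: "regular F \<Longrightarrow> regular G \<Longrightarrow> regular (\<lambda>y. F y * G y)"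
proof -
  assume "regular F" "regular G"
  then obtain a0 a1 a2 a3 b0 b1 b2 b3 where
    *: "\<forall>y\<in>chart. F y = reg4 a0 a1 a2 a3 y" "\<forall>y\<in>chart. G y = reg4 b0 b1 b2 b3 y"
    unfolding regular_def by blast
  have "F y * G y = reg4
      (a0 * b0 + pA * (a1 * b1) + pC * (a2 * b2) + pA * pC * (a3 * b3))
      (a0 * b1 + a1 * b0 + pC * (a2 * b3 + a3 * b2))
      (a0 * b2 + a2 * b0 + pA * (a1 * b3 + a3 * b1))
      (a0 * b3 + a3 * b0 + a1 * b2 + a2 * b1) y" if y: "y \<in> chart" for y
  proof -
    have sq: "poly pA (y X1) = y X2 * y X2" "poly pC (y X1) = y X3 * y X3"
      using y by (simp_all add: chart_def power2_eq_square)
    show ?thesis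
      using * y by (simp add: reg4_def sq algebra_simps)
  qed
  then show ?thesis
    unfolding regular_def by blast
qed

lemma regular_uminus: "regular F \<Longrightarrow> regular (\<lambda>y. - F y)"
  using regular_mult[OF regular_const[of "-1"], of F] by simp

lemma regular_diff: "regular F \<Longrightarrow> regular G \<Longrightarrow> regular (\<lambda>y. F y - G y)"
  using regular_add[OF _ regular_uminus, of F G] by simp

lemma regular_sum: "(\<And>x. x \<in> S \<Longrightarrow> regular (F x)) \<Longrightarrow> regular (\<lambda>y. \<Sum>x\<in>S. F x y)"
  by (induction S rule: infinite_finite_induct) (auto intro: regular_const regular_add)

end

subsection \<open>Elements vanishing along orbits\<close>

lemma self_in_proj_point: "y \<in> proj_point y"
  unfolding proj_point_def by (rule CollectI, rule exI[of _ 1]) simp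

lemma proj_point_scale: "t \<noteq> 0 \<Longrightarrow> proj_point (\<lambda>i. t * y i) = proj_point y"
proof -
  assume t: "t \<noteq> 0"
  have "z \<in> proj_point y" if "z \<in> proj_point (\<lambda>i. t * y i)" for z
  proof -
    from that obtain c where c: "c \<noteq> 0" "z = (\<lambda>i. c * (t * y i))"
      unfolding proj_point_def by blast
    then have "z = (\<lambda>i. (c * t) * y i)" "c * t \<noteq> 0"
      using t by (auto simp: mult.assoc)
    then show ?thesis
      unfolding proj_point_def by blast
  qed
  moreover have "z \<in> proj_point (\<lambda>i. t * y i)" if "z \<in> proj_point y" for z
  proof -
    from that obtain c where c: "c \<noteq> 0" "z = (\<lambda>i. c * y i)"
      unfolding proj_point_def by blast
    then have "z = (\<lambda>i. (c / t) * (t * y i))" "c / t \<noteq> 0"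
      using t by auto
    then show ?thesis
      unfolding proj_point_def by blast
  qed
  ultimately show ?thesis by blast
qed

lemma in_proj_pointE:
  assumes "z \<in> proj_point y"
  obtains t where "t \<noteq> 0" "z = (\<lambda>i. t * y i)"
  using assms unfolding proj_point_def by blast

lemma evl_scale:
  "(\<And>i. i < length w \<Longrightarrow> ys i = (\<lambda>j. t i * zs i j)) \<Longrightarrow> evl ys w = (\<Prod>i<length w. t i) * evl zs w"
proof (induction w arbitrary: ys zs t)
  case (Cons a w)
  have "evl (shift 1 ys) w = (\<Prod>i<length w. t (Suc i)) * evl (shift 1 zs) w"
    using Cons.prems by (intro Cons.IH) (simp add: shift_apply)
  moreover have "ys 0 = (\<lambda>j. t 0 * zs 0 j)"
    using Cons.prems by simp
  ultimately show ?case
    by (simp add: prod.lessThan_Suc_shift del: prod.lessThan_Suc)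
qed simp

lemma ev_scale:
  assumes "\<And>i. i < n \<Longrightarrow> ys i = (\<lambda>j. t i * zs i j)"
  shows "ev n ys f = (\<Prod>i<n. t i) * ev n zs f"
proof -
  have "evw ys w = (\<Prod>i<n. t i) * evw zs w" if "wlen w = n" for w
    using evl_scale[of "letters w" ys t zs] assms that by (simp add: wlen_def evw_def)
  then show ?thesis
    unfolding ev_def lext_def sum_distrib_left by (intro sum.cong) auto
qed

section \<open>Points of the elliptic curve and finiteness of exceptional sets\<close>

context skl_params
begin

abbreviation E :: "'k proj_point set" where "E \<equiv> skl_curve \<alpha> \<beta> \<gamma>"

lemma on_curve_scale: "on_curve y \<Longrightarrow> on_curve (\<lambda>i. t * y i)"
proof -
  assume "on_curve y"
  then have "t\<^sup>2 * ((y X0)\<^sup>2 + (y X1)\<^sup>2 + (y X2)\<^sup>2 + (y X3)\<^sup>2) = 0"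
    "t\<^sup>2 * ((y X3)\<^sup>2 + \<mu>1 * (y X1)\<^sup>2 + \<mu>2 * (y X2)\<^sup>2) = 0"
    by (simp_all add: on_curve_def)
  then show ?thesis
    by (simp add: on_curve_def power_mult_distrib algebra_simps)
qed

lemma E_eq: "E = {proj_point y |y. y \<noteq> (\<lambda>_. 0) \<and> on_curve y}"
  unfolding skl_curve_def on_curve_def \<mu>1_def \<mu>2_def by (simp add: algebra_simps)

lemma in_EI: "y \<noteq> (\<lambda>_. 0) \<Longrightarrow> on_curve y \<Longrightarrow> proj_point y \<in> E"
  unfolding E_eq by blast

lemma in_point:
  assumes "p \<in> E" "y \<in> p"
  shows "p = proj_point y" "y \<noteq> (\<lambda>_. 0)" "on_curve y"
proof -
  obtain z where z: "p = proj_point z" "z \<noteq> (\<lambda>_. 0)" "on_curve z"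
    using assms(1) unfolding E_eq by blast
  then obtain t where t: "t \<noteq> 0" "y = (\<lambda>i. t * z i)"
    using assms(2) in_proj_pointE by blast
  show "p = proj_point y" "on_curve y"
    using z t by (auto simp: proj_point_scale on_curve_scale)
  show "y \<noteq> (\<lambda>_. 0)"
    using z(2) t by (auto simp: fun_eq_iff)
qed

lemma point_nonempty: "p \<in> E \<Longrightarrow> \<exists>y. y \<in> p"
  unfolding E_eq using self_in_proj_point by blast

lemma chart_in_E: "y \<in> chart \<Longrightarrow> proj_point y \<in> E"
  by (rule in_EI) (auto simp: chart_iff)

lemma chart_inj:
  assumes "y X0 = 1" "z X0 = 1" "proj_point y = proj_point z"
  shows "y = z"
proof -
  obtain t where "y = (\<lambda>i. t * z i)"
    using assms(3) self_in_proj_point in_proj_pointE by metis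
  with assms show ?thesis by simp
qed

lemma infinite_E: "infinite E"
proof
  assume "finite E"
  moreover have "proj_point ` chart \<subseteq> E"
    using chart_in_E by blast
  moreover have "inj_on proj_point chart"
    by (rule inj_onI) (auto intro: chart_inj simp: chart_iff)
  ultimately show False
    using infinite_chart finite_imageD finite_subset by blast
qed

lemma normalize:
  assumes "p \<in> E" "y \<in> p" "y X0 \<noteq> 0"
  obtains z where "z \<in> chart" "p = proj_point z" "z = (\<lambda>i. (1 / y X0) * y i)"
proof
  let ?z = "\<lambda>i. (1 / y X0) * y i"
  show "?z \<in> chart"
    unfolding chart_iff using assms in_point(3)[OF assms(1,2)] on_curve_scale[of y "1 / y X0"] by simp
  show "p = proj_point ?z"
    using in_point(1)[OF assms(1,2)] proj_point_scale[of "1 / y X0" y] assms(3) by simp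
qed simp

lemma finite_at_infinity: "finite {p \<in> E. \<exists>y\<in>p. y X0 = 0}"
proof -
  \<comment> \<open>At \<open>y X0 = 0\<close> the two equations force the value \<open>a\<close>
    for the square of \<open>y X2 / y X1\<close>; the denominator cannot vanish there.\<close>
  define a where "a = (1 - \<mu>1) / (\<mu>2 - 1)"
  define V where "V = (\<lambda>(b, c) i. case i of X0 \<Rightarrow> 0 | X1 \<Rightarrow> (1::'k) | X2 \<Rightarrow> b | X3 \<Rightarrow> c)
    ` ({b. b\<^sup>2 = a} \<times> {c. c\<^sup>2 = - 1 - a})"
  have "finite V"
    unfolding V_def by (intro finite_imageI finite_cartesian_product finite_square_roots)
  moreover have "{p \<in> E. \<exists>y\<in>p. y X0 = 0} \<subseteq> proj_point ` V"
  proof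
    fix p assume "p \<in> {p \<in> E. \<exists>y\<in>p. y X0 = 0}"
    then obtain y where y: "p \<in> E" "y \<in> p" "y X0 = 0" by blast
    have c: "y X1 ^ 2 + y X2 ^ 2 + y X3 ^ 2 = 0" "(y X3)\<^sup>2 + \<mu>1 * (y X1)\<^sup>2 + \<mu>2 * (y X2)\<^sup>2 = 0"
      using in_point(3)[OF y(1,2)] y(3) by (simp_all add: on_curve_def)
    have "(\<mu>2 - 1) * (y X2)\<^sup>2 = ((y X3)\<^sup>2 + \<mu>1 * (y X1)\<^sup>2 + \<mu>2 * (y X2)\<^sup>2) - (y X1 ^ 2 + y X2 ^ 2 + y X3 ^ 2)
        + (1 - \<mu>1) * (y X1)\<^sup>2"
      by (simp add: algebra_simps)
    then have e2: "(\<mu>2 - 1) * (y X2)\<^sup>2 = (1 - \<mu>1) * (y X1)\<^sup>2"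
      using c by simp
    have y1: "y X1 \<noteq> 0"
    proof
      assume "y X1 = 0"
      then have "y X2 = 0"
        using e2 mu_nz by simp
      then have "y X3 = 0"
        using c \<open>y X1 = 0\<close> by simp
      then have "y i = 0" for i
        using y \<open>y X1 = 0\<close> \<open>y X2 = 0\<close> by (cases i) auto
      then show False
        using in_point(2)[OF y(1,2)] by blast
    qed
    define z where "z = (\<lambda>i. (1 / y X1) * y i)"
    have "p = proj_point z"
      unfolding z_def using in_point(1)[OF y(1,2)] proj_point_scale[of "1 / y X1" y] y1 by simp
    moreover have "(z X2)\<^sup>2 = a"
      using e2 y1 mu_nz by (simp add: z_def a_def power_divide frac_eq_eq) (simp add: mult.commute)
    moreover have "(z X3)\<^sup>2 = - 1 - (z X2)\<^sup>2"
    proof -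
      have "(1 / y X1)\<^sup>2 * (y X1 ^ 2 + y X2 ^ 2 + y X3 ^ 2) = 0"
        using c by simp
      then have "1 + (z X2)\<^sup>2 + (z X3)\<^sup>2 = 0"
        using y1 by (simp add: z_def distrib_left power_divide)
      then show ?thesis
        by (simp add: algebra_simps eq_neg_iff_add_eq_0)
    qed
    moreover have "z = (\<lambda>i. case i of X0 \<Rightarrow> 0 | X1 \<Rightarrow> 1 | X2 \<Rightarrow> z X2 | X3 \<Rightarrow> z X3)"
      using y y1 by (intro ext) (simp add: z_def split: gen.split)
    ultimately show "p \<in> proj_point ` V"
      unfolding V_def by (intro image_eqI[of _ _ z]) (auto intro!: image_eqI[of _ _ "(z X2, z X3)"])
  qed
  ultimately show ?thesis
    using finite_subset by blast
qed

text \<open>A condition stable under scaling can be tested on the normalised representative in the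
  chart, and only finitely many points lie off the chart.\<close>

lemma finite_points:
  assumes fin: "finite {y \<in> chart. Q y}" and scale: "\<And>y t. t \<noteq> 0 \<Longrightarrow> Q y \<Longrightarrow> Q (\<lambda>i. t * y i)"
  shows "finite {p \<in> E. \<exists>y\<in>p. Q y}"
proof -
  have "{p \<in> E. \<exists>y\<in>p. Q y} \<subseteq> {p \<in> E. \<exists>y\<in>p. y X0 = 0} \<union> proj_point ` {y \<in> chart. Q y}"
  proof
    fix p assume "p \<in> {p \<in> E. \<exists>y\<in>p. Q y}"
    then obtain y where y: "p \<in> E" "y \<in> p" "Q y" by blast
    show "p \<in> {p \<in> E. \<exists>y\<in>p. y X0 = 0} \<union> proj_point ` {y \<in> chart. Q y}"
    proof (cases "y X0 = 0")
      case False
      with y obtain z where z: "z \<in> chart" "p = proj_point z" "z = (\<lambda>i. (1 / y X0) * y i)"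
        using normalize by metis
      then have "Q z"
        using scale[of "1 / y X0" y] y False by simp
      with z show ?thesis by blast
    qed (use y in blast)
  qed
  then show ?thesis
    using fin finite_at_infinity finite_subset by blast
qed

lemma finite_lin_zeros:
  assumes "c \<noteq> (\<lambda>_. 0)"
  shows "finite {p \<in> E. \<exists>y\<in>p. dot c y = 0}"
proof (rule finite_points)
  have "\<not> ([:c X0, c X1:] = 0 \<and> [:c X2:] = 0 \<and> [:c X3:] = 0 \<and> (0::'k poly) = 0)"
  proof
    assume "[:c X0, c X1:] = 0 \<and> [:c X2:] = 0 \<and> [:c X3:] = 0 \<and> (0::'k poly) = 0"
    then have "c i = 0" for i by (cases i) auto
    with assms show False by blast
  qed
  from reg4_finite_zeros[OF this] show "finite {y \<in> chart. dot c y = 0}"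
    by (rule rev_finite_subset) (auto simp: reg4_def dot_def sum_gen chart_def algebra_simps)
  show "dot c (\<lambda>i. t * y i) = 0" if "dot c y = 0" for y t
    using that by (simp add: dot_def sum_distrib_left mult.left_commute flip: sum_distrib_left)
qed

lemma finite_not_good: "finite {p \<in> E. \<exists>y\<in>p. \<not> good y}"
proof (rule finite_points)
  have "finite {y \<in> chart. reg4 [:0, 1:] 0 0 0 y = 0}" "finite {y \<in> chart. reg4 0 1 0 0 y = 0}"
    "finite {y \<in> chart. reg4 0 0 1 0 y = 0}"
    by (rule reg4_finite_zeros, simp)+
  \<comment> \<open>The two minors written out at \<open>y X0 = 1\<close>; the conditions on the
    parameters make their coefficients nonzero.\<close>
  moreover have "finite {y \<in> chart. reg4 0 [:- 2 * \<omega>2:] [:0, 1 - \<alpha>:] 0 y = 0}"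
    "finite {y \<in> chart. reg4 0 [:- 2 * (1 - \<gamma>):] [:0, (1 + \<beta>) * (1 + \<gamma>):] 0 y = 0}"
    using alpha_nz two omega2_nz by (intro reg4_finite_zeros; simp)+
  moreover have "{y \<in> chart. \<not> good y} \<subseteq> {y \<in> chart. reg4 [:0, 1:] 0 0 0 y = 0} \<union> {y \<in> chart. reg4 0 1 0 0 y = 0}
    \<union> {y \<in> chart. reg4 0 0 1 0 y = 0} \<union> {y \<in> chart. reg4 0 [:- 2 * \<omega>2:] [:0, 1 - \<alpha>:] 0 y = 0}
    \<union> {y \<in> chart. reg4 0 [:- 2 * (1 - \<gamma>):] [:0, (1 + \<beta>) * (1 + \<gamma>):] 0 y = 0}"
    by (auto simp: good_def all_gen reg4_def chart_def even_minor_def odd_minor_def algebra_simps)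
  ultimately show "finite {y \<in> chart. \<not> good y}"
    by (meson finite_UnI finite_subset)
  show "\<not> good (\<lambda>i. t * y i)" if "t \<noteq> 0" "\<not> good y" for y t
  proof
    assume "good (\<lambda>i. t * y i)"
    from good_flip[OF good_flip_scale[OF this, of "1 / t"]] show False
      using that by (simp add: flip_scale)
  qed
qed

text \<open>Cramer's rule for the successor of \<open>b\<close>, from the relations \<open>Om1m\<close>, \<open>Om2m\<close> and \<open>R1\<close>; it fails
  where \<open>b X0 * even_minor b = 0\<close>.\<close>

definition step :: "(gen \<Rightarrow> 'k) \<Rightarrow> gen \<Rightarrow> 'k" where
  "step b = (let s1 = - (1 - \<alpha>) * \<omega>3 * (b X3 * b X3) - (1 + \<alpha>) * \<omega>2 * (b X2 * b X2);
                 s2 = (1 + \<alpha>) * (b X1 * b X2) + 2 * \<omega>3 * (b X0 * b X3)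
             in (\<lambda>i. case i of X0 \<Rightarrow> b X1 * s1 + b X2 * s2 + b X3 * even_minor b
                    | X1 \<Rightarrow> b X0 * s1 | X2 \<Rightarrow> b X0 * s2 | X3 \<Rightarrow> b X0 * even_minor b))"

lemma step_simps:
  "step b X0 = b X1 * (- (1 - \<alpha>) * \<omega>3 * (b X3 * b X3) - (1 + \<alpha>) * \<omega>2 * (b X2 * b X2))
     + b X2 * ((1 + \<alpha>) * (b X1 * b X2) + 2 * \<omega>3 * (b X0 * b X3)) + b X3 * even_minor b"
  "step b X1 = b X0 * (- (1 - \<alpha>) * \<omega>3 * (b X3 * b X3) - (1 + \<alpha>) * \<omega>2 * (b X2 * b X2))"
  "step b X2 = b X0 * ((1 + \<alpha>) * (b X1 * b X2) + 2 * \<omega>3 * (b X0 * b X3))"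
  "step b X3 = b X0 * even_minor b"
  by (simp_all add: step_def Let_def)

lemma step_scale: "step (\<lambda>i. t * b i) = (\<lambda>i. t ^ 3 * step b i)"
proof
  fix i show "step (\<lambda>i. t * b i) i = t ^ 3 * step b i"
    by (cases i) (simp_all add: step_simps even_minor_def power3_eq_cube algebra_simps)
qed

lemma step_related:
  assumes "good b" "related b z" "z \<noteq> (\<lambda>_. 0)"
  shows "\<exists>t. t \<noteq> 0 \<and> z = (\<lambda>i. t * step b i)"
proof -
  define D where "D = even_minor b"
  define s1 where "s1 = - (1 - \<alpha>) * \<omega>3 * (b X3 * b X3) - (1 + \<alpha>) * \<omega>2 * (b X2 * b X2)"
  define s2 where "s2 = (1 + \<alpha>) * (b X1 * b X2) + 2 * \<omega>3 * (b X0 * b X3)"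
  have nz: "b X0 \<noteq> 0" "D \<noteq> 0"
    using assms(1) by (auto simp: good_def D_def)
  have z3: "z X3 \<noteq> 0"
    using even_expansion(1)[OF assms] .
  have "dot (row Om1m b) z = 0" "dot (row Om2m b) z = 0" "dot (row R1 b) z = 0"
    using assms(2) by (auto simp: related_def rels_def even_rels_def)
  then have e1: "- b X0 * z X0 + b X1 * z X1 + b X2 * z X2 + b X3 * z X3 = 0"
    and e2: "b X1 * z X1 + \<omega>2 * b X2 * z X2 + \<omega>3 * b X3 * z X3 = 0"
    and e3: "2 * b X0 * z X1 + (1 - \<alpha>) * b X3 * z X2 - (1 + \<alpha>) * b X2 * z X3 = 0"
    by (simp_all add: dot_def row_def sum_gen algebra_simps)
  have "D * z X1 = (1 - \<alpha>) * b X3 * (b X1 * z X1 + \<omega>2 * b X2 * z X2 + \<omega>3 * b X3 * z X3)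
      - \<omega>2 * b X2 * (2 * b X0 * z X1 + (1 - \<alpha>) * b X3 * z X2 - (1 + \<alpha>) * b X2 * z X3) + s1 * z X3"
    by (simp add: D_def s1_def even_minor_def algebra_simps)
  then have z1: "D * z X1 = s1 * z X3"
    by (simp only: e2 e3) simp
  have "D * z X2 = b X1 * (2 * b X0 * z X1 + (1 - \<alpha>) * b X3 * z X2 - (1 + \<alpha>) * b X2 * z X3)
      - 2 * b X0 * (b X1 * z X1 + \<omega>2 * b X2 * z X2 + \<omega>3 * b X3 * z X3) + s2 * z X3"
    by (simp add: D_def s2_def even_minor_def algebra_simps)
  then have z2: "D * z X2 = s2 * z X3"
    by (simp only: e2 e3) simp
  have "b X0 * (D * z X0) = b X1 * (D * z X1) + b X2 * (D * z X2) + b X3 * (D * z X3)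
      - D * (- b X0 * z X0 + b X1 * z X1 + b X2 * z X2 + b X3 * z X3)"
    by (simp add: algebra_simps)
  then have z0: "b X0 * (D * z X0) = (b X1 * s1 + b X2 * s2 + b X3 * D) * z X3"
    by (simp only: e1 z1 z2) (simp add: algebra_simps)
  \<comment> \<open>The coordinate \<open>X3\<close> fixes the factor, since
    \<open>step b X3\<close> is \<open>b X0 * D\<close>.\<close>
  define t where "t = z X3 / (b X0 * D)"
  have tD: "t * (b X0 * D) = z X3"
    using nz by (simp add: t_def)
  have "(b X0 * D) * z i = (b X0 * D) * (t * step b i)" for i
  proof (cases i)
    case X0
    have "(b X0 * D) * (t * step b X0) = (b X1 * s1 + b X2 * s2 + b X3 * D) * (t * (b X0 * D))"
      by (simp add: step_simps s1_def s2_def D_def mult_ac)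
    then show ?thesis
      unfolding X0 tD z0[symmetric] by (simp only: mult.assoc)
  next
    case X1
    have "(b X0 * D) * (t * step b X1) = b X0 * (s1 * (t * (b X0 * D)))"
      by (simp add: step_simps s1_def D_def mult_ac)
    then show ?thesis
      unfolding X1 tD z1[symmetric] by (simp only: mult.assoc)
  next
    case X2
    have "(b X0 * D) * (t * step b X2) = b X0 * (s2 * (t * (b X0 * D)))"
      by (simp add: step_simps s2_def D_def mult_ac)
    then show ?thesis
      unfolding X2 tD z2[symmetric] by (simp only: mult.assoc)
  next
    case X3
    have "(b X0 * D) * (t * step b X3) = (b X0 * D) * (t * (b X0 * D))"
      by (simp add: step_simps D_def)
    then show ?thesis
      unfolding X3 tD by (rule sym)
  qed
  then have "z i = t * step b i" for i
    using nz by (metis mult_cancel_left mult_eq_0_iff)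
  then have "z = (\<lambda>i. t * step b i)"
    by blast
  moreover have "t \<noteq> 0"
    using nz z3 by (simp add: t_def)
  ultimately show ?thesis by blast
qed

lemma regular_step: "(\<And>j. regular (\<lambda>y. G y j)) \<Longrightarrow> regular (\<lambda>y. step (G y) j)"
  by (cases j) (simp_all add: step_simps even_minor_def, (intro regular_add regular_diff regular_mult regular_const | assumption)+)

lemma regular_steps: "regular (\<lambda>y. (step ^^ i) y j)"
proof (induction i arbitrary: j)
  case 0
  then show ?case by (simp add: regular_coord)
next
  case (Suc i)
  then show ?case using regular_step[of "step ^^ i" j] by simp
qed

lemma regular_evl: "regular (\<lambda>y. evl (\<lambda>i. (step ^^ (i + m)) y) w)"
proof (induction w arbitrary: m)
  case Nil
  then show ?case by (simp add: regular_const)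
next
  case (Cons a w)
  have "shift 1 (\<lambda>i. (step ^^ (i + m)) y) = (\<lambda>i. (step ^^ (i + Suc m)) y)" for y
    by (simp add: shift_def)
  then show ?case
    using regular_mult[OF regular_steps[of m a] Cons.IH[of "Suc m"]] by simp
qed

lemma regular_ev: "regular (\<lambda>y. ev n (\<lambda>i. (step ^^ i) y) f)"
proof -
  have "regular (\<lambda>y. if wlen w = n then evw (\<lambda>i. (step ^^ i) y) w else 0)" for w
    using regular_evl[of 0 "letters w"] by (cases "wlen w = n") (simp_all add: evw_def regular_const)
  then show ?thesis
    unfolding ev_def lext_def by (intro regular_sum regular_mult regular_const) 
qed

end

section \<open>Orbits, the vanishing theorem and finiteness of zeros\<close>

locale skl_orbits = skl_ideal \<alpha> \<beta> \<gamma> K for \<alpha> \<beta> \<gamma> :: "'k::alg_closed_field" and K +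
  fixes \<sigma> :: "'k proj_point \<Rightarrow> 'k proj_point"
  assumes bij: "bij_betw \<sigma> E E"
    and related_succ: "p \<in> E \<Longrightarrow> y \<in> p \<Longrightarrow> z \<in> \<sigma> p \<Longrightarrow> related y z"
begin

lemma bij_pow: "bij_betw (\<sigma> ^^ i) E E"
  using bij by (induction i) (auto intro: bij_betw_trans bij_betw_id simp: id_def[symmetric])

lemma pow_in_E: "p \<in> E \<Longrightarrow> (\<sigma> ^^ i) p \<in> E"
  using bij_pow by (meson bij_betw_apply)

definition orbit :: "'k proj_point \<Rightarrow> (nat \<Rightarrow> gen \<Rightarrow> 'k) \<Rightarrow> bool" where
  "orbit p ys \<longleftrightarrow> (\<forall>i. ys i \<in> (\<sigma> ^^ i) p)"

lemma orbit_exists: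
  assumes "p \<in> E" "y \<in> p"
  obtains ys where "orbit p ys" "ys 0 = y"
proof -
  have "\<exists>z. z \<in> (\<sigma> ^^ i) p" for i
    using point_nonempty[OF pow_in_E[OF assms(1)]] .
  then obtain zs where zs: "\<And>i. zs i \<in> (\<sigma> ^^ i) p"
    by metis
  show ?thesis
    by (rule that[of "zs(0 := y)"]) (use zs assms in \<open>auto simp: orbit_def\<close>)
qed

lemma orbit_related: "p \<in> E \<Longrightarrow> orbit p ys \<Longrightarrow> related (ys i) (ys (Suc i))"
  by (rule related_succ[OF pow_in_E[of p i]]) (auto simp: orbit_def dest: spec[of _ "Suc i"])

lemma finite_preimage: "finite T \<Longrightarrow> finite {p \<in> E. (\<sigma> ^^ i) p \<in> T}"
proof -
  assume "finite T"
  from finite_vimage_IntI[OF this bij_betw_imp_inj_on[OF bij_pow[of i]]]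
  show ?thesis
    by (rule rev_finite_subset) auto
qed

definition bad :: "nat \<Rightarrow> 'k proj_point set" where
  "bad n = (\<Union>i<n. {p \<in> E. (\<sigma> ^^ i) p \<in> {p \<in> E. \<exists>y\<in>p. \<not> good y}})"

lemma finite_bad: "finite (bad n)"
  unfolding bad_def using finite_preimage[OF finite_not_good] by blast

lemma orbit_chain:
  assumes "p \<in> E" "p \<notin> bad n" "orbit p ys"
  shows "chain n ys"
  unfolding chain_def
proof (intro conjI allI impI)
  fix i
  have i: "ys i \<in> (\<sigma> ^^ i) p" "(\<sigma> ^^ i) p \<in> E"
    using assms pow_in_E by (auto simp: orbit_def)
  show "ys i \<noteq> (\<lambda>_. 0)"
    using in_point(2)[OF i(2,1)] .
  show "related (ys i) (ys (Suc i))"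
    using orbit_related assms by blast
  assume "i < n"
  then show "good (ys i)"
    using assms i by (auto simp: bad_def)
qed

text \<open>The finite exceptional set is what lets the induction run: after division by
  \<open>u\<close>, the vanishing of the quotient is known only off the images of the old exceptions
  and of the zeros of \<open>u\<close>.\<close>

theorem vanishing_in_K:
  assumes "f \<in> free_deg n" "finite T" "\<And>p ys. p \<in> E \<Longrightarrow> p \<notin> T \<Longrightarrow> orbit p ys \<Longrightarrow> ev n ys f = 0"
  shows "f \<in> K"
  using assms
proof (induction n arbitrary: f T)
  case (0 f T)
  have "infinite (E - T)"
    using infinite_E 0 by simp
  then obtain p where p: "p \<in> E" "p \<notin> T"
    by (metis DiffE finite.emptyI ex_in_conv)
  then obtain ys where "orbit p ys"
    using orbit_exists point_nonempty by metis
  then have "f = scalar 0"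
    using 0 p free_deg_0_scalar[of f ys] by metis
  then show ?case by (simp add: K_0)
next
  case (Suc n f T)
  \<comment> \<open>The bad points are added so that orbits starting outside \<open>T'\<close> are
    chains, as \<open>division\<close> demands.\<close>
  define T' where "T' = T \<union> bad (Suc n)"
  have fT': "finite T'"
    using Suc.prems finite_bad by (simp add: T'_def)
  have inj: "inj_on (\<lambda>y. proj_point (\<phi> y)) chart"
    if "\<And>y. \<phi> y X0 = y X0" "\<And>y z. \<phi> y = \<phi> z \<Longrightarrow> y = z" for \<phi> :: "(gen \<Rightarrow> 'k) \<Rightarrow> gen \<Rightarrow> 'k"
    using that by (intro inj_onI) (metis chart_iff chart_inj)
  have flip_inj: "y = z" if "flip y = flip z" for y z :: "gen \<Rightarrow> 'k"
    using that by (metis flip_flip)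
  have flip3_inj: "y = z" if "flip3 y = flip3 z" for y z :: "gen \<Rightarrow> 'k"
  proof
    fix i show "y i = z i"
      using fun_cong[OF that, of i] by (cases i) auto
  qed
  have fin: "finite {y \<in> chart. proj_point (\<phi> y) \<in> T'}"
    if "\<And>y. \<phi> y X0 = y X0" "\<And>y z. \<phi> y = \<phi> z \<Longrightarrow> y = z" for \<phi> :: "(gen \<Rightarrow> 'k) \<Rightarrow> gen \<Rightarrow> 'k"
    using finite_vimage_IntI[OF fT' inj[of \<phi>, OF that]] by (rule rev_finite_subset) auto
  have "finite ({y \<in> chart. proj_point y \<in> T'} \<union> {y \<in> chart. proj_point (flip y) \<in> T'}
    \<union> {y \<in> chart. proj_point (flip3 y) \<in> T'} \<union> {y \<in> chart. proj_point (flip (flip3 y)) \<in> T'})" (is "finite ?bad")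
  proof (intro finite_UnI)
    show "finite {y \<in> chart. proj_point y \<in> T'}"
      by (rule fin) simp_all
    show "finite {y \<in> chart. proj_point (flip y) \<in> T'}"
      by (rule fin) (simp, erule flip_inj)
    show "finite {y \<in> chart. proj_point (flip3 y) \<in> T'}"
      by (rule fin) (simp, erule flip3_inj)
    show "finite {y \<in> chart. proj_point (flip (flip3 y)) \<in> T'}"
      by (rule fin) (simp, rule flip3_inj, erule flip_inj)
  qed
  then have "infinite (chart - ?bad)"
    using infinite_chart by (rule Diff_infinite_finite)
  then have "chart - ?bad \<noteq> {}"
    by (rule infinite_imp_nonempty)
  then obtain b where b: "b \<in> chart" "proj_point b \<notin> T'" "proj_point (flip b) \<notin> T'"
    "proj_point (flip3 b) \<notin> T'" "proj_point (flip (flip3 b)) \<notin> T'"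
    by blast
  have cb: "on_curve b" "b X0 = 1"
    using b by (auto simp: chart_iff)
  then have ch: "flip b \<in> chart" "flip3 b \<in> chart" "flip (flip3 b) \<in> chart"
    by (simp_all add: chart_iff on_curve_def)
  obtain ys1 ys2 ys3 ys4 where ys: "orbit (proj_point b) ys1" "ys1 0 = b" "orbit (proj_point (flip b)) ys2" "ys2 0 = flip b"
    "orbit (proj_point (flip3 b)) ys3" "ys3 0 = flip3 b" "orbit (proj_point (flip (flip3 b))) ys4" "ys4 0 = flip (flip3 b)"
    using orbit_exists[OF chart_in_E self_in_proj_point] b(1) ch by metis
  have chain: "chain (Suc n) zs" and zero: "ev (Suc n) zs f = 0"
    if "y \<in> chart" "proj_point y \<notin> T'" "orbit (proj_point y) zs" for y zs
    using orbit_chain[OF chart_in_E[OF that(1)] _ that(3)] that Suc.prems(3)[OF chart_in_E[OF that(1)] _ that(3)]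
    by (auto simp: T'_def)
  obtain g k where gk: "g \<in> free_deg n" "k \<in> K" "f = lin (uform b) * g + k"
    using division[OF chain[OF b(1,2) ys(1)] chain[OF ch(1) b(3) ys(3)] chain[OF ch(2) b(4) ys(5)]
        chain[OF ch(3) b(5) ys(7)] ys(2,4,6,8) Suc.prems(1) zero[OF b(1,2) ys(1)] zero[OF ch(1) b(3) ys(3)]
        zero[OF ch(2) b(4) ys(5)] zero[OF ch(3) b(5) ys(7)]] by blast
  define Z where "Z = {p \<in> E. \<exists>y\<in>p. dot (uform b) y = 0}"
  have "uform b \<noteq> (\<lambda>_. 0)"
    using cb(2) by (metis neg_0_equal_iff_equal uform.simps(2) zero_neq_one)
  then have "finite Z"
    unfolding Z_def by (rule finite_lin_zeros)
  have "g \<in> K"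
  proof (rule Suc.IH[OF gk(1)])
    \<comment> \<open>The quotient is evaluated from the second point on, so its exceptional
      starting points are images under \<open>\<sigma>\<close>.\<close>
    show "finite (\<sigma> ` (T \<union> Z))"
      using Suc.prems \<open>finite Z\<close> by simp
    fix q zs assume q: "q \<in> E" "q \<notin> \<sigma> ` (T \<union> Z)" "orbit q zs"
    obtain p where p: "p \<in> E" "q = \<sigma> p"
      using bij q(1) by (metis bij_betw_imp_surj_on imageE)
    obtain y where y: "y \<in> p"
      using point_nonempty[OF p(1)] by blast
    \<comment> \<open>The given orbit is prolonged backwards by a representative of the preimage
      \<open>p\<close>.\<close>
    define ys where "ys i = (case i of 0 \<Rightarrow> y | Suc j \<Rightarrow> zs j)" for i
    have orb: "orbit p ys"
      unfolding orbit_def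
    proof
      fix i show "ys i \<in> (\<sigma> ^^ i) p"
        using y q(3) by (cases i) (auto simp: ys_def orbit_def p(2) funpow_swap1)
    qed
    have "ev (Suc n) ys f = 0"
      using Suc.prems(3)[OF p(1) _ orb] q(2) p(2) by blast
    moreover have "ev (Suc n) ys k = 0"
      using K_ev[OF gk(2)] orbit_related[OF p(1) orb] by blast
    moreover have "shift 1 ys = zs"
      by (simp add: shift_def ys_def)
    ultimately have "dot (uform b) y * ev n zs g = 0"
      unfolding gk(3) by (simp add: ev_lin ev_lin_mult) (simp add: ys_def)
    moreover have "dot (uform b) y \<noteq> 0"
      using q(2) p y by (auto simp: Z_def)
    ultimately show "ev n zs g = 0" by simp
  qed
  then show ?case
    unfolding gk(3) by (intro K_add K_lmult gk(2))
qed

text \<open>Each transition follows \<open>step\<close> up to a scalar; \<open>i = n\<close> is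
  allowed because only the points before it have to be good.\<close>

lemma orbit_steps:
  assumes p: "p \<in> E" "p \<notin> bad n" "orbit p ys" and y: "p = proj_point y"
  shows "i \<le> n \<Longrightarrow> \<exists>t. t \<noteq> 0 \<and> ys i = (\<lambda>j. t * (step ^^ i) y j)"
proof (induction i)
  case 0
  have "ys 0 \<in> proj_point y"
    using p(3) y by (metis funpow_0 orbit_def)
  then show ?case
    by (rule in_proj_pointE) auto
next
  case (Suc i)
  then obtain t where t: "t \<noteq> 0" "ys i = (\<lambda>j. t * (step ^^ i) y j)" by auto
  have "chain n ys"
    using orbit_chain p by blast
  then obtain s where s: "s \<noteq> 0" "ys (Suc i) = (\<lambda>j. s * step (ys i) j)"
    using step_related[of "ys i" "ys (Suc i)"] Suc.prems unfolding chain_def by force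
  show ?case
    using s t by (intro exI[of _ "s * t ^ 3"]) (simp add: step_scale mult.assoc)
qed

text \<open>By \<open>vanishing_in_K\<close>, \<open>f\<close> is nonzero along some orbit outside
  \<open>T\<close>. Along such orbits evaluation is, up to a nonzero scalar, a regular function on
  the chart, which then has finitely many zeros.\<close>

theorem finite_zeros:
  assumes f: "f \<in> free_deg n" "f \<notin> K"
  shows "finite {p \<in> E. \<exists>ys. orbit p ys \<and> ev n ys f = 0}"
proof -
  let ?F = "\<lambda>y. ev n (\<lambda>i. (step ^^ i) y) f"
  define T where "T = bad n \<union> {p \<in> E. \<exists>y\<in>p. y X0 = 0}"
  have fT: "finite T"
    by (simp add: T_def finite_bad finite_at_infinity)
  have ev_F: "ev n ys f = 0 \<longleftrightarrow> ?F y = 0" if p: "p \<in> E" "p \<notin> T" "orbit p ys" and y: "p = proj_point y" for p ys y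
  proof -
    have "\<forall>i. \<exists>t. i \<le> n \<longrightarrow> t \<noteq> 0 \<and> ys i = (\<lambda>j. t * (step ^^ i) y j)"
      using orbit_steps[OF p(1) _ p(3) y] p(2) by (auto simp: T_def)
    then obtain t where t: "\<And>i. i \<le> n \<Longrightarrow> t i \<noteq> 0 \<and> ys i = (\<lambda>j. t i * (step ^^ i) y j)"
      by metis
    have "ev n ys f = (\<Prod>i<n. t i) * ?F y"
      by (rule ev_scale) (use t in auto)
    moreover have "(\<Prod>i<n. t i) \<noteq> 0"
      using t by simp
    ultimately show ?thesis by simp
  qed
  have norm: "\<exists>y\<in>chart. q = proj_point y" if q: "q \<in> E" "q \<notin> T" for q
  proof -
    obtain y where y: "y \<in> q"
      using point_nonempty[OF q(1)] by blast
    then have "y X0 \<noteq> 0"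
      using q by (auto simp: T_def)
    with normalize[OF q(1) y] show ?thesis by blast
  qed
  obtain p ys where p: "p \<in> E" "p \<notin> T" "orbit p ys" "ev n ys f \<noteq> 0"
    using vanishing_in_K[OF f(1) fT] f(2) by blast
  then obtain y where y: "y \<in> chart" "p = proj_point y"
    using norm by blast
  then have "?F y \<noteq> 0"
    using ev_F p by blast
  then have "finite {y \<in> chart. ?F y = 0}"
    using regular_finite_zeros[OF regular_ev y(1)] by blast
  moreover have "{p \<in> E. \<exists>ys. orbit p ys \<and> ev n ys f = 0} \<subseteq> T \<union> proj_point ` {y \<in> chart. ?F y = 0}"
  proof
    fix q assume "q \<in> {p \<in> E. \<exists>ys. orbit p ys \<and> ev n ys f = 0}"
    then obtain zs where q: "q \<in> E" "orbit q zs" "ev n zs f = 0" by blast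
    show "q \<in> T \<union> proj_point ` {y \<in> chart. ?F y = 0}"
    proof (cases "q \<in> T")
      case False
      then obtain z where "z \<in> chart" "q = proj_point z"
        using norm q(1) by blast
      then show ?thesis
        using ev_F[OF q(1) False q(2)] q(3) by blast
    qed simp
  qed
  ultimately show ?thesis
    using fT finite_subset by blast
qed

end

subsection \<open>The kernel of the projection to \<open>B\<close>\<close>

lemma ring_free_ring: "ring (free_ring :: 'k::field free_alg ring)"
proof -
  have "\<exists>y. x + y = 0" for x :: "'k free_alg"
    using add.right_inverse by blast
  then show ?thesis
    unfolding ring_of_type_algebra_def
    by unfold_locales (auto simp: algebra_simps Units_def add_eq_0_iff)
qed

lemma free_ring_simps [simp]:
  "carrier (free_ring :: 'k::field free_alg ring) = UNIV"
  "x \<otimes>\<^bsub>free_ring\<^esub> (y :: 'k free_alg) = x * y"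
  "x \<oplus>\<^bsub>free_ring\<^esub> (y :: 'k free_alg) = x + y"
  "\<one>\<^bsub>free_ring\<^esub> = (1 :: 'k free_alg)"
  "\<zero>\<^bsub>free_ring\<^esub> = (0 :: 'k free_alg)"
  by (simp_all add: ring_of_type_algebra_def)

lemma free_ring_uminus [simp]: "\<ominus>\<^bsub>free_ring\<^esub> (x :: 'k::field free_alg) = - x"
proof -
  interpret ring "free_ring :: 'k free_alg ring" by (rule ring_free_ring)
  show ?thesis
    by (rule minus_equality) simp_all
qed

lemma free_ring_minus [simp]: "x \<ominus>\<^bsub>free_ring\<^esub> y = x - (y :: 'k::field free_alg)"
  by (simp add: a_minus_def)

lemma ideal_free_ringI:
  assumes "0 \<in> J" "\<And>f g. f \<in> J \<Longrightarrow> g \<in> J \<Longrightarrow> f + g \<in> J"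
    "\<And>f g. f \<in> J \<Longrightarrow> g * f \<in> J" "\<And>f g. f \<in> J \<Longrightarrow> f * g \<in> J"
  shows "ideal J (free_ring :: 'k::field free_alg ring)"
proof (rule idealI)
  show "ring (free_ring :: 'k free_alg ring)" by (rule ring_free_ring)
  interpret R: ring "free_ring :: 'k free_alg ring" by (rule ring_free_ring)
  have "- f \<in> J" if "f \<in> J" for f
    using assms(3)[OF that, of "- 1"] by simp
  then show "subgroup J (add_monoid (free_ring :: 'k free_alg ring))"
    using assms by (intro R.add.subgroupI) (auto simp: a_inv_def[symmetric])
qed (use assms in auto)

lemma xgen_mult_xgen: "xgen i * xgen j = single (Word [i, j]) 1"
  by (simp add: xgen_def mult_single plus_word_def)

lemma bil_single: "bil r = (\<Sum>i\<in>UNIV. \<Sum>j\<in>UNIV. single (Word [i, j]) (r i j))"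
  unfolding bil_def lin_def sum_distrib_left
proof (intro sum.cong refl)
  fix i j
  have "xgen i * (scalar (r i j) * xgen j) = scalar (r i j) * (xgen i * xgen j)"
    by (metis mult.assoc scalar_commute)
  then show "xgen i * (scalar (r i j) * xgen j) = single (Word [i, j]) (r i j)"
    by (simp add: xgen_mult_xgen scalar_mult_single)
qed

lemma gev_bil: "gev n g ys (bil r) =
  (\<Sum>i\<in>UNIV. \<Sum>j\<in>UNIV. if n = 2 \<and> gadd (gdeg i) (gdeg j) = g then r i j * (ys 0 i * ys 1 j) else 0)"
  unfolding bil_single gev_lin
proof (intro sum.cong refl)
  fix i j
  have "wlen (Word [i, j]) = 2" "wdeg (Word [i, j]) = gadd (gdeg i) (gdeg j)" "evw ys (Word [i, j]) = ys 0 i * ys 1 j"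
    by (simp_all add: wlen_def wdeg_def evw_def)
  then show "gev n g ys (single (Word [i, j]) (r i j)) =
     (if n = 2 \<and> gadd (gdeg i) (gdeg j) = g then r i j * (ys 0 i * ys 1 j) else 0)"
    by (auto simp: gev_single)
qed

context skl_params
begin

abbreviation "S \<equiv> sklyanin \<alpha> \<beta> \<gamma>"
abbreviation "B \<equiv> skl_B \<alpha> \<beta> \<gamma>"
abbreviation "toS \<equiv> to_skl \<alpha> \<beta> \<gamma>"
abbreviation "toB \<equiv> to_B \<alpha> \<beta> \<gamma>"
abbreviation "relI \<equiv> Idl\<^bsub>free_ring\<^esub> (sklyanin_relations \<alpha> \<beta> \<gamma>)"
abbreviation "\<Omega>I \<equiv> \<Omega>_ideal \<alpha> \<beta> \<gamma>"

lemma ideal_I: "ideal relI free_ring"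
  by (rule ring.genideal_ideal[OF ring_free_ring]) simp

lemma ring_S: "ring S"
  unfolding sklyanin_def by (rule ideal.quotient_is_ring[OF ideal_I])

lemma toS_hom: "ring_hom_ring free_ring S toS"
  using ideal.rcos_ring_hom_ring[OF ideal_I] unfolding sklyanin_def to_skl_def .

lemma toS_simps:
  "toS f \<in> carrier S" "toS (f + g) = toS f \<oplus>\<^bsub>S\<^esub> toS g" "toS (f * g) = toS f \<otimes>\<^bsub>S\<^esub> toS g"
  "toS 1 = \<one>\<^bsub>S\<^esub>" "toS 0 = \<zero>\<^bsub>S\<^esub>"
  using ring_hom_closed[OF ring_hom_ring.homh[OF toS_hom], of f]
    ring_hom_add[OF ring_hom_ring.homh[OF toS_hom], of f g]
    ring_hom_mult[OF ring_hom_ring.homh[OF toS_hom], of f g]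
    ring_hom_one[OF ring_hom_ring.homh[OF toS_hom]]
    ring_hom_zero[OF ring_hom_ring.homh[OF toS_hom] ring_free_ring ring_S]
  by simp_all

lemma carrier_S: "carrier S = range toS"
  by (auto simp: sklyanin_def FactRing_def A_RCOSETS_def' to_skl_def)

lemma toS_eq_iff: "toS f = toS g \<longleftrightarrow> f - g \<in> relI"
  using ring.quotient_eq_iff_same_a_r_cos[OF ring_free_ring ideal_I, of f g] by (simp add: to_skl_def)

lemma ideal_\<Omega>: "ideal \<Omega>I S"
  unfolding \<Omega>_ideal_def by (rule ring.genideal_ideal[OF ring_S]) (simp add: toS_simps)

lemma ring_B: "ring B"
  unfolding skl_B_def by (rule ideal.quotient_is_ring[OF ideal_\<Omega>])

lemma rcos_B_hom: "ring_hom_ring S B ((+>\<^bsub>S\<^esub>) \<Omega>I)"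
  using ideal.rcos_ring_hom_ring[OF ideal_\<Omega>] unfolding skl_B_def .

lemma toB_simps:
  "toB f \<in> carrier B" "toB (f + g) = toB f \<oplus>\<^bsub>B\<^esub> toB g" "toB (f * g) = toB f \<otimes>\<^bsub>B\<^esub> toB g"
  "toB 1 = \<one>\<^bsub>B\<^esub>" "toB 0 = \<zero>\<^bsub>B\<^esub>"
  unfolding to_B_def
  using ring_hom_closed[OF ring_hom_ring.homh[OF rcos_B_hom], of "toS f"]
    ring_hom_add[OF ring_hom_ring.homh[OF rcos_B_hom], of "toS f" "toS g"]
    ring_hom_mult[OF ring_hom_ring.homh[OF rcos_B_hom], of "toS f" "toS g"]
    ring_hom_one[OF ring_hom_ring.homh[OF rcos_B_hom]]
    ring_hom_zero[OF ring_hom_ring.homh[OF rcos_B_hom] ring_S ring_B]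
  by (simp_all add: toS_simps)

lemma carrier_B: "carrier B = range toB"
  by (auto simp: skl_B_def FactRing_def A_RCOSETS_def' to_B_def carrier_S)

definition kerB :: "'k free_alg set" where
  "kerB = {f. toB f = \<zero>\<^bsub>B\<^esub>}"

lemma toB_uminus: "toB (- f) = \<ominus>\<^bsub>B\<^esub> toB f"
proof -
  interpret B: ring B by (rule ring_B)
  have "toB (- f) \<oplus>\<^bsub>B\<^esub> toB f = \<zero>\<^bsub>B\<^esub>"
    by (simp flip: toB_simps)
  then show ?thesis
    using B.minus_equality toB_simps(1) by metis
qed

lemma toB_eq_iff: "toB f = toB g \<longleftrightarrow> f - g \<in> kerB"
proof -
  interpret B: ring B by (rule ring_B)
  have "toB (f - g) = toB f \<ominus>\<^bsub>B\<^esub> toB g"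
    using toB_simps(2)[of f "- g"] by (simp add: toB_uminus a_minus_def)
  then show ?thesis
    using B.r_right_minus_eq toB_simps(1) by (simp add: kerB_def)
qed

lemma kerB_iff: "f \<in> kerB \<longleftrightarrow> toS f \<in> \<Omega>I"
proof -
  interpret \<Omega>: ideal \<Omega>I S by (rule ideal_\<Omega>)
  have "\<zero>\<^bsub>B\<^esub> = \<Omega>I"
    by (simp add: skl_B_def FactRing_def)
  then show ?thesis
    unfolding kerB_def to_B_def
    using \<Omega>.rcos_const_imp_mem[of "toS f"] ring.a_rcos_zero[OF ring_S ideal_\<Omega>, of "toS f"] toS_simps(1)
    by auto
qed

lemma kerB_0: "0 \<in> kerB"
  by (simp add: kerB_def toB_simps)

lemma kerB_add: "f \<in> kerB \<Longrightarrow> g \<in> kerB \<Longrightarrow> f + g \<in> kerB"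
  using ring.ring_simprules(8)[OF ring_B, of "\<zero>\<^bsub>B\<^esub>"] ring.ring_simprules(2)[OF ring_B]
  by (simp add: kerB_def toB_simps)

lemma kerB_lmult: "f \<in> kerB \<Longrightarrow> g * f \<in> kerB"
proof -
  interpret B: ring B by (rule ring_B)
  show "f \<in> kerB \<Longrightarrow> g * f \<in> kerB"
    by (simp add: kerB_def toB_simps)
qed

lemma kerB_rmult: "f \<in> kerB \<Longrightarrow> f * g \<in> kerB"
proof -
  interpret B: ring B by (rule ring_B)
  show "f \<in> kerB \<Longrightarrow> f * g \<in> kerB"
    by (simp add: kerB_def toB_simps)
qed

lemma sub_I_kerB: "relI \<subseteq> kerB"
proof
  fix f assume "f \<in> relI"
  then have "toS f = toS 0"
    by (simp add: toS_eq_iff)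
  moreover have "\<zero>\<^bsub>S\<^esub> \<in> \<Omega>I"
    using additive_subgroup.zero_closed[OF ideal.axioms(1)[OF ideal_\<Omega>]] .
  ultimately show "f \<in> kerB"
    by (simp add: kerB_iff toS_simps)
qed

lemma relation_in_I: "r \<in> sklyanin_relations \<alpha> \<beta> \<gamma> \<Longrightarrow> r \<in> relI"
  using ring.genideal_self[OF ring_free_ring, of "sklyanin_relations \<alpha> \<beta> \<gamma>"] by auto

lemma single_2: "single w (2::'k) = single w 1 + single w 1"
  by (simp flip: single_add)

lemma bil_R:
  "bil R1 = (commutator (xgen X0) (xgen X1) - scalar \<alpha> * anticommutator (xgen X2) (xgen X3))
     + (anticommutator (xgen X0) (xgen X1) - commutator (xgen X2) (xgen X3))"
  "bil R2 = (anticommutator (xgen X0) (xgen X1) - commutator (xgen X2) (xgen X3))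
     - (commutator (xgen X0) (xgen X1) - scalar \<alpha> * anticommutator (xgen X2) (xgen X3))"
  "bil R3 = (commutator (xgen X0) (xgen X2) - scalar \<beta> * anticommutator (xgen X3) (xgen X1))
     + (anticommutator (xgen X0) (xgen X2) - commutator (xgen X3) (xgen X1))"
  "bil R4 = (anticommutator (xgen X0) (xgen X2) - commutator (xgen X3) (xgen X1))
     - (commutator (xgen X0) (xgen X2) - scalar \<beta> * anticommutator (xgen X3) (xgen X1))"
  "bil R5 = (commutator (xgen X0) (xgen X3) - scalar \<gamma> * anticommutator (xgen X1) (xgen X2))
     + (anticommutator (xgen X0) (xgen X3) - commutator (xgen X1) (xgen X2))"
  "bil R6 = (anticommutator (xgen X0) (xgen X3) - commutator (xgen X1) (xgen X2))
     - (commutator (xgen X0) (xgen X3) - scalar \<gamma> * anticommutator (xgen X1) (xgen X2))"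
  "bil Om1m = \<Omega>1"
  "bil Om2m = \<Omega>2 \<alpha> \<beta> \<gamma>"
  by (simp_all add: bil_single sum_gen commutator_def anticommutator_def xgen_mult_xgen distrib_left
      scalar_mult_single single_add single_diff single_uminus single_2 \<Omega>1_def \<Omega>2_def \<omega>2_def \<omega>3_def
      power2_eq_square)

lemma I_add: "f \<in> relI \<Longrightarrow> g \<in> relI \<Longrightarrow> f + g \<in> relI"
  using additive_subgroup.a_closed[OF ideal.axioms(1)[OF ideal_I], of f g] by simp

lemma I_diff: "f \<in> relI \<Longrightarrow> g \<in> relI \<Longrightarrow> f - g \<in> relI"
  using I_add[of f "- g"] additive_subgroup.a_inv_closed[OF ideal.axioms(1)[OF ideal_I], of g] by simp

lemma R_in_I: "r \<in> {R1, R2, R3, R4, R5, R6} \<Longrightarrow> bil r \<in> relI"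
  by (elim insertE emptyE; hypsubst; unfold bil_R; rule I_add I_diff; rule relation_in_I;
      simp add: sklyanin_relations_def)

lemma rels_eq: "rels = {R1, R2, R3, R4, R5, R6} \<union> {Om1m, Om2m}"
  by (auto simp: rels_def even_rels_def odd_rels_def)

lemma rels_in_kerB: "r \<in> rels \<Longrightarrow> bil r \<in> kerB"
proof -
  assume r: "r \<in> rels"
  have "{toS \<Omega>1, toS (\<Omega>2 \<alpha> \<beta> \<gamma>)} \<subseteq> \<Omega>I"
    unfolding \<Omega>_ideal_def by (rule ring.genideal_self[OF ring_S]) (simp add: toS_simps)
  then have "bil Om1m \<in> kerB" "bil Om2m \<in> kerB"
    by (simp_all add: kerB_iff bil_R)
  with r show ?thesis
    using R_in_I sub_I_kerB unfolding rels_eq by blast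
qed

text \<open>Arbitrary related sequences are allowed, and tails of these are again related, which
  gives closure under left multiplication. Asking for each G-degree separately makes the
  G-components of elements of \<open>kerB\<close> vanish along orbits as well.\<close>

definition vanishing :: "'k free_alg set" where
  "vanishing = {f. \<forall>ys n g. (\<forall>i. related (ys i) (ys (Suc i))) \<longrightarrow> gev n g ys f = 0}"

lemma vanishing_0: "0 \<in> vanishing"
  by (simp add: vanishing_def gev_lin)

lemma vanishing_add: "f \<in> vanishing \<Longrightarrow> g \<in> vanishing \<Longrightarrow> f + g \<in> vanishing"
  by (simp add: vanishing_def gev_lin)

lemma vanishing_lmult: "f \<in> vanishing \<Longrightarrow> g * f \<in> vanishing"
  by (auto simp: vanishing_def gev_mult shift_apply intro!: sum.neutral)

lemma vanishing_rmult: "f \<in> vanishing \<Longrightarrow> f * g \<in> vanishing"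
  by (auto simp: vanishing_def gev_mult intro!: sum.neutral)

lemma vanishing_ideal: "ideal vanishing free_ring"
  by (rule ideal_free_ringI[OF vanishing_0 vanishing_add vanishing_lmult vanishing_rmult])

lemma vanishing_diff: "f \<in> vanishing \<Longrightarrow> g \<in> vanishing \<Longrightarrow> f - g \<in> vanishing"
  by (simp add: vanishing_def gev_lin)

lemma rels_vanish: "r \<in> rels \<Longrightarrow> bil r \<in> vanishing"
proof -
  assume r: "r \<in> rels"
  have "gev n g ys (bil r) = 0" if "\<forall>i. related (ys i) (ys (Suc i))" for ys n g
  proof -
    have "dot (row r (ys 0)) (ys 1) = 0"
      using that r by (simp add: related_def)
    then show ?thesis
      using r unfolding rels_def even_rels_def odd_rels_def gev_bil
      by (cases g; cases "n = 2") (auto simp: sum_gen dot_def row_def algebra_simps)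
  qed
  then show ?thesis
    by (simp add: vanishing_def)
qed

text \<open>Halving recovers the six defining relations from their sums and differences
  \<open>R1\<close> to \<open>R6\<close>.\<close>

lemma relations_subset:
  assumes J: "\<And>f g. f \<in> J \<Longrightarrow> g \<in> J \<Longrightarrow> f + g \<in> J" "\<And>f g. f \<in> J \<Longrightarrow> g * f \<in> J"
    and R: "\<And>r. r \<in> {R1, R2, R3, R4, R5, R6} \<Longrightarrow> bil r \<in> J"
  shows "sklyanin_relations \<alpha> \<beta> \<gamma> \<subseteq> J"
proof -
  have half: "f \<in> J \<and> g \<in> J" if "f + g \<in> J" "g - f \<in> J" for f g
  proof -
    have "scalar (1/2) * (h + h) = h" for h :: "'k free_alg"
    proof -
      have "scalar (1/2) * (h + h) = scalar (1/2 + 1/2) * h"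
        unfolding scalar_add by (simp add: distrib_left distrib_right)
      also have "(1/2 + 1/2 :: 'k) = 1"
        using two by (simp add: field_simps)
      finally show ?thesis by simp
    qed
    then have "f = scalar (1/2) * ((f + g) + - 1 * (g - f))" "g = scalar (1/2) * ((f + g) + (g - f))"
      by (simp_all add: algebra_simps)
    then show ?thesis
      using that J by metis
  qed
  show ?thesis
    using half[OF R[of R1, unfolded bil_R] R[of R2, unfolded bil_R]]
      half[OF R[of R3, unfolded bil_R] R[of R4, unfolded bil_R]]
      half[OF R[of R5, unfolded bil_R] R[of R6, unfolded bil_R]]
    by (auto simp: sklyanin_relations_def)
qed

text \<open>The kernel comes from two generated ideals, so minimality is used twice: for
  \<open>relI\<close> in the free algebra, and in \<open>S\<close> for the image of
  \<open>vanishing\<close>. Passing back from \<open>S\<close> costs an element of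
  \<open>relI\<close>, which vanishes too.\<close>

lemma kerB_vanishing: "kerB \<subseteq> vanishing"
proof
  have I: "relI \<subseteq> vanishing"
    by (rule ring.genideal_minimal[OF ring_free_ring vanishing_ideal relations_subset])
       (auto intro: vanishing_add vanishing_lmult rels_vanish simp: rels_eq)
  interpret S: ring S by (rule ring_S)
  have uminus: "toS (- f) = \<ominus>\<^bsub>S\<^esub> toS f" for f
    by (rule sym, rule S.minus_equality) (simp_all add: toS_simps flip: toS_simps(2))
  have "ideal (toS ` vanishing) S"
  proof (rule idealI[OF ring_S])
    show "subgroup (toS ` vanishing) (add_monoid S)"
    proof (rule S.add.subgroupI)
      show "toS ` vanishing \<subseteq> carrier S"
        by (auto simp: toS_simps)
      show "toS ` vanishing \<noteq> {}"
        using vanishing_0 by blast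
      show "\<ominus>\<^bsub>S\<^esub> a \<in> toS ` vanishing" if a: "a \<in> toS ` vanishing" for a
      proof -
        obtain f where f: "a = toS f" "f \<in> vanishing"
          using a by blast
        then have "- f \<in> vanishing"
          using vanishing_diff[OF vanishing_0] by fastforce
        moreover have "\<ominus>\<^bsub>S\<^esub> a = toS (- f)"
          unfolding f uminus ..
        ultimately show ?thesis by blast
      qed
      show "a \<oplus>\<^bsub>S\<^esub> b \<in> toS ` vanishing" if "a \<in> toS ` vanishing" "b \<in> toS ` vanishing" for a b
        using that vanishing_add by (auto simp: toS_simps(2)[symmetric])
    qed
    show "x \<otimes>\<^bsub>S\<^esub> a \<in> toS ` vanishing" "a \<otimes>\<^bsub>S\<^esub> x \<in> toS ` vanishing"
      if "a \<in> toS ` vanishing" "x \<in> carrier S" for a x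
      using that vanishing_lmult vanishing_rmult by (auto simp: carrier_S toS_simps(3)[symmetric])
  qed
  moreover have "{toS \<Omega>1, toS (\<Omega>2 \<alpha> \<beta> \<gamma>)} \<subseteq> toS ` vanishing"
    using rels_vanish[of Om1m] rels_vanish[of Om2m] by (auto simp: bil_R rels_eq)
  ultimately have sub: "\<Omega>I \<subseteq> toS ` vanishing"
    unfolding \<Omega>_ideal_def by (rule S.genideal_minimal)
  fix f assume "f \<in> kerB"
  then obtain g where g: "toS f = toS g" "g \<in> vanishing"
    using sub by (auto simp: kerB_iff)
  then have "f - g \<in> vanishing"
    using I by (auto simp: toS_eq_iff)
  from vanishing_add[OF this g(2)] show "f \<in> vanishing" by simp
qed

lemma skl_ideal_kerB: "skl_ideal \<alpha> \<beta> \<gamma> kerB"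
proof
  fix f n and ys :: "nat \<Rightarrow> gen \<Rightarrow> 'k"
  assume "f \<in> kerB" "\<And>i. related (ys i) (ys (Suc i))"
  then show "ev n ys f = 0"
    using kerB_vanishing by (force simp: ev_eq_sum_gev vanishing_def intro: sum.neutral)
qed (rule kerB_0 kerB_add kerB_lmult kerB_rmult rels_in_kerB; assumption)+

end

subsection \<open>The automorphism and the relations\<close>

context skl_params
begin

text \<open>With \<open>m0\<close>, \<open>m1\<close> spanning the first two components,
  \<open>xgen i\<close> sends \<open>m0\<close> to \<open>l i\<close> times \<open>m1\<close>, and
  \<open>l\<close> is proportional to \<open>p\<close>. The relation kills \<open>m0\<close>, and
  its action on \<open>m0\<close> is that of \<open>lin (row r l)\<close> on
  \<open>m1\<close>.\<close>

lemma row_in_annihilator: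
  assumes pm: "point_module_at \<alpha> \<beta> \<gamma> p M" and y: "p \<in> E" "y \<in> p"
    and r: "bil r \<in> relI" and m: "m \<in> component M 1"
  shows "toS (lin (row r y)) \<odot>\<^bsub>M\<^esub> m = \<zero>\<^bsub>M\<^esub>"
proof -
  have pm': "point_module S (\<lambda>c. toS (scalar c)) (skl_deg \<alpha> \<beta> \<gamma>) M"
    using pm by (simp add: point_module_at_def)
  interpret M: graded_right_module S "skl_deg \<alpha> \<beta> \<gamma>" M
    using pm' by (simp add: point_module_def)
  have sub: "component M n \<subseteq> carrier M" for n
    using M.component_subgroup additive_subgroup.a_subset by blast
  have comp: "\<exists>m\<in>component M n. m \<noteq> \<zero>\<^bsub>M\<^esub> \<and> component M n = {toS (scalar c) \<odot>\<^bsub>M\<^esub> m | c. True}" for n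
    using pm' by (simp add: point_module_def)
  obtain m0 where m0: "m0 \<in> component M 0" "component M 0 = {toS (scalar c) \<odot>\<^bsub>M\<^esub> m0 | c. True}"
    using comp by blast
  obtain m1 where m1: "m1 \<in> component M 1" "m1 \<noteq> \<zero>\<^bsub>M\<^esub>" "component M 1 = {toS (scalar c) \<odot>\<^bsub>M\<^esub> m1 | c. True}"
    using comp by blast
  define act where "act f v = toS f \<odot>\<^bsub>M\<^esub> v" for f v
  have act_closed: "v \<in> carrier M \<Longrightarrow> act f v \<in> carrier M" for f v
    by (simp add: act_def M.action_closed toS_simps)
  have act_add: "v \<in> carrier M \<Longrightarrow> act (f + g) v = act f v \<oplus>\<^bsub>M\<^esub> act g v" for f g v
    by (simp add: act_def toS_simps M.action_distrib_ring)
  have act_mult: "v \<in> carrier M \<Longrightarrow> act (f * g) v = act g (act f v)" for f g v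
    by (simp add: act_def toS_simps M.action_mult)
  have act_1: "v \<in> carrier M \<Longrightarrow> act 1 v = v" for v
    by (simp add: act_def toS_simps M.action_one)
  have act_0: "act 0 v = \<zero>\<^bsub>M\<^esub>" if "v \<in> carrier M" for v
    using act_add[OF that, of 0 0] act_closed[OF that, of 0] by (metis M.M.add.r_cancel_one' add_0)
  have act_zero: "act f \<zero>\<^bsub>M\<^esub> = \<zero>\<^bsub>M\<^esub>" for f
    using act_mult[of "\<zero>\<^bsub>M\<^esub>" 0 f] act_0[of "\<zero>\<^bsub>M\<^esub>"] by simp
  have act_sum: "act (\<Sum>i\<in>UNIV. F i) v = act (\<Sum>i\<in>UNIV. G i) v'"
    if "v \<in> carrier M" "v' \<in> carrier M" "\<And>i. act (F i) v = act (G i) v'"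
    for F G :: "gen \<Rightarrow> 'k free_alg" and v v'
    using that by (simp add: sum_gen act_add)
  have c0: "m0 \<in> carrier M" and c1: "m1 \<in> carrier M"
    using sub m0(1) m1(1) by blast+
  obtain y0 where y0: "y0 \<noteq> (\<lambda>_. 0)" "p = proj_point y0"
    "\<And>c. (\<forall>m\<in>component M 0. act (lin c) m = \<zero>\<^bsub>M\<^esub>) \<longleftrightarrow> dot c y0 = 0"
    using pm unfolding point_module_at_def lin_def dot_def act_def by blast
  have "act (xgen i) m0 \<in> component M 1" for i
  proof -
    have "xgen i \<in> free_deg 1"
      using lin_free_deg[of "\<lambda>j. of_bool (j = i)"] by (simp add: lin_unit)
    then have "toS (xgen i) \<in> skl_deg \<alpha> \<beta> \<gamma> 1"
      unfolding skl_deg_def by (rule imageI)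
    from M.component_action[OF this m0(1)] show ?thesis
      by (simp add: act_def)
  qed
  then have "\<exists>c. act (xgen i) m0 = act (scalar c) m1" for i
    unfolding m1(3) act_def by blast
  then obtain l where l: "\<And>i. act (xgen i) m0 = act (scalar (l i)) m1"
    by metis
  have lin_m0: "act (lin c) m0 = act (scalar (dot c l)) m1" for c
  proof -
    have "act (scalar (c i) * xgen i) m0 = act (scalar (c i * l i)) m1" for i
      using act_mult[OF c0, of "xgen i" "scalar (c i)"] act_mult[OF c1, of "scalar (l i)" "scalar (c i)"] l
      by (simp add: scalar_commute[of "xgen i"] mult.commute[of "c i"] scalar_mult)
    from act_sum[OF c0 c1 this] show ?thesis
      unfolding lin_def dot_def by (simp add: sum_gen scalar_add)
  qed
  have scalar_zero: "c = 0" if "act (scalar c) m1 = \<zero>\<^bsub>M\<^esub>" for c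
  proof (rule ccontr)
    assume "c \<noteq> 0"
    then have "act (scalar c * scalar (1 / c)) m1 = m1"
      by (simp add: scalar_mult[symmetric] act_1 c1)
    then show False
      using that m1(2) act_mult[OF c1, of "scalar c" "scalar (1 / c)"] act_zero by simp
  qed
  have dot_l: "dot c l = 0 \<longleftrightarrow> dot c y0 = 0" for c
  proof -
    have "act (lin c) m0 = \<zero>\<^bsub>M\<^esub> \<longleftrightarrow> (\<forall>m\<in>component M 0. act (lin c) m = \<zero>\<^bsub>M\<^esub>)"
    proof
      assume z: "act (lin c) m0 = \<zero>\<^bsub>M\<^esub>"
      have "act (lin c) (act (scalar d) m0) = \<zero>\<^bsub>M\<^esub>" for d
        using act_mult[OF c0, of "scalar d" "lin c"] act_mult[OF c0, of "lin c" "scalar d"] z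
        by (simp add: scalar_commute[of "lin c"] act_zero)
      then show "\<forall>m\<in>component M 0. act (lin c) m = \<zero>\<^bsub>M\<^esub>"
        unfolding m0(2) act_def by blast
    qed (use m0 in blast)
    moreover have "act (lin c) m0 = \<zero>\<^bsub>M\<^esub> \<longleftrightarrow> dot c l = 0"
      unfolding lin_m0 using scalar_zero act_0[OF c1] by auto
    ultimately show ?thesis
      using y0(3) by simp
  qed
  obtain i0 where i0: "y0 i0 \<noteq> 0"
    using y0(1) by blast
  define t where "t = l i0 / y0 i0"
  \<comment> \<open>Vectors annihilated by the same linear forms are proportional; forms supported
    on \<open>i\<close> and \<open>i0\<close> suffice to see it.\<close>
  have l_eq: "l = (\<lambda>i. t * y0 i)"
  proof
    fix i
    have "dot (\<lambda>j. y0 i0 * of_bool (j = i) - y0 i * of_bool (j = i0)) y0 = 0"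
      by (simp add: dot_diff dot_scale dot_unit)
    then have "dot (\<lambda>j. y0 i0 * of_bool (j = i) - y0 i * of_bool (j = i0)) l = 0"
      using dot_l by blast
    then show "l i = t * y0 i"
      using i0 by (simp add: dot_diff dot_scale dot_unit t_def field_simps)
  qed
  have "t \<noteq> 0"
  proof
    assume "t = 0"
    then have "l i0 = 0"
      using fun_cong[OF l_eq, of i0] by simp
    then show False
      using dot_l[of "\<lambda>j. of_bool (j = i0)"] i0 unfolding dot_unit by blast
  qed
  obtain s where s: "s \<noteq> 0" "y = (\<lambda>i. s * y0 i)"
    using y y0(2) in_proj_pointE by metis
  have y_l: "y = (\<lambda>i. (s / t) * l i)"
    using s \<open>t \<noteq> 0\<close> by (simp add: l_eq)
  have "act (bil r) m0 = act (lin (row r l)) m1"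
    unfolding bil_def lin_row
  proof (rule act_sum[OF c0 c1])
    fix i show "act (xgen i * lin (r i)) m0 = act (scalar (l i) * lin (r i)) m1"
      by (simp add: act_mult c0 c1 l)
  qed
  moreover have "act (bil r) m0 = \<zero>\<^bsub>M\<^esub>"
  proof -
    have "toS (bil r) = toS 0"
      using r by (simp add: toS_eq_iff)
    then show ?thesis
      using act_0[OF c0] by (simp add: act_def)
  qed
  ultimately have z: "act (lin (row r l)) m1 = \<zero>\<^bsub>M\<^esub>"
    by simp
  obtain d where d: "m = act (scalar d) m1"
    using m m1(3) by (auto simp: act_def)
  have "lin (row r y) = scalar (s / t) * lin (row r l)"
    by (simp only: y_l row_scale lin_scale)
  then have "act (lin (row r y)) m = act (scalar d * (scalar (s / t) * lin (row r l))) m1"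
    by (simp add: d act_mult c1)
  also have "scalar d * (scalar (s / t) * lin (row r l)) = lin (row r l) * (scalar d * scalar (s / t))"
    by (metis mult.assoc scalar_commute scalar_mult)
  also have "act \<dots> m1 = \<zero>\<^bsub>M\<^esub>"
    using act_mult[OF c1, of "lin (row r l)" "scalar d * scalar (s / t)"] z act_zero by simp
  finally show ?thesis
    by (simp add: act_def)
qed

text \<open>The carrier of the shift is phrased through a definite description, so the explicit
  decomposition concentrated in degree \<open>Suc n\<close> has to be matched with the unique
  one.\<close>

lemma component_in_shift:
  assumes "graded_right_module R D M" "m \<in> component M (Suc n) \<or> m = \<zero>\<^bsub>M\<^esub>"
  shows "m \<in> carrier (shift_module M)"
proof -
  interpret M: graded_right_module R D M by (rule assms(1))
  have sub: "component M n \<subseteq> carrier M" and zero: "\<zero>\<^bsub>M\<^esub> \<in> component M n" for n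
    using M.component_subgroup additive_subgroup.a_subset additive_subgroup.zero_closed by blast+
  have carr: "m \<in> carrier M"
    using assms(2) sub by auto
  define c where "c i = (if i = Suc n then m else \<zero>\<^bsub>M\<^esub>)" for i
  have S: "{i. c i \<noteq> \<zero>\<^bsub>M\<^esub>} = (if m = \<zero>\<^bsub>M\<^esub> then {} else {Suc n})"
    by (auto simp: c_def)
  have "is_decomposition M (component M) m c"
    unfolding is_decomposition_def S using assms(2) zero carr by (auto simp: c_def)
  then have "homogeneous_part M (component M) m = c"
    unfolding homogeneous_part_def using M.component_direct_sum[OF carr] by (rule the1_equality[rotated])
  then show ?thesis
    using carr by (simp add: shift_module_def c_def)
qed

text \<open>On the curve \<open>y X0\<close> and \<open>y X1\<close> are never both zero, and up to
  nonzero constants the product of either with each of the two expressions is a combination of the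
  six relations and the equations of the curve.\<close>

lemma related_Om:
  assumes y: "y \<noteq> (\<lambda>_. 0)" "on_curve y"
    and r: "\<And>r. r \<in> {R1, R2, R3, R4, R5, R6} \<Longrightarrow> dot (row r y) z = 0"
  shows "dot (row Om1m y) z = 0" "dot (row Om2m y) z = 0"
proof -
  define e1 e2 e3 e4 e5 e6 where e: "e1 = 2 * y X0 * z X1 - (1 + \<alpha>) * y X2 * z X3 + (1 - \<alpha>) * y X3 * z X2"
    "e2 = 2 * y X1 * z X0 - (1 - \<alpha>) * y X2 * z X3 + (1 + \<alpha>) * y X3 * z X2"
    "e3 = 2 * y X0 * z X2 - (1 + \<beta>) * y X3 * z X1 + (1 - \<beta>) * y X1 * z X3"
    "e4 = 2 * y X2 * z X0 - (1 - \<beta>) * y X3 * z X1 + (1 + \<beta>) * y X1 * z X3"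
    "e5 = 2 * y X0 * z X3 - (1 + \<gamma>) * y X1 * z X2 + (1 - \<gamma>) * y X2 * z X1"
    "e6 = 2 * y X3 * z X0 - (1 - \<gamma>) * y X1 * z X2 + (1 + \<gamma>) * y X2 * z X1"
  have "dot (row R1 y) z = e1" "dot (row R2 y) z = e2" "dot (row R3 y) z = e3"
    "dot (row R4 y) z = e4" "dot (row R5 y) z = e5" "dot (row R6 y) z = e6"
    by (simp_all add: e dot_def row_def sum_gen algebra_simps)
  then have e0: "e1 = 0" "e2 = 0" "e3 = 0" "e4 = 0" "e5 = 0" "e6 = 0"
    using r by auto
  define q1 where "q1 = y X0 * y X0 + y X1 * y X1 + y X2 * y X2 + y X3 * y X3"
  define q2 where "q2 = y X3 * y X3 + \<mu>1 * (y X1 * y X1) + \<mu>2 * (y X2 * y X2)"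
  have q: "q1 = 0" "q2 = 0"
    using y(2) by (simp_all add: on_curve_def q1_def q2_def power2_eq_square)
  define O1 where "O1 = - y X0 * z X0 + y X1 * z X1 + y X2 * z X2 + y X3 * z X3"
  define O2 where "O2 = y X1 * z X1 + \<omega>2 * y X2 * z X2 + \<omega>3 * y X3 * z X3"
  have O: "dot (row Om1m y) z = O1" "dot (row Om2m y) z = O2"
    by (simp_all add: O1_def O2_def dot_def row_def sum_gen)
  have k1: "\<omega>2 * (1 - \<beta>) = 1 + \<alpha>" and k2: "\<omega>3 * (1 + \<gamma>) = 1 - \<alpha>"
    and k3: "\<mu>1 * (1 + \<alpha>) = 1 - \<gamma>" and k4: "\<mu>2 * (1 - \<beta>) = 1 + \<gamma>"
    using alpha_nz by (simp_all add: \<omega>2_def \<omega>3_def \<mu>1_def \<mu>2_def)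
  \<comment> \<open>The parameter equation in multiplicative form.\<close>
  have k: "(1 + \<alpha>) * (1 + \<beta>) * (1 + \<gamma>) = (1 - \<alpha>) * (1 - \<beta>) * (1 - \<gamma>)"
  proof -
    have "(1 + \<alpha>) * (1 + \<beta>) * (1 + \<gamma>) - (1 - \<alpha>) * (1 - \<beta>) * (1 - \<gamma>) = 2 * (\<alpha> + \<beta> + \<gamma> + \<alpha> * \<beta> * \<gamma>)"
      by (simp add: algebra_simps)
    then show ?thesis
      using param_eq by simp
  qed
  have k5: "\<omega>2 * (1 + \<beta>) = \<omega>3 * (1 - \<gamma>)"
  proof -
    have "(\<omega>2 * (1 + \<beta>)) * ((1 - \<beta>) * (1 + \<gamma>)) = (1 + \<alpha>) * (1 + \<beta>) * (1 + \<gamma>)"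
      unfolding k1[symmetric] by (simp only: ac_simps)
    also have "\<dots> = (\<omega>3 * (1 - \<gamma>)) * ((1 - \<beta>) * (1 + \<gamma>))"
      unfolding k unfolding k2[symmetric] by (simp only: ac_simps)
    finally show ?thesis
      using alpha_nz by simp
  qed
  have k6: "(1 - \<beta>) * \<mu>1 * \<omega>2 = 1 - \<gamma>"
  proof -
    have "(1 - \<beta>) * \<mu>1 * \<omega>2 = \<mu>1 * (\<omega>2 * (1 - \<beta>))"
      by (simp only: ac_simps)
    then show ?thesis
      by (simp only: k1 k3)
  qed
  have k7: "(1 - \<beta>) * \<mu>1 * \<omega>3 = 1 + \<beta>"
  proof -
    have "((1 - \<beta>) * \<mu>1 * \<omega>3) * \<omega>2 * (1 + \<beta>) = ((1 - \<beta>) * \<mu>1 * \<omega>2) * (\<omega>2 * (1 + \<beta>)) * \<omega>3 / \<omega>2"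
      using omega2_nz by simp
    also have "\<dots> = (1 - \<gamma>) * (\<omega>3 * (1 - \<gamma>)) * \<omega>3 / \<omega>2"
      unfolding k6 k5 ..
    finally have "((1 - \<beta>) * \<mu>1 * \<omega>3) * (1 - \<gamma>) = (1 - \<gamma>) * (1 + \<beta>)"
      unfolding k6[symmetric] using k5 k6 by (metis mult.assoc mult.commute)
    then show ?thesis
      using alpha_nz by (metis mult.commute mult_cancel_left)
  qed
  have "2 * (y X0 * O1) = y X1 * (e1 + e2) + y X2 * (e3 + e4) + y X3 * (e5 + e6) - 2 * (q1 * z X0)"
    "2 * (y X1 * O1) = 2 * (q1 * z X1) - y X0 * (e1 + e2) + y X3 * (e3 + e4) - y X2 * (e5 + e6)"
    unfolding O1_def e q1_def by (simp_all add: algebra_simps)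
  then have "2 * (y X0 * O1) = 0" "2 * (y X1 * O1) = 0"
    by (simp_all only: e0 q) simp_all
  then have O1: "y X0 = 0 \<or> O1 = 0" "y X1 = 0 \<or> O1 = 0"
    using two by simp_all
  have "2 * (y X0 * O2) = y X1 * e1 + \<omega>2 * (y X2 * e3) + \<omega>3 * (y X3 * e5)
     + ((1 + \<alpha>) - \<omega>2 * (1 - \<beta>)) * (y X1 * y X2 * z X3)
     + (\<omega>3 * (1 + \<gamma>) - (1 - \<alpha>)) * (y X1 * y X3 * z X2)
     + (\<omega>2 * (1 + \<beta>) - \<omega>3 * (1 - \<gamma>)) * (y X2 * y X3 * z X1)"
    unfolding O2_def e by (simp add: algebra_simps)
  then have "2 * (y X0 * O2) = 0"
    by (simp only: e0 k1 k2 k5) simp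
  moreover have "(1 - \<beta>) * \<mu>1 * (y X1 * O2) = y X3 * e4 - y X2 * e6 + (1 - \<beta>) * (q2 * z X1)
     + ((1 - \<beta>) * \<mu>1 * \<omega>2 - (1 - \<gamma>)) * (y X1 * y X2 * z X2)
     + ((1 - \<beta>) * \<mu>1 * \<omega>3 - (1 + \<beta>)) * (y X1 * y X3 * z X3)
     + ((1 + \<gamma>) - \<mu>2 * (1 - \<beta>)) * (y X2 * y X2 * z X1)"
    unfolding O2_def e q2_def by (simp add: algebra_simps)
  then have "(1 - \<beta>) * \<mu>1 * (y X1 * O2) = 0"
    by (simp only: e0 q k4 k6 k7) simp
  ultimately have O2: "y X0 = 0 \<or> O2 = 0" "y X1 = 0 \<or> O2 = 0"
    using two mu_nz alpha_nz by simp_all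
  have "\<not> (y X0 = 0 \<and> y X1 = 0)"
  proof
    assume y01: "y X0 = 0 \<and> y X1 = 0"
    have "q2 - q1 = (\<mu>2 - 1) * (y X2 * y X2)"
      using y01 by (simp add: q1_def q2_def algebra_simps)
    then have "y X2 = 0"
      using q mu_nz by simp
    then have "y X3 = 0"
      using q y01 by (simp add: q1_def)
    have "y i = 0" for i
      using y01 \<open>y X2 = 0\<close> \<open>y X3 = 0\<close> by (cases i) auto
    then show False
      using y(1) by blast
  qed
  then show "dot (row Om1m y) z = 0" "dot (row Om2m y) z = 0"
    using O O1 O2 by auto
qed

text \<open>The isomorphism takes the component of \<open>M\<close> in degree one to that of
  \<open>N\<close> in degree zero. The rows at \<open>y\<close> kill the former, hence also the
  latter, and so they vanish at \<open>\<sigma> p\<close>.\<close>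

theorem automorphism_related:
  assumes aut: "is_skl_automorphism \<alpha> \<beta> \<gamma> \<sigma>" and p: "p \<in> E" "y \<in> p" "z \<in> \<sigma> p"
  shows "related y z"
proof -
  obtain M N :: "('k skl, nat \<Rightarrow>\<^sub>0 'k) graded_module" where
    M: "point_module_at \<alpha> \<beta> \<gamma> p M" and N: "point_module_at \<alpha> \<beta> \<gamma> (\<sigma> p) N"
    and iso: "graded_isomorphic S (shift_module M) N"
    using aut p(1) unfolding is_skl_automorphism_def by blast
  interpret M: graded_right_module S "skl_deg \<alpha> \<beta> \<gamma>" M
    using M by (simp add: point_module_at_def point_module_def)
  interpret N: graded_right_module S "skl_deg \<alpha> \<beta> \<gamma>" N
    using N by (simp add: point_module_at_def point_module_def)
  obtain f where f: "bij_betw f (carrier (shift_module M)) (carrier N)"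
    "\<And>m n. m \<in> carrier (shift_module M) \<Longrightarrow> n \<in> carrier (shift_module M) \<Longrightarrow> f (m \<oplus>\<^bsub>M\<^esub> n) = f m \<oplus>\<^bsub>N\<^esub> f n"
    "\<And>a m. a \<in> carrier S \<Longrightarrow> m \<in> carrier (shift_module M) \<Longrightarrow> f (a \<odot>\<^bsub>M\<^esub> m) = a \<odot>\<^bsub>N\<^esub> f m"
    "\<And>n. f ` component M (Suc n) = component N n"
    using iso unfolding graded_isomorphic_def by (auto simp: shift_module_def)
  have zero: "\<zero>\<^bsub>M\<^esub> \<in> carrier (shift_module M)"
    using component_in_shift[OF M.graded_right_module_axioms] by blast
  then have "f \<zero>\<^bsub>M\<^esub> \<in> carrier N"
    using f(1) bij_betw_apply by metis
  moreover have "f \<zero>\<^bsub>M\<^esub> = f \<zero>\<^bsub>M\<^esub> \<oplus>\<^bsub>N\<^esub> f \<zero>\<^bsub>M\<^esub>"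
    using f(2)[OF zero zero] by simp
  ultimately have f0: "f \<zero>\<^bsub>M\<^esub> = \<zero>\<^bsub>N\<^esub>"
    by (metis N.M.add.r_cancel_one')
  obtain z0 where z0: "\<sigma> p = proj_point z0"
    "\<And>c. (\<forall>m\<in>component N 0. toS (lin c) \<odot>\<^bsub>N\<^esub> m = \<zero>\<^bsub>N\<^esub>) \<longleftrightarrow> dot c z0 = 0"
    using N unfolding point_module_at_def lin_def dot_def by blast
  obtain s where s: "z = (\<lambda>i. s * z0 i)"
    using p(3) z0(1) in_proj_pointE by metis
  have R: "dot (row r y) z = 0" if r: "r \<in> {R1, R2, R3, R4, R5, R6}" for r
  proof -
    have "toS (lin (row r y)) \<odot>\<^bsub>N\<^esub> n = \<zero>\<^bsub>N\<^esub>" if n: "n \<in> component N 0" for n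
    proof -
      obtain m where m: "m \<in> component M 1" "n = f m"
        using n f(4)[of 0] by auto
      have "m \<in> carrier (shift_module M)"
        using component_in_shift[OF M.graded_right_module_axioms, of m 0] m by simp
      from f(3)[OF toS_simps(1) this, of "lin (row r y)"] show ?thesis
        using row_in_annihilator[OF M p(1,2) R_in_I[OF r] m(1)] f0 m by simp
    qed
    then have "dot (row r y) z0 = 0"
      using z0(2) by blast
    moreover have "dot (row r y) z = s * dot (row r y) z0"
      by (simp add: s dot_def sum_distrib_left mult.left_commute)
    ultimately show ?thesis by simp
  qed
  show ?thesis
    using related_Om[OF in_point(2,3)[OF p(1,2)] R] R unfolding related_def rels_eq by auto
qed

end

section \<open>Homogeneous components in the free algebra\<close>

definition gproj :: "G \<Rightarrow> 'k::field free_alg \<Rightarrow> 'k free_alg" where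
  "gproj g = diag (\<lambda>w. of_bool (wdeg w = g))"

definition hcomp :: "nat \<Rightarrow> G \<Rightarrow> 'k::field free_alg \<Rightarrow> 'k free_alg" where
  "hcomp n g = diag (\<lambda>w. of_bool (wlen w = n \<and> wdeg w = g))"

lemma gproj_add: "gproj g (f + h) = gproj g f + gproj g h"
  by (simp add: gproj_def diag_add)

lemma gproj_0 [simp]: "gproj g 0 = 0"
  by (simp add: gproj_def)

lemma gproj_single: "gproj g (single w c) = (if wdeg w = g then single w c else 0)"
  by (simp add: gproj_def)

lemma gproj_gproj: "gproj g (gproj g f) = gproj g f"
  by (rule poly_mapping_eqI) (simp add: gproj_def)

lemma sum_gproj: "(\<Sum>g\<in>UNIV. gproj g f) = f"
proof (rule poly_mapping_eqI)
  fix w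
  have "(\<Sum>g\<in>UNIV. of_bool (wdeg w = g) * lookup f w) =
      (\<Sum>g\<in>UNIV. if g = wdeg w then lookup f w else 0)"
    by (rule sum.cong) auto
  then show "lookup (\<Sum>g\<in>UNIV. gproj g f) w = lookup f w"
    by (simp add: lookup_sum gproj_def)
qed

lemma gev_gproj: "gev n h ys (gproj g f) = (if h = g then gev n h ys f else 0)"
  unfolding gev_def gproj_def lext_diag by (auto simp: lext_def intro!: sum.cong sum.neutral)

lemma hcomp_free_deg: "hcomp n g f \<in> free_deg n"
  by (simp add: free_deg_iff hcomp_def)

lemma ev_hcomp: "ev n ys (hcomp n g f) = gev n g ys f"
  unfolding ev_def gev_def hcomp_def lext_diag by (auto simp: lext_def intro!: sum.cong)

lemma sum_hcomp:
  assumes "\<And>w. w \<in> keys f \<Longrightarrow> wlen w \<le> N"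
  shows "f = (\<Sum>n\<le>N. \<Sum>g\<in>UNIV. hcomp n g f)"
proof (rule poly_mapping_eqI)
  fix w
  show "lookup f w = lookup (\<Sum>n\<le>N. \<Sum>g\<in>UNIV. hcomp n g f) w"
  proof (cases "w \<in> keys f")
    case True
    have "(\<Sum>n\<le>N. \<Sum>g\<in>UNIV. of_bool (wlen w = n \<and> wdeg w = g) * lookup f w)
        = (\<Sum>n\<le>N. if n = wlen w then (\<Sum>g\<in>UNIV. if g = wdeg w then lookup f w else 0) else 0)"
      by (intro sum.cong refl) (auto intro!: sum.cong)
    also have "\<dots> = lookup f w"
      using assms[OF True] by simp
    finally show ?thesis
      by (simp add: lookup_sum hcomp_def)
  qed (simp add: lookup_sum hcomp_def in_keys_iff)
qed

lemma wlen_bound: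
  obtains N where "\<And>w. w \<in> keys f \<Longrightarrow> wlen w \<le> N"
proof
  show "w \<in> keys f \<Longrightarrow> wlen w \<le> Max (wlen ` keys f)" for w
    by simp
qed

lemma hcomp_beyond:
  assumes "\<And>w. w \<in> keys f \<Longrightarrow> wlen w \<le> N" "n > N"
  shows "hcomp n g f = 0"
  by (rule poly_mapping_eqI) (use assms in \<open>force simp: hcomp_def in_keys_iff\<close>)

subsection \<open>Characters and the twisted product on the free algebra\<close>

lemma G_char_mult: "G_char (gadd a b) h = G_char a h * (G_char b h :: 'k::field)"
  by (cases a; cases b; cases h) (auto simp: of_bool_def)

lemma G_char_square: "G_char a h * G_char a h = (1 :: 'k::field)"
  by (cases a; cases h) (auto simp: of_bool_def)

lemma G_char_separates:
  assumes "(2::'k::field) \<noteq> 0" "a \<noteq> b"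
  shows "\<exists>h. G_char a h \<noteq> (G_char b h :: 'k)"
proof -
  have n: "(1::'k) \<noteq> - 1" "- 1 \<noteq> (1::'k)"
    using assms(1) by (metis add.inverse_inverse neg_eq_iff_add_eq_0 one_add_one)+
  obtain p q r s where ab: "a = (p, q)" "b = (r, s)"
    by (cases a; cases b)
  show ?thesis
  proof (cases "p = r")
    case True
    then have "G_char a (True, False) \<noteq> (G_char b (True, False) :: 'k)"
      using assms(2) n by (cases q; cases s) (auto simp: ab)
    then show ?thesis by blast
  next
    case False
    then have "G_char a (False, True) \<noteq> (G_char b (False, True) :: 'k)"
      using n by (cases p; cases r) (auto simp: ab)
    then show ?thesis by blast
  qed
qed

text \<open>Two rounds of sums and differences invert the character table of G.\<close>

lemma characters_independent:
  assumes two: "(2::'k::field) \<noteq> 0" and T: "\<And>h. (\<Sum>v\<in>UNIV. G_char h v * T v) = (0::'k)"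
  shows "T g = 0"
proof -
  let ?a = "T (False, False)" and ?b = "T (True, False)" and ?c = "T (False, True)" and ?d = "T (True, True)"
  have "(?a + ?b) + (?c + ?d) = (\<Sum>v\<in>UNIV. G_char (False, False) v * T v)"
    "(?a + ?b) - (?c + ?d) = (\<Sum>v\<in>UNIV. G_char (True, False) v * T v)"
    "(?a - ?b) + (?c - ?d) = (\<Sum>v\<in>UNIV. G_char (False, True) v * T v)"
    "(?a - ?b) - (?c - ?d) = (\<Sum>v\<in>UNIV. G_char (True, True) v * T v)"
    by (simp_all add: sum_G)
  note e = this[unfolded T]
  have "?a + ?b = 0" "?a - ?b = 0" "?c + ?d = 0" "?c - ?d = 0"
    using both_zero[OF two e(1,2)] both_zero[OF two e(3,4)] by auto
  then have "?a = 0" "?b = 0" "?c = 0" "?d = 0"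
    using both_zero[OF two] by blast+
  then show ?thesis
    by (cases g) (metis (full_types))
qed

lemma cocycle_mult_left: "cocycle (gadd a b) c = cocycle a c * (cocycle b c :: 'k::field)"
  by (cases a; cases b; cases c) (auto simp: of_bool_def)

lemma cocycle_mult_right: "cocycle a (gadd b c) = cocycle a b * (cocycle a c :: 'k::field)"
  by (cases a; cases b; cases c) (auto simp: of_bool_def)

lemma cocycle_0 [simp]: "cocycle gzero a = 1" "cocycle a gzero = 1"
  by (cases a; simp)+

lemma cocycle_nz [simp]: "cocycle a b \<noteq> (0 :: 'k::field)"
  by (cases a; cases b) simp

text \<open>The cocycle has values 1 and -1, so this product is also the quotient of the two values:
  the pairing by which twisting changes commutation. Its nondegeneracy carries the proof of
  primeness.\<close>

lemma cocycle_swap: "cocycle a b * cocycle b a = (G_char a b :: 'k::field)"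
  by (cases a; cases b) (auto simp: of_bool_def)

definition tmul :: "'k::field free_alg \<Rightarrow> 'k free_alg \<Rightarrow> 'k free_alg" where
  "tmul f h = (\<Sum>a\<in>UNIV. \<Sum>b\<in>UNIV. scalar (cocycle a b) * (gproj a f * gproj b h))"

lemma tmul_add_left: "tmul (f + f') h = tmul f h + tmul f' h"
  by (simp add: tmul_def gproj_add distrib_left distrib_right sum.distrib)

lemma tmul_add_right: "tmul f (h + h') = tmul f h + tmul f h'"
  by (simp add: tmul_def gproj_add distrib_left sum.distrib)

lemma tmul_0 [simp]: "tmul 0 h = 0" "tmul f 0 = 0"
  by (simp_all add: tmul_def)

lemma tmul_single: "tmul (single u c) (single v d)
    = single (u + v) (cocycle (wdeg u) (wdeg v) * (c * d))"
proof -
  have "tmul (single u c) (single v d)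
     = (\<Sum>a\<in>UNIV. \<Sum>b\<in>UNIV. if b = wdeg v then if a = wdeg u then
         single (u + v) (cocycle (wdeg u) (wdeg v) * (c * d)) else 0 else 0)"
    unfolding tmul_def by (intro sum.cong refl) (auto simp: gproj_single mult_single scalar_mult_single)
  then show ?thesis by simp
qed

text \<open>On words both sides concatenate, and the signs agree because the cocycle is
  multiplicative in each argument.\<close>

lemma tmul_assoc: "tmul (tmul f g) h = tmul f (tmul g h)"
proof (induction f rule: free_alg_induct)
  case (single u a)
  show ?case
  proof (induction g rule: free_alg_induct)
    case (single v b)
    show ?case
    proof (induction h rule: free_alg_induct)
      case (single w c)
      show ?case
        by (simp add: tmul_single wdeg_add cocycle_mult_left cocycle_mult_right add.assoc mult_ac)
    qed (simp_all add: tmul_add_right)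
  qed (simp_all add: tmul_add_left tmul_add_right)
qed (simp_all add: tmul_add_left)

lemma single_0_1: "(1 :: 'k::field free_alg) = single 0 1"
  by simp

lemma tmul_1: "tmul 1 f = f" "tmul f 1 = f"
proof -
  show "tmul 1 f = f"
    by (induction f rule: free_alg_induct) (simp_all add: tmul_add_right single_0_1 tmul_single del: single_one)
  show "tmul f 1 = f"
    by (induction f rule: free_alg_induct) (simp_all add: tmul_add_left single_0_1 tmul_single del: single_one)
qed

lemma gev_tmul:
  "gev n k ys (tmul f h) = (\<Sum>i\<le>n. \<Sum>a\<in>UNIV. cocycle a (gadd a k) * (gev i a ys f * gev (n - i) (gadd a k) (shift i ys) h))"
  by (rule gev_bilinear) (simp_all add: tmul_add_left tmul_add_right tmul_single)

lemma gev_xgen: "gev n g ys (xgen l) = (if n = 1 \<and> g = gdeg l then ys 0 l else 0)"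
  by (auto simp: xgen_def gev_single wlen_def wdeg_def evw_def)

lemma gev_tmul_xgen_0: "gev 0 u ys (tmul a (xgen l)) = 0"
  by (simp add: gev_tmul gev_xgen)

lemma gev_tmul_xgen:
  "gev (Suc j) u ys (tmul a (xgen l)) = cocycle (gadd u (gdeg l)) (gdeg l) * (gev j (gadd u (gdeg l)) ys a * ys j l)"
proof -
  have g: "gadd v u = gdeg l \<longleftrightarrow> v = gadd u (gdeg l)" for v
    by (cases u; cases v; cases l) auto
  have g': "gadd (gadd u (gdeg l)) u = gdeg l"
    using g by blast
  have "gev (Suc j) u ys (tmul a (xgen l)) = (\<Sum>i\<le>Suc j. if i = j then
      cocycle (gadd u (gdeg l)) (gdeg l) * (gev j (gadd u (gdeg l)) ys a * ys j l) else 0)"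
    unfolding gev_tmul
  proof (intro sum.cong refl)
    fix i assume "i \<in> {..Suc j}"
    then have i: "Suc j - i = 1 \<longleftrightarrow> i = j" by auto
    have "(\<Sum>v\<in>UNIV. cocycle v (gadd v u) * (gev i v ys a * gev (Suc j - i) (gadd v u) (shift i ys) (xgen l)))
      = (\<Sum>v\<in>UNIV. if v = gadd u (gdeg l) then (if i = j then
      cocycle (gadd u (gdeg l)) (gdeg l) * (gev j (gadd u (gdeg l)) ys a * ys j l) else 0) else 0)"
      by (rule sum.cong) (auto simp: gev_xgen i g g')
    then show "(\<Sum>v\<in>UNIV. cocycle v (gadd v u) * (gev i v ys a * gev (Suc j - i) (gadd v u) (shift i ys) (xgen l)))
      = (if i = j then cocycle (gadd u (gdeg l)) (gdeg l) * (gev j (gadd u (gdeg l)) ys a * ys j l) else 0)"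
      by simp
  qed
  then show ?thesis by simp
qed

text \<open>Nothing survives above the degrees \<open>n\<close> and \<open>m\<close>, so only the
  splitting after \<open>n + 1\<close> letters counts. Bimultiplicativity of the cocycle collects
  the signs caused by \<open>xgen l\<close> into a constant and
  \<open>cocycle (gdeg l) v * cocycle v (gdeg l)\<close>, which is a character value.\<close>

lemma gev_top:
  assumes a: "\<And>j v. j > n \<Longrightarrow> gev j v ys a = 0"
    and b: "\<And>j i v. j > m \<Longrightarrow> gev j v (shift i ys) b = 0"
  shows "gev (Suc n + m) (gadd (gdeg l) d) ys (tmul (tmul a (xgen l)) b)
    = ys n l * cocycle (gdeg l) d * (\<Sum>v\<in>UNIV. G_char (gdeg l) v *
        (cocycle v (gadd v d) * (gev n v ys a * gev m (gadd v d) (shift (Suc n) ys) b)))"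
proof -
  let ?k = "gadd (gdeg l) d"
  let ?t = "\<lambda>i. \<Sum>u\<in>UNIV. cocycle u (gadd u ?k) * (gev i u ys (tmul a (xgen l)) * gev (Suc n + m - i) (gadd u ?k) (shift i ys) b)"
  have "?t i = 0" if i: "i \<noteq> Suc n" "i \<le> Suc n + m" for i
  proof (cases i)
    case 0
    then show ?thesis by (simp add: gev_tmul_xgen_0)
  next
    case (Suc j)
    show ?thesis
    proof (cases "j > n")
      case True
      then show ?thesis
        using a Suc by (simp add: gev_tmul_xgen)
    next
      case False
      then have "Suc n + m - i > m"
        using i Suc by auto
      then show ?thesis
        using b by simp
    qed
  qed
  then have "gev (Suc n + m) ?k ys (tmul (tmul a (xgen l)) b) = (\<Sum>i\<in>{Suc n}. ?t i)"
    unfolding gev_tmul[of "Suc n + m" ?k] by (intro sum.mono_neutral_right) auto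
  also have "\<dots> = (\<Sum>u\<in>UNIV. cocycle u (gadd u ?k) * (cocycle (gadd u (gdeg l)) (gdeg l) *
      (gev n (gadd u (gdeg l)) ys a * ys n l) * gev m (gadd u ?k) (shift (Suc n) ys) b))"
    by (simp add: gev_tmul_xgen)
  \<comment> \<open>Reindexed by the degree \<open>v\<close> of the component of \<open>a\<close>
    alone, without the inserted generator.\<close>
  also have "\<dots> = (\<Sum>v\<in>UNIV. cocycle (gadd v (gdeg l)) (gadd v d) * (cocycle v (gdeg l) *
      (gev n v ys a * ys n l) * gev m (gadd v d) (shift (Suc n) ys) b))"
  proof (rule sum.reindex_bij_witness[of _ "\<lambda>v. gadd v (gdeg l)" "\<lambda>v. gadd v (gdeg l)"])
    fix u
    show "gadd (gadd u (gdeg l)) (gdeg l) = u"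
      by (simp add: gadd_assoc)
    have "gadd (gadd u (gdeg l)) d = gadd u ?k"
      by (simp add: gadd_assoc)
    then show "cocycle (gadd (gadd u (gdeg l)) (gdeg l)) (gadd (gadd u (gdeg l)) d) * (cocycle (gadd u (gdeg l)) (gdeg l) *
      (gev n (gadd u (gdeg l)) ys a * ys n l) * gev m (gadd (gadd u (gdeg l)) d) (shift (Suc n) ys) b)
      = cocycle u (gadd u ?k) * (cocycle (gadd u (gdeg l)) (gdeg l) *
      (gev n (gadd u (gdeg l)) ys a * ys n l) * gev m (gadd u ?k) (shift (Suc n) ys) b)"
      by (simp add: gadd_assoc)
  qed (auto simp: gadd_assoc)
  also have "\<dots> = ys n l * cocycle (gdeg l) d * (\<Sum>v\<in>UNIV. G_char (gdeg l) v *
        (cocycle v (gadd v d) * (gev n v ys a * gev m (gadd v d) (shift (Suc n) ys) b)))"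
    unfolding sum_distrib_left
    by (intro sum.cong refl) (simp add: cocycle_mult_left cocycle_mult_right cocycle_swap[symmetric] mult_ac)
  finally show ?thesis .
qed

lemma sign_word: "prod_list (map (gen_sign h) (letters w)) = (G_char (wdeg w) h :: 'k::field)"
proof -
  have gs: "gen_sign h i = (G_char (gdeg i) h :: 'k)" for i
    by (cases h; cases i) (auto simp: of_bool_def)
  have "prod_list (map (gen_sign h) u) = (G_char (wdeg (Word u)) h :: 'k)" for u
  proof (induction u)
    case Nil
    then show ?case by (cases h) (simp add: wdeg_def)
  next
    case (Cons i u)
    then show ?case by (simp add: gs wdeg_Cons G_char_mult)
  qed
  then show ?thesis
    by (cases w) simp
qed

lemma free_act_diag: "free_act h f = diag (\<lambda>w. G_char (wdeg w) h) f"
  by (simp add: free_act_def diag_def sign_word)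

lemma free_act_add: "free_act h (f + g) = free_act h f + free_act h g"
  by (simp add: free_act_diag diag_add)

lemma free_act_diff: "free_act h (f - g) = free_act h f - free_act h g"
  by (simp add: free_act_diag diag_diff)

lemma free_act_0 [simp]: "free_act h 0 = 0"
  by (simp add: free_act_diag)

lemma free_act_free_act [simp]: "free_act h (free_act h f) = f"
  by (rule poly_mapping_eqI) (simp add: free_act_diag mult.assoc[symmetric] G_char_square)

lemma free_act_mult: "free_act h (f * g) = free_act h f * free_act h g"
proof (induction f rule: free_alg_induct)
  case (single u c)
  show ?case
    by (induction g rule: free_alg_induct)
       (simp_all add: free_act_diag mult_single diag_add distrib_left wdeg_add G_char_mult mult_ac)
qed (simp_all add: free_act_add distrib_right)

lemma gev_free_act: "gev n g ys (free_act h f) = G_char g h * gev n g ys f"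
  unfolding gev_def free_act_diag lext_diag by (auto simp: lext_def sum_distrib_left mult_ac intro!: sum.cong)

subsection \<open>The twisted ring\<close>

lemma gev_hcomp: "gev n h ys (hcomp m g f) = (if n = m \<and> h = g then gev n h ys f else 0)"
  unfolding gev_def hcomp_def lext_diag by (auto simp: lext_def intro!: sum.cong sum.neutral)

context skl_params
begin

lemma free_act_bil:
  "r \<in> {R1, R2, R3, R4, R5, R6} \<Longrightarrow> free_act h (bil r) = bil r \<or> free_act h (bil r) = - bil r"
  by (cases h) (auto simp: bil_single sum_gen free_act_diag diag_add wdeg_def single_uminus)

lemma free_act_I: "f \<in> relI \<Longrightarrow> free_act h f \<in> relI"
proof -
  let ?J = "{f. free_act h f \<in> relI}"
  have "ideal ?J free_ring"
  proof (rule ideal_free_ringI)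
    show "0 \<in> ?J"
      using I_diff[of "bil R1" "bil R1"] R_in_I[of R1] by simp
    show "f + g \<in> ?J" if "f \<in> ?J" "g \<in> ?J" for f g
      using that by (simp add: free_act_add I_add)
    show "g * f \<in> ?J" "f * g \<in> ?J" if "f \<in> ?J" for f g
      using that ideal.I_l_closed[OF ideal_I, of "free_act h f" "free_act h g"]
        ideal.I_r_closed[OF ideal_I, of "free_act h f" "free_act h g"]
      by (simp_all add: free_act_mult)
  qed
  moreover have "sklyanin_relations \<alpha> \<beta> \<gamma> \<subseteq> ?J"
  proof (rule relations_subset)
    show "bil r \<in> ?J" if r: "r \<in> {R1, R2, R3, R4, R5, R6}" for r
      using free_act_bil[OF r, of h] R_in_I[OF r] I_diff[OF I_diff[OF R_in_I R_in_I] R_in_I, OF r r r] by auto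
  qed (auto simp: free_act_add free_act_mult I_add intro: ideal.I_l_closed[OF ideal_I, simplified])
  ultimately have "relI \<subseteq> ?J"
    by (rule ring.genideal_minimal[OF ring_free_ring])
  then show "f \<in> relI \<Longrightarrow> free_act h f \<in> relI"
    by blast
qed

lemma toS_set: "toS f = {f'. f' - f \<in> relI}"
proof -
  have "toS f = (\<lambda>i. i + f) ` relI"
    by (auto simp: to_skl_def a_r_coset_def' )
  also have "\<dots> = {f'. f' - f \<in> relI}"
    by (auto intro!: image_eqI[of _ _ "f' - f" for f'])
  finally show ?thesis .
qed

lemma toB_set: "toB f = {toS f' |f'. f' - f \<in> kerB}"
proof -
  have "\<Omega>I \<subseteq> carrier S"
    using ideal.Icarr[OF ideal_\<Omega>] by blast
  then have "\<Omega>I = toS ` kerB"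
    by (auto simp: carrier_S kerB_iff)
  then have "toB f = {toS i \<oplus>\<^bsub>S\<^esub> toS f | i. i \<in> kerB}"
    by (auto simp: to_B_def a_r_coset_def')
  also have "\<dots> = {toS (i + f) | i. i \<in> kerB}"
    by (simp add: toS_simps)
  also have "\<dots> = {toS f' |f'. f' - f \<in> kerB}"
  proof (intro equalityI subsetI)
    fix x assume "x \<in> {toS f' |f'. f' - f \<in> kerB}"
    then obtain f' where "x = toS ((f' - f) + f)" "f' - f \<in> kerB"
      by auto
    then show "x \<in> {toS (i + f) |i. i \<in> kerB}"
      by blast
  qed force
  finally show ?thesis .
qed

lemma free_act_toS: "free_act h ` toS f = toS (free_act h f)"
proof (intro equalityI subsetI)
  fix x assume "x \<in> free_act h ` toS f"
  then show "x \<in> toS (free_act h f)"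
    using free_act_I[of _ h] by (auto simp: toS_set free_act_diff[symmetric])
next
  fix x assume "x \<in> toS (free_act h f)"
  then have "free_act h (x - free_act h f) \<in> relI"
    by (intro free_act_I) (simp add: toS_set)
  then have "free_act h x \<in> toS f"
    by (simp add: toS_set free_act_diff)
  then show "x \<in> free_act h ` toS f"
    by (metis free_act_free_act image_eqI)
qed

lemma finsum_toB:
  "finite A \<Longrightarrow> (\<Oplus>\<^bsub>B\<^esub>i\<in>A. toB (F i)) = toB (\<Sum>i\<in>A. F i)"
proof (induction A rule: finite_induct)
  case empty
  interpret B: ring B by (rule ring_B)
  show ?case by (simp add: toB_simps)
next
  case (insert x A)
  interpret B: ring B by (rule ring_B)
  show ?case
    using insert by (simp add: toB_simps B.finsum_insert Pi_def)
qed

lemma kerB_uminus: "f \<in> kerB \<Longrightarrow> - f \<in> kerB"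
  using kerB_lmult[of f "- 1"] by simp

lemma kerB_diff: "f \<in> kerB \<Longrightarrow> g \<in> kerB \<Longrightarrow> f - g \<in> kerB"
  using kerB_add[of f "- g"] kerB_uminus by simp

lemma kerB_sum: "(\<And>x. x \<in> A \<Longrightarrow> F x \<in> kerB) \<Longrightarrow> (\<Sum>x\<in>A. F x) \<in> kerB"
  by (induction A rule: infinite_finite_induct) (auto intro: kerB_0 kerB_add)

end

section \<open>The G-grading of B and the twisted product on cosets\<close>

locale skl_twist = skl_params \<alpha> \<beta> \<gamma> for \<alpha> \<beta> \<gamma> :: "'k::alg_closed_field" +
  fixes \<sigma> :: "'k proj_point \<Rightarrow> 'k proj_point"
  assumes sigma_bij: "bij_betw \<sigma> E E"
    and sigma_related: "p \<in> E \<Longrightarrow> y \<in> p \<Longrightarrow> z \<in> \<sigma> p \<Longrightarrow> related y z"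

sublocale skl_twist \<subseteq> skl_orbits \<alpha> \<beta> \<gamma> kerB \<sigma>
proof -
  interpret skl_ideal \<alpha> \<beta> \<gamma> kerB by (rule skl_ideal_kerB)
  show "skl_orbits \<alpha> \<beta> \<gamma> kerB \<sigma>"
    by unfold_locales (use sigma_bij sigma_related in auto)
qed

context skl_twist
begin

lemma kerB_gev: "f \<in> kerB \<Longrightarrow> p \<in> E \<Longrightarrow> orbit p ys \<Longrightarrow> gev n g ys f = 0"
  using kerB_vanishing orbit_related unfolding vanishing_def by blast

lemma kerBI_hcomp:
  assumes "\<And>n g. hcomp n g f \<in> kerB"
  shows "f \<in> kerB"
proof -
  obtain N where "\<And>w. w \<in> keys f \<Longrightarrow> wlen w \<le> N"
    using wlen_bound by blast
  from sum_hcomp[OF this] have f: "f = (\<Sum>n\<le>N. \<Sum>g\<in>UNIV. hcomp n g f)" .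
  show ?thesis
    by (subst f) (intro kerB_sum assms)
qed

text \<open>Together with \<open>kerB_gev\<close> this describes \<open>kerB\<close> by evaluations,
  so that stability under G and homogeneity become checks on \<open>gev\<close>.\<close>

lemma kerBI:
  assumes "\<And>p ys n g. p \<in> E \<Longrightarrow> orbit p ys \<Longrightarrow> gev n g ys f = 0"
  shows "f \<in> kerB"
  by (rule kerBI_hcomp, rule vanishing_in_K[OF hcomp_free_deg finite.emptyI]) (simp add: ev_hcomp assms)

lemma kerB_free_act: "f \<in> kerB \<Longrightarrow> free_act h f \<in> kerB"
  by (rule kerBI) (simp add: gev_free_act kerB_gev)

lemma B_act_toB: "B_act h (toB f) = toB (free_act h f)"
proof -
  have "B_act h (toB f) = {toS (free_act h f') |f'. f' - f \<in> kerB}"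
    by (simp add: B_act_def toB_set setcompr_eq_image image_image free_act_toS)
  also have "\<dots> = {toS f' |f'. f' - free_act h f \<in> kerB}"
  proof (intro equalityI subsetI)
    fix x assume "x \<in> {toS (free_act h f') |f'. f' - f \<in> kerB}"
    then show "x \<in> {toS f' |f'. f' - free_act h f \<in> kerB}"
      using kerB_free_act[of _ h] by (auto simp: free_act_diff[symmetric])
  next
    fix x assume "x \<in> {toS f' |f'. f' - free_act h f \<in> kerB}"
    then obtain f' where f': "x = toS f'" "f' - free_act h f \<in> kerB" by blast
    then have "free_act h f' - f \<in> kerB"
      using kerB_free_act[of "f' - free_act h f" h] by (simp add: free_act_diff)
    moreover have "x = toS (free_act h (free_act h f'))"
      by (simp add: f')
    ultimately show "x \<in> {toS (free_act h f') |f'. f' - f \<in> kerB}" by blast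
  qed
  finally show ?thesis
    by (simp only: toB_set)
qed

text \<open>Both sides say that along orbits the components of \<open>f\<close> of degree other than
  \<open>g\<close> vanish: on degree \<open>a\<close> the action multiplies by
  \<open>G_char a h\<close>, and distinct characters differ at some \<open>h\<close>.\<close>

lemma B_comp_iff: "toB f \<in> B_comp \<alpha> \<beta> \<gamma> g \<longleftrightarrow> f - gproj g f \<in> kerB"
proof -
  have "toB f \<in> B_comp \<alpha> \<beta> \<gamma> g \<longleftrightarrow> (\<forall>h. free_act h f - scalar (G_char g h) * f \<in> kerB)"
    by (simp add: B_comp_def toB_simps(1) B_act_toB toB_simps(3)[symmetric] toB_eq_iff)
  also have "\<dots> \<longleftrightarrow> f - gproj g f \<in> kerB"
  proof
    assume *: "\<forall>h. free_act h f - scalar (G_char g h) * f \<in> kerB"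
    show "f - gproj g f \<in> kerB"
    proof (rule kerBI)
      fix p ys n a assume p: "p \<in> E" "orbit p ys"
      have "gev n a ys f = 0" if "a \<noteq> g"
      proof -
        obtain h where h: "G_char a h \<noteq> (G_char g h :: 'k)"
          using G_char_separates[OF two \<open>a \<noteq> g\<close>] by blast
        have "(G_char a h - G_char g h) * gev n a ys f = 0"
          using kerB_gev[OF *[rule_format, of h] p, of n a]
          by (simp add: gev_lin gev_free_act left_diff_distrib)
        with h show ?thesis by simp
      qed
      then show "gev n a ys (f - gproj g f) = 0"
        by (auto simp: gev_lin gev_gproj)
    qed
  next
    assume *: "f - gproj g f \<in> kerB"
    show "\<forall>h. free_act h f - scalar (G_char g h) * f \<in> kerB"
    proof (intro allI kerBI)
      fix h p ys n a assume p: "p \<in> E" "orbit p ys"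
      have "a = g \<or> gev n a ys f = 0"
        using kerB_gev[OF * p, of n a] by (auto simp: gev_lin gev_gproj split: if_splits)
      then show "gev n a ys (free_act h f - scalar (G_char g h) * f) = 0"
        by (auto simp: gev_lin gev_free_act)
    qed
  qed
  finally show ?thesis .
qed

lemma is_decomposition_gproj: "is_decomposition B (B_comp \<alpha> \<beta> \<gamma>) (toB f) (\<lambda>g. toB (gproj g f))"
  unfolding is_decomposition_def
proof (intro conjI allI)
  show "toB (gproj g f) \<in> B_comp \<alpha> \<beta> \<gamma> g" for g
    by (simp add: B_comp_iff gproj_gproj kerB_0)
  let ?A = "{g. toB (gproj g f) \<noteq> \<zero>\<^bsub>B\<^esub>}"
  show "finite ?A" by simp
  have "(\<Sum>g\<in>- ?A. gproj g f) \<in> kerB"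
    by (rule kerB_sum) (simp add: kerB_def)
  moreover have "(\<Sum>g\<in>UNIV. gproj g f) - (\<Sum>g\<in>?A. gproj g f) = (\<Sum>g\<in>- ?A. gproj g f)"
    by (simp add: sum_diff[symmetric] Compl_eq_Diff_UNIV)
  ultimately have "toB f = toB (\<Sum>g\<in>?A. gproj g f)"
    by (simp add: toB_eq_iff sum_gproj)
  also have "\<dots> = (\<Oplus>\<^bsub>B\<^esub>g\<in>?A. toB (gproj g f))"
    by (rule finsum_toB[symmetric]) simp
  finally show "toB f = (\<Oplus>\<^bsub>B\<^esub>g\<in>?A. toB (gproj g f))" .
qed

lemma decomposition_unique:
  assumes "is_decomposition B (B_comp \<alpha> \<beta> \<gamma>) (toB f) c"
  shows "c = (\<lambda>g. toB (gproj g f))"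
proof -
  have c: "c i \<in> B_comp \<alpha> \<beta> \<gamma> i" for i
    using assms unfolding is_decomposition_def by blast
  have "\<exists>e. c i = toB e" for i
  proof -
    have "c i \<in> carrier B"
      using c[of i] by (simp only: B_comp_def mem_Collect_eq)
    then show ?thesis
      unfolding carrier_B by blast
  qed
  then obtain e where e: "\<And>i. c i = toB (e i)"
    by metis
  let ?A = "{i. c i \<noteq> \<zero>\<^bsub>B\<^esub>}"
  have "toB f = (\<Oplus>\<^bsub>B\<^esub>i\<in>?A. toB (e i))"
    using assms unfolding is_decomposition_def e by blast
  then have "toB f = toB (\<Sum>i\<in>?A. e i)"
    by (simp add: finsum_toB)
  then have 1: "f - (\<Sum>i\<in>?A. e i) \<in> kerB"
    by (simp add: toB_eq_iff)
  have "(\<Sum>i\<in>- ?A. e i) \<in> kerB"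
    by (rule kerB_sum) (simp add: kerB_def e)
  moreover have "(\<Sum>i\<in>UNIV. e i) - (\<Sum>i\<in>?A. e i) = (\<Sum>i\<in>- ?A. e i)"
    by (simp add: sum_diff[symmetric] Compl_eq_Diff_UNIV)
  ultimately have "(\<Sum>i\<in>UNIV. e i) - (\<Sum>i\<in>?A. e i) \<in> kerB"
    by simp
  from kerB_diff[OF 1 this] have 2: "f - (\<Sum>i\<in>UNIV. e i) \<in> kerB"
    by simp
  have 3: "gev n a ys (e i) = 0" if "p \<in> E" "orbit p ys" "a \<noteq> i" for p ys n a i
  proof -
    have "e i - gproj i (e i) \<in> kerB"
      using c[of i] by (simp add: e B_comp_iff)
    from kerB_gev[OF this that(1,2), of n a] show ?thesis
      using that(3) by (simp add: gev_lin gev_gproj)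
  qed
  show ?thesis
  proof
    fix g
    have "e g - gproj g f \<in> kerB"
    proof (rule kerBI)
      fix p ys n a assume p: "p \<in> E" "orbit p ys"
      show "gev n a ys (e g - gproj g f) = 0"
      proof (cases "a = g")
        case True
        have "(\<Sum>i\<in>UNIV. gev n g ys (e i)) = (\<Sum>i\<in>UNIV. if i = g then gev n g ys (e g) else 0)"
          by (rule sum.cong) (auto intro: 3[OF p])
        then have "gev n g ys f = gev n g ys (e g)"
          using kerB_gev[OF 2 p, of n g] by (simp add: gev_lin)
        then show ?thesis
          using True by (simp add: gev_lin gev_gproj)
      next
        case False
        then show ?thesis
          using 3[OF p False] by (simp add: gev_lin gev_gproj)
      qed
    qed
    then show "c g = toB (gproj g f)"
      by (simp add: e toB_eq_iff)
  qed
qed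

lemma homogeneous_part_toB: "homogeneous_part B (B_comp \<alpha> \<beta> \<gamma>) (toB f) g = toB (gproj g f)"
proof -
  have "homogeneous_part B (B_comp \<alpha> \<beta> \<gamma>) (toB f) = (\<lambda>g. toB (gproj g f))"
    unfolding homogeneous_part_def
    by (rule the_equality) (rule is_decomposition_gproj, rule decomposition_unique)
  then show ?thesis by simp
qed

abbreviation "T \<equiv> twisted_B \<alpha> \<beta> \<gamma>"

lemma T_simps [simp]:
  "carrier T = carrier B" "\<one>\<^bsub>T\<^esub> = \<one>\<^bsub>B\<^esub>" "\<zero>\<^bsub>T\<^esub> = \<zero>\<^bsub>B\<^esub>" "x \<oplus>\<^bsub>T\<^esub> y = x \<oplus>\<^bsub>B\<^esub> y"
  by (simp_all add: twisted_B_def cocycle_twist_def)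

text \<open>Moves all computations in the twist to words; the ring axioms then pass from
  \<open>tmul\<close> to cosets.\<close>

lemma T_mult: "toB f \<otimes>\<^bsub>T\<^esub> toB g = toB (tmul f g)"
proof -
  have "toB f \<otimes>\<^bsub>T\<^esub> toB g = (\<Oplus>\<^bsub>B\<^esub>a\<in>UNIV. \<Oplus>\<^bsub>B\<^esub>b\<in>UNIV. toB (scalar (cocycle a b) * (gproj a f * gproj b g)))"
    by (simp add: twisted_B_def cocycle_twist_def homogeneous_part_toB toB_simps(3))
  then show ?thesis
    by (simp add: finsum_toB tmul_def)
qed

lemma ring_T: "ring T"
proof (rule ringI)
  interpret B: ring B by (rule ring_B)
  have "add_monoid T = add_monoid B"
    by (simp add: twisted_B_def cocycle_twist_def)
  moreover have "comm_group (add_monoid B)"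
    using B.a_comm_group .
  ultimately show "abelian_group T"
    by (intro comm_group_abelian_groupI) simp
  show "Group.monoid T"
    by (rule monoidI) (auto simp: carrier_B T_mult tmul_assoc toB_simps(4)[symmetric] tmul_1)
qed (auto simp: carrier_B T_mult toB_simps(2)[symmetric] tmul_add_left tmul_add_right)

section \<open>Primeness of the twist\<close>

lemma top_component:
  assumes "f \<notin> kerB"
  obtains n g where "hcomp n g f \<notin> kerB" "\<And>j v. j > n \<Longrightarrow> hcomp j v f \<in> kerB"
proof -
  define M where "M = {n. \<exists>g. hcomp n g f \<notin> kerB}"
  obtain N where N: "\<And>w. w \<in> keys f \<Longrightarrow> wlen w \<le> N"
    using wlen_bound by blast
  have "n \<le> N" if "n \<in> M" for n
    using that hcomp_beyond[OF N, where n = n] kerB_0 by (force simp: M_def not_le[symmetric])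
  then have fin: "finite M"
    by (metis finite_nat_set_iff_bounded_le)
  have "M \<noteq> {}"
    using assms kerBI_hcomp[of f] unfolding M_def by blast
  then have "Max M \<in> M"
    using fin by (rule Max_in[rotated])
  then obtain g where g: "hcomp (Max M) g f \<notin> kerB"
    by (auto simp: M_def)
  show ?thesis
    by (rule that[OF g]) (use Max_ge[OF fin] in \<open>force simp: M_def not_le[symmetric]\<close>)
qed

theorem tmul_prime:
  assumes "a \<notin> kerB" "b \<notin> kerB"
  shows "\<exists>c. tmul (tmul a c) b \<notin> kerB"
proof (rule ccontr)
  assume "\<nexists>c. tmul (tmul a c) b \<notin> kerB"
  then have ker: "tmul (tmul a c) b \<in> kerB" for c
    by blast
  obtain n g where a: "hcomp n g a \<notin> kerB" "\<And>j v. j > n \<Longrightarrow> hcomp j v a \<in> kerB"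
    using top_component[OF assms(1)] by blast
  obtain m g' where b: "hcomp m g' b \<notin> kerB" "\<And>j v. j > m \<Longrightarrow> hcomp j v b \<in> kerB"
    using top_component[OF assms(2)] by blast
  define Za where "Za = {p \<in> E. \<exists>ys. orbit p ys \<and> ev n ys (hcomp n g a) = 0}"
  define Zb where "Zb = {p \<in> E. \<exists>ys. orbit p ys \<and> ev m ys (hcomp m g' b) = 0}"
  define Zx where "Zx = {p \<in> E. \<exists>y\<in>p. \<not> good y}"
  \<comment> \<open>To be avoided: zeros of the chosen component of \<open>a\<close> at
    \<open>p\<close>, zeros of that of \<open>b\<close> at the point \<open>n + 1\<close> steps
    later, and points that are not \<open>good\<close> after \<open>n\<close> steps, where the
    inserted generator must not vanish.\<close>
  have "finite (Za \<union> {p \<in> E. (\<sigma> ^^ n) p \<in> Zx} \<union> {p \<in> E. (\<sigma> ^^ Suc n) p \<in> Zb})"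
    unfolding Za_def Zb_def Zx_def
    using finite_zeros[OF hcomp_free_deg] a(1) b(1) finite_not_good finite_preimage by (intro finite_UnI) blast+
  then have "infinite (E - (Za \<union> {p \<in> E. (\<sigma> ^^ n) p \<in> Zx} \<union> {p \<in> E. (\<sigma> ^^ Suc n) p \<in> Zb}))"
    using infinite_E by (rule Diff_infinite_finite)
  then have "E - (Za \<union> {p \<in> E. (\<sigma> ^^ n) p \<in> Zx} \<union> {p \<in> E. (\<sigma> ^^ Suc n) p \<in> Zb}) \<noteq> {}"
    by (rule infinite_imp_nonempty)
  then obtain p where p: "p \<in> E" "p \<notin> Za" "(\<sigma> ^^ n) p \<notin> Zx" "(\<sigma> ^^ Suc n) p \<notin> Zb"
    by blast
  obtain y where "y \<in> p"
    using point_nonempty[OF p(1)] by blast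
  then obtain ys where ys: "orbit p ys"
    using orbit_exists[OF p(1)] by blast
  have orb: "orbit ((\<sigma> ^^ i) p) (shift i ys)" for i
    using ys by (simp add: orbit_def shift_apply funpow_add[symmetric, unfolded o_def, THEN fun_cong] add.commute[of i])
  have A: "gev n g ys a \<noteq> 0"
    using p(1,2) ys by (auto simp: Za_def ev_hcomp)
  have Bnz: "gev m g' (shift (Suc n) ys) b \<noteq> 0"
    using p(4) orb[of "Suc n"] pow_in_E[OF p(1), of "Suc n"] unfolding Zb_def ev_hcomp by blast
  have "ys n \<in> (\<sigma> ^^ n) p"
    using ys by (simp add: orbit_def)
  then have ynz: "ys n l \<noteq> 0" for l
    using p(3) pow_in_E[OF p(1), of n] good_nz by (auto simp: Zx_def)
  have ta: "gev j v ys a = 0" if "j > n" for j v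
    using kerB_gev[OF a(2)[OF that, of v] p(1) ys, of j v] by (simp add: gev_hcomp)
  have tb: "gev j v (shift i ys) b = 0" if "j > m" for j i v
    using kerB_gev[OF b(2)[OF that, of v] pow_in_E[OF p(1)] orb, of j v] by (simp add: gev_hcomp)
  \<comment> \<open>The total degree is chosen so that the term for \<open>v = g\<close> pairs the
    component \<open>g\<close> of \<open>a\<close> with the component \<open>g'\<close> of
    \<open>b\<close>.\<close>
  define d where "d = gadd g g'"
  define t where "t v = cocycle v (gadd v d) * (gev n v ys a * gev m (gadd v d) (shift (Suc n) ys) b)" for v
  have "(\<Sum>v\<in>UNIV. G_char h v * t v) = 0" for h
  proof -
    \<comment> \<open>The four generators realise all four degrees, so every character of G is
      available.\<close>
    obtain l where l: "gdeg l = h"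
      using gdeg.simps by (metis (full_types) surj_pair)
    have "ys n l * cocycle h d * (\<Sum>v\<in>UNIV. G_char h v * t v) = 0"
      using gev_top[OF ta tb, where l = l and d = d] kerB_gev[OF ker p(1) ys] by (simp add: l t_def)
    then show ?thesis
      using ynz by simp
  qed
  from characters_independent[OF two this, of g] have "t g = 0" .
  then show False
    using A Bnz by (simp add: t_def d_def)
qed

theorem prime_T: "prime_ring T"
  unfolding prime_ring_def
proof (intro conjI allI impI)
  show "ring T" by (rule ring_T)
  show "\<one>\<^bsub>T\<^esub> \<noteq> \<zero>\<^bsub>T\<^esub>"
  proof
    assume "\<one>\<^bsub>T\<^esub> = \<zero>\<^bsub>T\<^esub>"
    then have "1 \<in> kerB"
      by (simp add: kerB_def toB_simps)
    obtain p where p: "p \<in> E"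
      using infinite_E infinite_imp_nonempty by blast
    then obtain ys where "orbit p ys"
      using orbit_exists point_nonempty by metis
    from kerB_gev[OF \<open>1 \<in> kerB\<close> p this, of 0 gzero] show False
      by (simp add: single_0_1 gev_single del: single_one)
  qed
  fix I J assume I: "ideal I T" and J: "ideal J T" and IJ: "I \<cdot>\<^bsub>T\<^esub> J = {\<zero>\<^bsub>T\<^esub>}"
  show "I = {\<zero>\<^bsub>T\<^esub>} \<or> J = {\<zero>\<^bsub>T\<^esub>}"
  proof (rule ccontr)
    assume n: "\<not> (I = {\<zero>\<^bsub>T\<^esub>} \<or> J = {\<zero>\<^bsub>T\<^esub>})"
    have "\<zero>\<^bsub>T\<^esub> \<in> I" "\<zero>\<^bsub>T\<^esub> \<in> J"
      using I J additive_subgroup.zero_closed ideal.axioms(1) by blast+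
    then obtain x y where xy: "x \<in> I" "x \<noteq> \<zero>\<^bsub>T\<^esub>" "y \<in> J" "y \<noteq> \<zero>\<^bsub>T\<^esub>"
      using n by blast
    then have "x \<in> carrier B" "y \<in> carrier B"
      using ideal.Icarr[OF I] ideal.Icarr[OF J] by auto
    then obtain a b where ab: "x = toB a" "y = toB b"
      by (auto simp: carrier_B)
    then have "a \<notin> kerB" "b \<notin> kerB"
      using xy by (auto simp: kerB_def)
    then obtain c where c: "tmul (tmul a c) b \<notin> kerB"
      using tmul_prime by blast
    have "x \<otimes>\<^bsub>T\<^esub> toB c \<in> I"
      using ideal.I_r_closed[OF I xy(1)] toB_simps(1) by simp
    from ideal_prod.prod[OF this xy(3), of T] have "toB (tmul (tmul a c) b) = \<zero>\<^bsub>B\<^esub>"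
      unfolding IJ by (simp add: ab T_mult)
    with c show False
      by (simp add: kerB_def)
  qed
qed

end

theorem corollary5p3p21:
  fixes \<alpha> \<beta> \<gamma> :: "'k::alg_closed_field"
    and \<sigma> :: "'k proj_point \<Rightarrow> 'k proj_point"
  assumes "CHAR('k) \<noteq> 2"
    and "sklyanin_parameters \<alpha> \<beta> \<gamma>"
    and "is_skl_automorphism \<alpha> \<beta> \<gamma> \<sigma>"
    and "infinite_order_on (skl_curve \<alpha> \<beta> \<gamma>) \<sigma>"
  shows "prime_ring (twisted_B \<alpha> \<beta> \<gamma>)"
proof -
  have two: "(2::'k) \<noteq> 0"
  proof
    assume "(2::'k) = 0"
    then have "CHAR('k) dvd 2"
      using of_nat_eq_0_iff_char_dvd[where 'a = 'k, of 2] by simp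
    moreover have "CHAR('k) \<noteq> 1"
      using CHAR_not_1[where 'a = 'k] by simp
    ultimately show False
      using assms(1) two_is_prime_nat prime_nat_iff by blast
  qed
  interpret skl_params \<alpha> \<beta> \<gamma>
    by unfold_locales (use two assms(2) in auto)
  interpret skl_twist \<alpha> \<beta> \<gamma> \<sigma>
  proof
    show "bij_betw \<sigma> E E"
      using assms(3) by (simp add: is_skl_automorphism_def)
    show "related y z" if "p \<in> E" "y \<in> p" "z \<in> \<sigma> p" for p y z
      using automorphism_related[OF assms(3) that] .
  qed
  show ?thesis
    by (rule prime_T)
qed

end
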